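(* Let $R_0>0$ and $B_{R_0}:=\{u\in D(A^{1/2}):|u|_{D(A^{1/2})}<R_0\}$. Assume that the spectrum of $A$ is a finite or countable set of eigenvalues without finite accumulation points. Let $f:B_{R_0}\to H$ satisfy $f(0)=0$, and assume there exist $p>0$ and $L\ge0$ such that for all $u,v\in B_{R_0}$ $$|f(u)-f(v)|\le L\left(|u|^p_{D(A^{1/2})}+|v|^p_{D(A^{1/2})}\right)|u-v|_{D(A^{1/2})}.$$ Then for every $r_0\in\mathcal D$ with $r_0>0$ there exists $\varepsilon_0>0$ with the following property. Let $(v_0,v_1)\in D(A^{1/2})\times H$ be an $r_0$-pure pair and $(z_0,z_1)\in D(A^{1/2})\times H$ an $r_0$-fast pair, with $$|v_1|+|v_0|_{D(A^{1/2})}+|z_1|+|z_0|_{D(A^{1/2})}\le\varepsilon_0.$$ Then there exists an $r_0$-slow pair $(w_0,w_1)\in D(A^{1/2})\times H$ such that the equation $u''+2\delta u'+Au=f(u)$ with initial data $u(0)=v_0+z_0+w_0$, $u'(0)=v_1+z_1+w_1$ has a global solution $u$ satisfying $$\lim_{t\to+\infty}\left(|u'(t)-v'(t)|+|u(t)-v(t)|_{D(A^{1/2})}\right)e^{r_0t}=0.$$ Here $v$ is the ($r_0$-pure) solution of $v''+2\delta v'+Av=0$ with $v(0)=v_0$, $v'(0)=v_1$.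
   Context: $H$ is a separable real Hilbert space with norm $|\cdot|$ and scalar product $\langle\cdot,\cdot\rangle$. $A$ is a self-adjoint nonnegative linear operator on $H$ with dense domain $D(A)$. For $\alpha\ge0$, $D(A^\alpha)$ carries the norm $|u|_{D(A^\alpha)}=(|u|^2+|A^\alpha u|^2)^{1/2}$. The constant $\delta>0$ is fixed. Assume the spectrum $\sigma(A)$ is a finite or countable set of eigenvalues without finite accumulation points. Then $H$ has an orthonormal basis $\{e_k\}_{k\in\mathcal K}$ of eigenvectors, $Ae_k=\lambda_ke_k$; eigenvalues may be repeated. **The set $\mathcal{D}$.** $\mathcal{D}:=\{\mathrm{Re}(z): z\in\mathbb{C},\ z^2-2\delta z+\lambda=0 \text{ for some }\lambda\in\sigma(A)\}$. This is a finite set. **Linear solutions.** For $g\in C^0([0,\infty),H)$ and data in $D(A^{1/2})\times H$, the equation $u''+2\delta u'+Au=g$ has a unique weak solution in $C^0([0,\infty),D(A^{1/2}))\cap C^1([0,\infty),H)$. **Solutions of the semilinear equation.** A global solution of $u''+2\delta u'+Au=f(u)$ is such a weak solution with $g(t)=f(u(t))$, where $u(t)\in B_{R_0}$ for all $t\ge0$. **Decomposition of homogeneous solutions.** Let $u$ solve $u''+2\delta u'+Au=0$ and write $u_k=\langle u,e_k\rangle$. - If $\lambda_k\ge\delta^2$, the whole mode $u_k(t)e_k$ is assigned to $r=\delta$. - If $\lambda_k<\delta^2$, then $u_k=a_ke^{-r_{1,k}t}+b_ke^{-r_{2,k}t}$ with $r_{1,k}=\delta-\sqrt{\delta^2-\lambda_k}$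 and $r_{2,k}=\delta+\sqrt{\delta^2-\lambda_k}$. The first term is assigned to $r_{1,k}$ and the second to $r_{2,k}$. For $r\in\mathcal D$, $u_r$ is the sum of all pieces assigned to $r$, so that $u=\sum_{r\in\mathcal D}u_r$. For $r_0\in\mathcal{D}$, the solution $u$ is called: - $r_0$-fast if $u_r\equiv0$ for all $r\le r_0$; - $r_0$-slow if $u_r\equiv0$ for all $r>r_0$; - $r_0$-pure if $u_r\equiv0$ for all $r\ne r_0$. A pair of initial data is called $r_0$-fast (respectively $r_0$-slow, $r_0$-pure) if the corresponding homogeneous solution is. *)

theory Defs
  imports "HOL-Analysis.Analysis"
begin

text \<open>The operator A is represented through its spectral data: an orthonormal basis
  e k (k in the countable index set K, subset of nat) of eigenvectors with eigenvalues lam k,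
  so that A e k = lam k e k.  Everything is parametrised by (lam, e, K) and the damping delta.\<close>

definition onb :: "(nat \<Rightarrow> 'a::{real_inner,complete_space}) \<Rightarrow> nat set \<Rightarrow> bool" where
  "onb e K \<longleftrightarrow>
     (\<forall>i\<in>K. \<forall>j\<in>K. inner (e i) (e j) = (if i = j then 1 else 0)) \<and>
     (\<forall>x. ((\<lambda>k. inner x (e k) *\<^sub>R e k) has_sum x) K)"

definition spec :: "(nat \<Rightarrow> real) \<Rightarrow> nat set \<Rightarrow> real set" where
  "spec lam K = lam ` K"

definition halfsq :: "(nat \<Rightarrow> real) \<Rightarrow> (nat \<Rightarrow> 'a::{real_inner,complete_space}) \<Rightarrow> nat set \<Rightarrow> 'a \<Rightarrow> real" where
  "halfsq lam e K u = infsum (\<lambda>k. lam k * (inner u (e k))\<^sup>2) K"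

definition D12 :: "(nat \<Rightarrow> real) \<Rightarrow> (nat \<Rightarrow> 'a::{real_inner,complete_space}) \<Rightarrow> nat set \<Rightarrow> 'a set" where
  "D12 lam e K = {u. (\<lambda>k. lam k * (inner u (e k))\<^sup>2) summable_on K}"

definition dnorm :: "(nat \<Rightarrow> real) \<Rightarrow> (nat \<Rightarrow> 'a::{real_inner,complete_space}) \<Rightarrow> nat set \<Rightarrow> 'a \<Rightarrow> real" where
  "dnorm lam e K u = sqrt ((norm u)\<^sup>2 + halfsq lam e K u)"

definition ballD :: "(nat \<Rightarrow> real) \<Rightarrow> (nat \<Rightarrow> 'a::{real_inner,complete_space}) \<Rightarrow> nat set \<Rightarrow> real \<Rightarrow> 'a set" where
  "ballD lam e K R = {u \<in> D12 lam e K. dnorm lam e K u < R}"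

definition Dset :: "real \<Rightarrow> (nat \<Rightarrow> real) \<Rightarrow> nat set \<Rightarrow> real set" where
  "Dset \<delta> lam K = {Re z | z. \<exists>l \<in> spec lam K.
      z\<^sup>2 - 2 * complex_of_real \<delta> * z + complex_of_real l = 0}"

text \<open>Weak solution (u, u') of u'' + 2 delta u' + A u = g on [0,\<infinity>):
  u in C^0([0,\<infinity>), D(A^{1/2})), u in C^1([0,\<infinity>), H) with derivative u', and the
  equation holds tested against every eigenvector e_k (equivalently, against all of D(A^{1/2})).\<close>
definition weak_sol :: "real \<Rightarrow> (nat \<Rightarrow> real) \<Rightarrow> (nat \<Rightarrow> 'a::{real_inner,complete_space}) \<Rightarrow> nat set
    \<Rightarrow> (real \<Rightarrow> 'a) \<Rightarrow> (real \<Rightarrow> 'a) \<Rightarrow> (real \<Rightarrow> 'a) \<Rightarrow> bool" where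
  "weak_sol \<delta> lam e K g u u' \<longleftrightarrow>
     (\<forall>t\<ge>0. u t \<in> D12 lam e K) \<and>
     (\<forall>t\<ge>0. ((\<lambda>s. dnorm lam e K (u s - u t)) \<longlongrightarrow> 0) (at t within {0..})) \<and>
     (\<forall>t\<ge>0. (u has_vector_derivative u' t) (at t within {0..})) \<and>
     continuous_on {0..} u' \<and>
     (\<forall>k\<in>K. \<forall>t\<ge>0. ((\<lambda>s. inner (u' s) (e k)) has_real_derivative
          (inner (g t) (e k) - 2 * \<delta> * inner (u' t) (e k) - lam k * inner (u t) (e k)))
          (at t within {0..}))"

definition piece_coef :: "real \<Rightarrow> (nat \<Rightarrow> real) \<Rightarrow> (nat \<Rightarrow> 'a::{real_inner,complete_space})
    \<Rightarrow> (real \<Rightarrow> 'a) \<Rightarrow> (real \<Rightarrow> 'a) \<Rightarrow> real \<Rightarrow> nat \<Rightarrow> real \<Rightarrow> real" where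
  "piece_coef \<delta> lam e u u' r k t =
     (if lam k \<ge> \<delta>\<^sup>2 then (if r = \<delta> then inner (u t) (e k) else 0)
      else
        (let s = sqrt (\<delta>\<^sup>2 - lam k); r1 = \<delta> - s; r2 = \<delta> + s;
             x = inner (u 0) (e k); y = inner (u' 0) (e k);
             a = (r2 * x + y) / (r2 - r1); b = - (r1 * x + y) / (r2 - r1)
         in (if r = r1 then a * exp (- r1 * t) else 0) + (if r = r2 then b * exp (- r2 * t) else 0)))"

definition comp :: "real \<Rightarrow> (nat \<Rightarrow> real) \<Rightarrow> (nat \<Rightarrow> 'a::{real_inner,complete_space}) \<Rightarrow> nat set
    \<Rightarrow> (real \<Rightarrow> 'a) \<Rightarrow> (real \<Rightarrow> 'a) \<Rightarrow> real \<Rightarrow> real \<Rightarrow> 'a" where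
  "comp \<delta> lam e K u u' r t = infsum (\<lambda>k. piece_coef \<delta> lam e u u' r k t *\<^sub>R e k) K"

definition vanishes :: "real \<Rightarrow> (nat \<Rightarrow> real) \<Rightarrow> (nat \<Rightarrow> 'a::{real_inner,complete_space}) \<Rightarrow> nat set
    \<Rightarrow> (real \<Rightarrow> 'a) \<Rightarrow> (real \<Rightarrow> 'a) \<Rightarrow> real \<Rightarrow> bool" where
  "vanishes \<delta> lam e K u u' r \<longleftrightarrow> (\<forall>t\<ge>0. comp \<delta> lam e K u u' r t = 0)"

definition fast_sol where
  "fast_sol \<delta> lam e K u u' r0 \<longleftrightarrow> (\<forall>r \<in> Dset \<delta> lam K. r \<le> r0 \<longrightarrow> vanishes \<delta> lam e K u u' r)"
definition slow_sol where
  "slow_sol \<delta> lam e K u u' r0 \<longleftrightarrow> (\<forall>r \<in> Dset \<delta> lam K. r > r0 \<longrightarrow> vanishes \<delta> lam e K u u' r)"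
definition pure_sol where
  "pure_sol \<delta> lam e K u u' r0 \<longleftrightarrow> (\<forall>r \<in> Dset \<delta> lam K. r \<noteq> r0 \<longrightarrow> vanishes \<delta> lam e K u u' r)"

definition hom_sol :: "real \<Rightarrow> (nat \<Rightarrow> real) \<Rightarrow> (nat \<Rightarrow> 'a::{real_inner,complete_space}) \<Rightarrow> nat set
    \<Rightarrow> 'a \<Rightarrow> 'a \<Rightarrow> (real \<Rightarrow> 'a) \<Rightarrow> (real \<Rightarrow> 'a) \<Rightarrow> bool" where
  "hom_sol \<delta> lam e K x0 x1 u u' \<longleftrightarrow>
     weak_sol \<delta> lam e K (\<lambda>_. 0) u u' \<and> u 0 = x0 \<and> u' 0 = x1"

text \<open>Pairs of initial data in D(A^{1/2}) x H; the property refers to the (unique) corresponding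
  homogeneous solution.\<close>
definition fast_pair where
  "fast_pair \<delta> lam e K r0 x0 x1 \<longleftrightarrow> x0 \<in> D12 lam e K \<and>
     (\<forall>u u'. hom_sol \<delta> lam e K x0 x1 u u' \<longrightarrow> fast_sol \<delta> lam e K u u' r0)"
definition slow_pair where
  "slow_pair \<delta> lam e K r0 x0 x1 \<longleftrightarrow> x0 \<in> D12 lam e K \<and>
     (\<forall>u u'. hom_sol \<delta> lam e K x0 x1 u u' \<longrightarrow> slow_sol \<delta> lam e K u u' r0)"
definition pure_pair where
  "pure_pair \<delta> lam e K r0 x0 x1 \<longleftrightarrow> x0 \<in> D12 lam e K \<and>
     (\<forall>u u'. hom_sol \<delta> lam e K x0 x1 u u' \<longrightarrow> pure_sol \<delta> lam e K u u' r0)"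

definition global_sol where
  "global_sol \<delta> lam e K f R0 u u' \<longleftrightarrow>
     weak_sol \<delta> lam e K (\<lambda>t. f (u t)) u u' \<and> (\<forall>t\<ge>0. u t \<in> ballD lam e K R0)"

end

theory Submission
  imports Defs
begin

text \<open>
  A Lyapunov--Perron argument, carried out mode by mode. Given a forcing \<open>F\<close> decaying faster than
  \<open>e\<^bsup>-r\<^sub>0t\<^esup>\<close>, the equation \<open>u'' + 2\<delta>u' + Au = F\<close> has a solution of the form \<open>v + z + W F\<close>, where \<open>W F\<close> is
  obtained by integrating the pieces with rate at most \<open>r\<^sub>0\<close> from infinity and the others from 0; it decays
  faster than \<open>e\<^bsup>-r\<^sub>0t\<^esup>\<close> and its initial data are slow. Since \<open>f\<close> has order \<open>1 + p\<close> at 0, the map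
  \<open>F \<mapsto> f (v + z + W F)\<close> is a contraction for small data in a weighted space of forcings, and its fixed
  point gives the solution. The diagonal structure bounds every mode by a square summable sequence
  uniformly in time, so vector-valued continuity and differentiability follow from dominated convergence
  in the sequence space.
\<close>

section \<open>A single mode\<close>

text \<open>The unknown is the forcing rather than the solution. A forcing is only a continuous
  function into the whole space with an exponential bound, so after rescaling it ranges over a
  closed ball of bounded continuous functions, which is complete; the regularity in the domain of
  the square root of A is supplied by \<open>W\<close>. This gain must be uniform in the mode. For
  large eigenvalues the weight \<open>sqrt (1 + l)\<close> is absorbed by the denominator of the
  oscillating kernel; below \<open>\<delta>\<^sup>2\<close> there are only finitely many
  eigenvalues, so the two rates of a mode keep a positive distance. Discreteness also makes the set
  of rates finite and leaves a gap above \<open>r0\<close>. Four exponents are ordered as \<rho> <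
  \<open>r0\<close> < \<open>sg\<close> < \<sigma> = (1 + p)\<rho>: solutions are controlled at the
  rate \<rho>, forcings at \<sigma>, and \<open>sg\<close>, placed below the next rate after
  \<open>r0\<close>, controls both the fast data and \<open>W F\<close>. The inequality
  \<open>sg\<close> < \<sigma> makes the integrals from infinity converge, and \<open>sg\<close> >
  \<open>r0\<close> gives the limit in the theorem.\<close>

definition rates :: "real \<Rightarrow> real \<Rightarrow> real set" where
  "rates \<delta> l = (if l \<ge> \<delta>\<^sup>2 then {\<delta>} else {\<delta> - sqrt (\<delta>\<^sup>2 - l), \<delta> + sqrt (\<delta>\<^sup>2 - l)})"

text \<open>The impulse response when both characteristic roots have real part \<delta>. At the
  double root the quotient of sine by frequency becomes its limit t, which is the source of the
  polynomial factor in the estimates.\<close>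

definition osc :: "real \<Rightarrow> real \<Rightarrow> real \<Rightarrow> real" where
  "osc \<delta> l t = exp (- \<delta> * t) *
     (if l = \<delta>\<^sup>2 then t else sin (sqrt (l - \<delta>\<^sup>2) * t) / sqrt (l - \<delta>\<^sup>2))"

definition cosc :: "real \<Rightarrow> real \<Rightarrow> real \<Rightarrow> real" where
  "cosc \<delta> l t = exp (- \<delta> * t) * cos (sqrt (l - \<delta>\<^sup>2) * t)"

text \<open>With every rate admitted, \<open>fund\<close> is the solution of \<open>P'' + 2\<delta>P' + lP = 0\<close> with \<open>P(0) = 0\<close>,
  \<open>P'(0) = 1\<close>; the predicate \<open>Q\<close> keeps only the pieces whose rate satisfies it.\<close>

definition fund :: "real \<Rightarrow> real \<Rightarrow> (real \<Rightarrow> bool) \<Rightarrow> real \<Rightarrow> real" where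
  "fund \<delta> l Q t =
     (if l \<ge> \<delta>\<^sup>2 then (if Q \<delta> then osc \<delta> l t else 0)
      else let s = sqrt (\<delta>\<^sup>2 - l) in
        (if Q (\<delta> - s) then exp (- (\<delta> - s) * t) / (2 * s) else 0)
        - (if Q (\<delta> + s) then exp (- (\<delta> + s) * t) / (2 * s) else 0))"

definition dfund :: "real \<Rightarrow> real \<Rightarrow> (real \<Rightarrow> bool) \<Rightarrow> real \<Rightarrow> real" where
  "dfund \<delta> l Q t =
     (if l \<ge> \<delta>\<^sup>2 then (if Q \<delta> then cosc \<delta> l t - \<delta> * osc \<delta> l t else 0)
      else let s = sqrt (\<delta>\<^sup>2 - l) in
        - (if Q (\<delta> - s) then (\<delta> - s) * exp (- (\<delta> - s) * t) / (2 * s) else 0)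
        + (if Q (\<delta> + s) then (\<delta> + s) * exp (- (\<delta> + s) * t) / (2 * s) else 0))"

text \<open>The solution with data \<open>(x, y)\<close> is \<open>x(P' + 2\<delta>P) + yP\<close>, and the same formula applied to a piece of \<open>P\<close>
  gives the corresponding piece of the solution.\<close>

definition flow :: "real \<Rightarrow> real \<Rightarrow> (real \<Rightarrow> bool) \<Rightarrow> real \<Rightarrow> real \<Rightarrow> real \<Rightarrow> real" where
  "flow \<delta> l Q x y t = x * (dfund \<delta> l Q t + 2 * \<delta> * fund \<delta> l Q t) + y * fund \<delta> l Q t"

definition dflow :: "real \<Rightarrow> real \<Rightarrow> (real \<Rightarrow> bool) \<Rightarrow> real \<Rightarrow> real \<Rightarrow> real \<Rightarrow> real" where
  "dflow \<delta> l Q x y t = y * dfund \<delta> l Q t - l * x * fund \<delta> l Q t"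

abbreviation anyrate :: "real \<Rightarrow> bool" where
  "anyrate \<equiv> \<lambda>_. True"

lemma osc_deriv:
  assumes "l \<ge> \<delta>\<^sup>2"
  shows "(osc \<delta> l has_real_derivative (cosc \<delta> l t - \<delta> * osc \<delta> l t)) (at t)"
proof (cases "l = \<delta>\<^sup>2")
  case True
  have "((\<lambda>t. exp (- \<delta> * t) * t) has_real_derivative (cosc \<delta> l t - \<delta> * osc \<delta> l t)) (at t)"
    by (auto intro!: derivative_eq_intros simp: cosc_def osc_def True algebra_simps)
  then show ?thesis by (simp add: osc_def[abs_def] True)
next
  case False
  define w where "w = sqrt (l - \<delta>\<^sup>2)"
  have w: "w > 0" using False assms unfolding w_def by simp
  have "((\<lambda>t. exp (- \<delta> * t) * (sin (w * t) * (1 / w))) has_real_derivative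
      (exp (- \<delta> * t) * (- \<delta>)) * (sin (w * t) * (1 / w)) + exp (- \<delta> * t) * (cos (w * t) * w * (1 / w))) (at t)"
    using w by (auto intro!: derivative_eq_intros simp: diff_divide_distrib)
  also have "(exp (- \<delta> * t) * (- \<delta>)) * (sin (w * t) * (1 / w)) + exp (- \<delta> * t) * (cos (w * t) * w * (1 / w))
     = cosc \<delta> l t - \<delta> * osc \<delta> l t"
    using w False by (simp add: cosc_def osc_def w_def[symmetric] field_simps)
  finally show ?thesis by (simp add: osc_def[abs_def] False w_def)
qed

lemma cosc_deriv:
  assumes "l \<ge> \<delta>\<^sup>2"
  shows "(cosc \<delta> l has_real_derivative (- \<delta> * cosc \<delta> l t - (l - \<delta>\<^sup>2) * osc \<delta> l t)) (at t)"
proof (cases "l = \<delta>\<^sup>2")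
  case True
  show ?thesis unfolding cosc_def[abs_def] osc_def True
    by (auto intro!: derivative_eq_intros simp: algebra_simps)
next
  case False
  define w where "w = sqrt (l - \<delta>\<^sup>2)"
  have w: "w > 0" "l - \<delta>\<^sup>2 = w * w" using assms False unfolding w_def by auto
  then show ?thesis unfolding cosc_def[abs_def] osc_def w_def[symmetric]
    using False by (auto intro!: derivative_eq_intros simp: algebra_simps)
qed

lemma osc_add:
  assumes "l \<ge> \<delta>\<^sup>2"
  shows "osc \<delta> l (t + s) = osc \<delta> l s * cosc \<delta> l t + cosc \<delta> l s * osc \<delta> l t"
    and "cosc \<delta> l (t + s) = cosc \<delta> l s * cosc \<delta> l t - (l - \<delta>\<^sup>2) * (osc \<delta> l s * osc \<delta> l t)"
proof -
  define w where "w = sqrt (l - \<delta>\<^sup>2)"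
  have w: "w \<ge> 0" "l - \<delta>\<^sup>2 = w * w" using assms unfolding w_def by auto
  have E: "exp (- \<delta> * (t + s)) = exp (- \<delta> * t) * exp (- \<delta> * s)"
    by (simp add: exp_add[symmetric] algebra_simps)
  show "osc \<delta> l (t + s) = osc \<delta> l s * cosc \<delta> l t + cosc \<delta> l s * osc \<delta> l t"
    unfolding osc_def cosc_def w_def[symmetric] E distrib_left[of w] sin_add cos_add
    by (cases "l = \<delta>\<^sup>2") (simp_all add: algebra_simps add_divide_distrib w_def)
  show "cosc \<delta> l (t + s) = cosc \<delta> l s * cosc \<delta> l t - (l - \<delta>\<^sup>2) * (osc \<delta> l s * osc \<delta> l t)"
  proof (cases "l = \<delta>\<^sup>2")
    case True
    then show ?thesis unfolding cosc_def E by simp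
  next
    case False
    then have "w > 0" using assms by (simp add: w_def)
    then have o: "w * osc \<delta> l t = exp (- \<delta> * t) * sin (w * t)" for t
      unfolding osc_def w_def[symmetric] using False by simp
    have "(l - \<delta>\<^sup>2) * (osc \<delta> l s * osc \<delta> l t) = (w * osc \<delta> l s) * (w * osc \<delta> l t)"
      unfolding w(2) by (simp only: ac_simps)
    then have "(l - \<delta>\<^sup>2) * (osc \<delta> l s * osc \<delta> l t)
       = exp (- \<delta> * t) * exp (- \<delta> * s) * (sin (w * t) * sin (w * s))"
      unfolding o by simp
    then show ?thesis
      unfolding cosc_def w_def[symmetric] E distrib_left[of w] cos_add by (simp add: algebra_simps)
  qed
qed

text \<open>The first bound survives as the frequency tends to 0, at the price of a factor |t|. The
  second keeps the inverse frequency, which for large \<open>l\<close> pays for the weight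
  \<open>sqrt (1 + l)\<close>.\<close>

lemma osc_bounds:
  assumes "l \<ge> \<delta>\<^sup>2"
  shows "\<bar>osc \<delta> l t\<bar> \<le> \<bar>t\<bar> * exp (- \<delta> * t)"
    and "l \<noteq> \<delta>\<^sup>2 \<Longrightarrow> \<bar>osc \<delta> l t\<bar> \<le> exp (- \<delta> * t) / sqrt (l - \<delta>\<^sup>2)"
    and "\<bar>cosc \<delta> l t\<bar> \<le> exp (- \<delta> * t)"
proof -
  define w where "w = sqrt (l - \<delta>\<^sup>2)"
  have w: "w \<ge> 0" using assms unfolding w_def by auto
  show "\<bar>osc \<delta> l t\<bar> \<le> \<bar>t\<bar> * exp (- \<delta> * t)"
  proof (cases "l = \<delta>\<^sup>2")
    case True
    then show ?thesis unfolding osc_def by (simp add: abs_mult)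
  next
    case False
    then have "w > 0" using w assms w_def by auto
    moreover have "\<bar>sin (w * t)\<bar> \<le> \<bar>w * t\<bar>" by (rule abs_sin_x_le_abs_x)
    ultimately have "\<bar>sin (w * t) / w\<bar> \<le> \<bar>t\<bar>" by (simp add: abs_mult field_simps)
    then have "exp (- \<delta> * t) * \<bar>sin (w * t) / w\<bar> \<le> exp (- \<delta> * t) * \<bar>t\<bar>" by (intro mult_left_mono) auto
    then show ?thesis unfolding osc_def w_def[symmetric] using False by (simp add: abs_mult mult.commute)
  qed
  show "\<bar>osc \<delta> l t\<bar> \<le> exp (- \<delta> * t) / sqrt (l - \<delta>\<^sup>2)" if "l \<noteq> \<delta>\<^sup>2"
  proof -
    have "w > 0" using that w assms w_def by auto
    then show ?thesis unfolding osc_def w_def[symmetric] using that abs_sin_le_one[of "w * t"]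
      by (simp add: abs_mult divide_simps)
  qed
  show "\<bar>cosc \<delta> l t\<bar> \<le> exp (- \<delta> * t)" unfolding cosc_def by (simp add: abs_mult)
qed

text \<open>Each exponential, and the oscillating piece as a whole, solves the homogeneous equation
  by itself, so every selection of pieces does.\<close>

lemma fund_deriv:
  "(fund \<delta> l Q has_real_derivative dfund \<delta> l Q t) (at t)"
  "(dfund \<delta> l Q has_real_derivative (- 2 * \<delta> * dfund \<delta> l Q t - l * fund \<delta> l Q t)) (at t)"
proof -
  have "(fund \<delta> l Q has_real_derivative dfund \<delta> l Q t) (at t) \<and>
     (dfund \<delta> l Q has_real_derivative (- 2 * \<delta> * dfund \<delta> l Q t - l * fund \<delta> l Q t)) (at t)"
  proof (cases "l \<ge> \<delta>\<^sup>2")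
    case True
    show ?thesis
    proof (cases "Q \<delta>")
      case Q: True
      have 1: "fund \<delta> l Q = osc \<delta> l" "dfund \<delta> l Q = (\<lambda>t. cosc \<delta> l t - \<delta> * osc \<delta> l t)"
        using True Q by (auto simp: fund_def dfund_def fun_eq_iff)
      show ?thesis unfolding 1
        by (auto intro!: derivative_eq_intros osc_deriv[OF True] cosc_deriv[OF True]
            simp: algebra_simps power2_eq_square)
    next
      case Q: False
      have 1: "fund \<delta> l Q = (\<lambda>_. 0)" "dfund \<delta> l Q = (\<lambda>_. 0)"
        using True Q by (auto simp: fund_def dfund_def fun_eq_iff)
      show ?thesis unfolding 1 by auto
    qed
  next
    case False
    define s where "s = sqrt (\<delta>\<^sup>2 - l)"
    have s: "s > 0" "l = \<delta>\<^sup>2 - s\<^sup>2" using False unfolding s_def by auto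
    define a where "a = (if Q (\<delta> - s) then 1 else 0 :: real)"
    define b where "b = (if Q (\<delta> + s) then 1 else 0 :: real)"
    have 1: "fund \<delta> l Q = (\<lambda>t. a * exp (- (\<delta> - s) * t) / (2 * s) - b * exp (- (\<delta> + s) * t) / (2 * s))"
      "dfund \<delta> l Q = (\<lambda>t. - a * (\<delta> - s) * exp (- (\<delta> - s) * t) / (2 * s)
          + b * (\<delta> + s) * exp (- (\<delta> + s) * t) / (2 * s))"
      using False by (auto simp: fund_def dfund_def fun_eq_iff Let_def a_def b_def s_def[symmetric])
    have e1: "((\<lambda>t. exp (- (\<delta> - s) * t)) has_real_derivative - (\<delta> - s) * exp (- (\<delta> - s) * t)) (at t)"
      by (auto intro!: derivative_eq_intros)
    have e2: "((\<lambda>t. exp (- (\<delta> + s) * t)) has_real_derivative - (\<delta> + s) * exp (- (\<delta> + s) * t)) (at t)"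
      by (auto intro!: derivative_eq_intros)
    have e3: "((\<lambda>t. x * exp (- (\<delta> - s) * t) + y * exp (- (\<delta> + s) * t)) has_real_derivative
       x * (- (\<delta> - s) * exp (- (\<delta> - s) * t)) + y * (- (\<delta> + s) * exp (- (\<delta> + s) * t))) (at t)" for x y
      by (intro DERIV_add DERIV_cmult e1 e2)
    define i where "i = 1 / (2 * s)"
    have 2: "fund \<delta> l Q = (\<lambda>t. (a * i) * exp (- (\<delta> - s) * t) + (- b * i) * exp (- (\<delta> + s) * t))"
      "dfund \<delta> l Q = (\<lambda>t. (- a * (\<delta> - s) * i) * exp (- (\<delta> - s) * t)
          + (b * (\<delta> + s) * i) * exp (- (\<delta> + s) * t))"
      unfolding 1 i_def by (simp_all add: fun_eq_iff)
    have 3: "(fund \<delta> l Q has_real_derivative dfund \<delta> l Q t) (at t)"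
      unfolding 2 by (rule DERIV_cong[OF e3]) (simp add: algebra_simps)
    have 4: "(dfund \<delta> l Q has_real_derivative - 2 * \<delta> * dfund \<delta> l Q t - (\<delta>\<^sup>2 - s\<^sup>2) * fund \<delta> l Q t) (at t)"
      unfolding 2 by (rule DERIV_cong[OF e3]) (simp add: algebra_simps power2_eq_square)
    show ?thesis using 3 4 s(2) by simp
  qed
  then show "(fund \<delta> l Q has_real_derivative dfund \<delta> l Q t) (at t)"
  "(dfund \<delta> l Q has_real_derivative (- 2 * \<delta> * dfund \<delta> l Q t - l * fund \<delta> l Q t)) (at t)" by auto
qed

section \<open>Translation in time and splitting by rates\<close>

lemma fund_zero:
  "fund \<delta> l anyrate 0 = 0" "dfund \<delta> l anyrate 0 = 1"
  by (auto simp: fund_def dfund_def Let_def osc_def cosc_def field_simps)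

text \<open>A translate of a solution is the solution that issues from its value and derivative at
  time \<open>s\<close>. With \<open>- s\<close> in place of \<open>s\<close> this turns
  coefficients referred back to time 0 into the convolution kernel at \<open>t - s\<close>.\<close>

lemma flow_fund:
  "flow \<delta> l anyrate (fund \<delta> l Q s) (dfund \<delta> l Q s) t = fund \<delta> l Q (t + s)"
  "dflow \<delta> l anyrate (fund \<delta> l Q s) (dfund \<delta> l Q s) t = dfund \<delta> l Q (t + s)"
proof -
  have "flow \<delta> l anyrate (fund \<delta> l Q s) (dfund \<delta> l Q s) t = fund \<delta> l Q (t + s) \<and>
    dflow \<delta> l anyrate (fund \<delta> l Q s) (dfund \<delta> l Q s) t = dfund \<delta> l Q (t + s)"
  proof (cases "l \<ge> \<delta>\<^sup>2")
    case True
    then show ?thesis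
      by (auto simp: flow_def dflow_def fund_def dfund_def osc_add[OF True] algebra_simps power2_eq_square)
  next
    case False
    define w where "w = sqrt (\<delta>\<^sup>2 - l)"
    have w: "w > 0" "l = \<delta>\<^sup>2 - w\<^sup>2" using False unfolding w_def by auto
    define a where "a = (if Q (\<delta> - w) then 1 else 0 :: real)"
    define b where "b = (if Q (\<delta> + w) then 1 else 0 :: real)"
    define m where "m = 1 / (2 * w)"
    have m: "2 * w * m = 1" using w by (simp add: m_def)
    define E where "E = (\<lambda>t. exp (- (\<delta> - w) * t))"
    define G where "G = (\<lambda>t. exp (- (\<delta> + w) * t))"
    have EG: "E (t + s) = E t * E s" "G (t + s) = G t * G s" for t s
      by (simp_all add: E_def G_def exp_add[symmetric] algebra_simps)
    have 1: "fund \<delta> l Q t = a * (m * E t) - b * (m * G t)"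
      "dfund \<delta> l Q t = - a * ((\<delta> - w) * (m * E t)) + b * ((\<delta> + w) * (m * G t))" for t
      using False by (auto simp: fund_def dfund_def Let_def a_def b_def w_def[symmetric] m_def E_def G_def)
    have 2: "fund \<delta> l anyrate t = m * E t - m * G t"
      "dfund \<delta> l anyrate t = - ((\<delta> - w) * (m * E t)) + ((\<delta> + w) * (m * G t))" for t
      using False by (auto simp: fund_def dfund_def Let_def w_def[symmetric] m_def E_def G_def)
    \<comment> \<open>The mixed products of \<open>E\<close> and \<open>G\<close> cancel because
      each exponential is paired with its own root; what remains carries the factor
      \<open>2 * w * m\<close>, which is 1.\<close>
    have 3: "flow \<delta> l anyrate (fund \<delta> l Q s) (dfund \<delta> l Q s) t
       = (2 * w * m) * (a * (m * (E t * E s)) - b * (m * (G t * G s)))"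
      unfolding flow_def 1 2 by (simp add: algebra_simps)
    have 4: "dflow \<delta> l anyrate (fund \<delta> l Q s) (dfund \<delta> l Q s) t
       = (2 * w * m) * (- a * ((\<delta> - w) * (m * (E t * E s))) + b * ((\<delta> + w) * (m * (G t * G s))))"
    proof -
      have "dflow \<delta> l anyrate (fund \<delta> l Q s) (dfund \<delta> l Q s) t =
        (- a * ((\<delta> - w) * (m * E s)) + b * ((\<delta> + w) * (m * G s))) *
          (- ((\<delta> - w) * (m * E t)) + (\<delta> + w) * (m * G t))
        - (\<delta>\<^sup>2 - w\<^sup>2) * (a * (m * E s) - b * (m * G s)) * (m * E t - m * G t)"
        unfolding dflow_def 1 2 using w(2) by simp
      then show ?thesis by (simp add: algebra_simps power2_eq_square)
    qed
    show ?thesis unfolding 3 4 unfolding 1 EG m by simp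
  qed
  then show "flow \<delta> l anyrate (fund \<delta> l Q s) (dfund \<delta> l Q s) t = fund \<delta> l Q (t + s)"
  "dflow \<delta> l anyrate (fund \<delta> l Q s) (dfund \<delta> l Q s) t = dfund \<delta> l Q (t + s)" by auto
qed

text \<open>Disjoint sets of rates behave like complementary spectral projections: data built from
  the pieces of one set have zero coefficients on the pieces of the other. This is what makes the
  initial data of \<open>W F\<close> slow.\<close>

lemma flow_fund_disjoint:
  assumes "\<And>r. \<not> (Q r \<and> R r)"
  shows "flow \<delta> l R (fund \<delta> l Q s) (dfund \<delta> l Q s) t = 0"
proof (cases "l \<ge> \<delta>\<^sup>2")
  case True
  then show ?thesis using assms[of \<delta>] by (auto simp: flow_def fund_def dfund_def)
next
  case False
  define w where "w = sqrt (\<delta>\<^sup>2 - l)"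
  show ?thesis
    unfolding flow_def fund_def dfund_def Let_def w_def[symmetric]
    using False assms[of "\<delta> - w"] assms[of "\<delta> + w"]
    by (auto simp: algebra_simps diff_divide_distrib add_divide_distrib)
qed

lemma fund_split:
  "fund \<delta> l anyrate t = fund \<delta> l Q t + fund \<delta> l (\<lambda>r. \<not> Q r) t"
  "dfund \<delta> l anyrate t = dfund \<delta> l Q t + dfund \<delta> l (\<lambda>r. \<not> Q r) t"
  by (auto simp: fund_def dfund_def Let_def)

lemma flow_split:
  "flow \<delta> l anyrate x y t = flow \<delta> l Q x y t + flow \<delta> l (\<lambda>r. \<not> Q r) x y t"
  "dflow \<delta> l anyrate x y t = dflow \<delta> l Q x y t + dflow \<delta> l (\<lambda>r. \<not> Q r) x y t"
  unfolding flow_def dflow_def fund_split[where Q = Q] by (simp_all add: algebra_simps)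

text \<open>Passes between a predicate on rates, for which the estimates are made, and single rates,
  in which fast, slow and pure are phrased.\<close>

lemma flow_sum_rates:
  "flow \<delta> l Q x y t = (\<Sum>r | r \<in> rates \<delta> l \<and> Q r. flow \<delta> l (\<lambda>q. q = r) x y t)"
proof (cases "l \<ge> \<delta>\<^sup>2")
  case True
  then have "{r. r \<in> rates \<delta> l \<and> Q r} = (if Q \<delta> then {\<delta>} else {})" by (auto simp: rates_def)
  then show ?thesis using True by (auto simp: flow_def fund_def dfund_def)
next
  case False
  define s where "s = sqrt (\<delta>\<^sup>2 - l)"
  have s: "s > 0" using False unfolding s_def by auto
  have "{r. r \<in> rates \<delta> l \<and> Q r} =
     (if Q (\<delta> - s) then {\<delta> - s} else {}) \<union> (if Q (\<delta> + s) then {\<delta> + s} else {})"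
    using False by (auto simp: rates_def s_def)
  then show ?thesis using False s
    by (auto simp: flow_def fund_def dfund_def Let_def s_def[symmetric] algebra_simps)
qed

lemma flow_deriv:
  "(flow \<delta> l Q x y has_real_derivative dflow \<delta> l Q x y t) (at t)"
  "(dflow \<delta> l Q x y has_real_derivative (- 2 * \<delta> * dflow \<delta> l Q x y t - l * flow \<delta> l Q x y t)) (at t)"
proof -
  show "(flow \<delta> l Q x y has_real_derivative dflow \<delta> l Q x y t) (at t)"
    unfolding flow_def[abs_def] dflow_def
    by (auto intro!: derivative_eq_intros fund_deriv simp: algebra_simps)
  show "(dflow \<delta> l Q x y has_real_derivative (- 2 * \<delta> * dflow \<delta> l Q x y t - l * flow \<delta> l Q x y t)) (at t)"
    unfolding flow_def dflow_def[abs_def]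
    by (auto intro!: derivative_eq_intros fund_deriv simp: algebra_simps)
qed

lemma flow_zero:
  "flow \<delta> l anyrate x y 0 = x" "dflow \<delta> l anyrate x y 0 = y"
  by (auto simp: flow_def dflow_def fund_zero)

section \<open>Estimates uniform in the eigenvalue\<close>

lemma abs_exp_decay_le:
  fixes c t :: real
  assumes "c > 0"
  shows "\<bar>t\<bar> * exp (- c * \<bar>t\<bar>) \<le> 1 / c"
proof -
  have "c * \<bar>t\<bar> \<le> exp (c * \<bar>t\<bar>)" using exp_ge_add_one_self[of "c * \<bar>t\<bar>"] by linarith
  then show ?thesis using assms by (simp add: exp_minus field_simps)
qed

lemma fund_bounds:
  fixes \<delta> c g :: real
  assumes "\<delta> > 0" "c > 0" "g > 0"
  obtains C where "C > 0"
    "\<And>l Q s t. l \<ge> 0 \<Longrightarrow> (l < \<delta>\<^sup>2 \<Longrightarrow> sqrt (\<delta>\<^sup>2 - l) \<ge> g) \<Longrightarrow>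
       (\<And>r. r \<in> rates \<delta> l \<Longrightarrow> Q r \<Longrightarrow> (s - r) * t \<le> - c * \<bar>t\<bar>) \<Longrightarrow>
       sqrt (1 + l) * \<bar>fund \<delta> l Q t\<bar> \<le> C * exp (- s * t) \<and> \<bar>dfund \<delta> l Q t\<bar> \<le> C * exp (- s * t)"
proof -
  define C1 where "C1 = sqrt (2 * \<delta>\<^sup>2 + 2) * (1 / c) + 2 + (1 + \<delta> / c)"
  define C2 where "C2 = sqrt (1 + \<delta>\<^sup>2) / g + (3 * \<delta>) / g"
  have pos: "C1 > 0" "C2 > 0" unfolding C1_def C2_def using assms
    by (auto intro!: add_pos_pos add_nonneg_pos mult_pos_pos divide_pos_pos add_pos_nonneg)
  have e: "exp (- r * t) \<le> exp (- s * t) * exp (- c * \<bar>t\<bar>)" if "(s - r) * t \<le> - c * \<bar>t\<bar>" for r s t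
    unfolding exp_add[symmetric] using that by (simp add: algebra_simps)
  have e': "exp (- r * t) \<le> exp (- s * t)" if "(s - r) * t \<le> - c * \<bar>t\<bar>" for r s t
  proof -
    have "0 \<le> c * \<bar>t\<bar>" using assms(2) by simp
    then show ?thesis using that by (simp add: algebra_simps)
  qed
  have main: "sqrt (1 + l) * \<bar>fund \<delta> l Q t\<bar> \<le> (C1 + C2) * exp (- s * t) \<and>
      \<bar>dfund \<delta> l Q t\<bar> \<le> (C1 + C2) * exp (- s * t)"
    if l: "l \<ge> 0" and g: "l < \<delta>\<^sup>2 \<Longrightarrow> sqrt (\<delta>\<^sup>2 - l) \<ge> g"
      and r: "\<And>r. r \<in> rates \<delta> l \<Longrightarrow> Q r \<Longrightarrow> (s - r) * t \<le> - c * \<bar>t\<bar>" for l Q s t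
  proof (cases "l \<ge> \<delta>\<^sup>2")
    case True
    show ?thesis
    proof (cases "Q \<delta>")
      case False
      then show ?thesis using True pos by (simp add: fund_def dfund_def)
    next
      case Q: True
      have rr: "(s - \<delta>) * t \<le> - c * \<bar>t\<bar>" using r[of \<delta>] Q True by (simp add: rates_def)
      note e1 = e[OF rr] and e2 = e'[OF rr]
      have "\<bar>osc \<delta> l t\<bar> \<le> \<bar>t\<bar> * (exp (- s * t) * exp (- c * \<bar>t\<bar>))"
        using osc_bounds(1)[OF True, of t] mult_left_mono[OF e1, of "\<bar>t\<bar>"] by linarith
      also have "\<dots> \<le> (1 / c) * exp (- s * t)"
        using mult_left_mono[OF abs_exp_decay_le[OF assms(2), of t], of "exp (- s * t)"]
        by (simp add: algebra_simps)
      finally have o: "\<bar>osc \<delta> l t\<bar> \<le> (1 / c) * exp (- s * t)" .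
      have d: "\<bar>cosc \<delta> l t - \<delta> * osc \<delta> l t\<bar> \<le> (1 + \<delta> / c) * exp (- s * t)"
      proof -
        have "\<bar>cosc \<delta> l t - \<delta> * osc \<delta> l t\<bar> \<le> \<bar>cosc \<delta> l t\<bar> + \<delta> * \<bar>osc \<delta> l t\<bar>"
          using assms(1) by (metis abs_mult abs_of_pos abs_triangle_ineq4)
        also have "\<dots> \<le> exp (- s * t) + \<delta> * ((1 / c) * exp (- s * t))"
          using osc_bounds(3)[OF True, of t] e2 mult_left_mono[OF o, of \<delta>] assms(1) by linarith
        finally show ?thesis by (simp add: algebra_simps)
      qed
      \<comment> \<open>Above the threshold one has
        \<open>1 + l \<le> 4 * (l - \<delta>\<^sup>2)\<close>, so the inverse frequency cancels the
        weight; below it the weight is bounded and the estimate \<open>o\<close> suffices.\<close>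
      have b: "sqrt (1 + l) * \<bar>osc \<delta> l t\<bar> \<le> (sqrt (2 * \<delta>\<^sup>2 + 2) * (1 / c) + 2) * exp (- s * t)"
      proof (cases "l \<le> 2 * \<delta>\<^sup>2 + 1")
        case True
        have "sqrt (1 + l) * \<bar>osc \<delta> l t\<bar> \<le> sqrt (2 * \<delta>\<^sup>2 + 2) * ((1 / c) * exp (- s * t))"
          using True o by (intro mult_mono) auto
        moreover have "0 \<le> 2 * exp (- s * t)" by simp
        ultimately show ?thesis unfolding distrib_right mult.assoc by linarith
      next
        case big: False
        then have ne: "l \<noteq> \<delta>\<^sup>2" using zero_le_power2[of \<delta>] by linarith
        have "1 + l \<le> 4 * (l - \<delta>\<^sup>2)"
        proof -
          have "l > 2 * \<delta>\<^sup>2 + 1" "0 \<le> \<delta>\<^sup>2" using big by auto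
          then show ?thesis unfolding right_diff_distrib by linarith
        qed
        then have "sqrt (1 + l) \<le> 2 * sqrt (l - \<delta>\<^sup>2)"
          using real_sqrt_le_mono[of "1 + l" "4 * (l - \<delta>\<^sup>2)"] unfolding real_sqrt_mult real_sqrt_four by simp
        moreover have w: "sqrt (l - \<delta>\<^sup>2) > 0" using True ne by auto
        ultimately have "sqrt (1 + l) * \<bar>osc \<delta> l t\<bar> \<le> 2 * sqrt (l - \<delta>\<^sup>2) * (exp (- \<delta> * t) / sqrt (l - \<delta>\<^sup>2))"
          using osc_bounds(2)[OF True ne, of t] by (intro mult_mono) auto
        also have "\<dots> \<le> 2 * exp (- s * t)" using w e2 by simp
        also have "\<dots> \<le> (sqrt (2 * \<delta>\<^sup>2 + 2) * (1 / c) + 2) * exp (- s * t)"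
          using assms by (intro mult_right_mono) auto
        finally show ?thesis .
      qed
      have "(sqrt (2 * \<delta>\<^sup>2 + 2) * (1 / c) + 2) * exp (- s * t) \<le> (C1 + C2) * exp (- s * t)"
        using assms pos unfolding C1_def by (intro mult_right_mono) auto
      moreover have "(1 + \<delta> / c) * exp (- s * t) \<le> (C1 + C2) * exp (- s * t)"
        using assms pos unfolding C1_def by (intro mult_right_mono) auto
      ultimately have "sqrt (1 + l) * \<bar>osc \<delta> l t\<bar> \<le> (C1 + C2) * exp (- s * t)"
        "\<bar>cosc \<delta> l t - \<delta> * osc \<delta> l t\<bar> \<le> (C1 + C2) * exp (- s * t)"
        using b d by linarith+
      then show ?thesis using Q True unfolding fund_def dfund_def by auto
    qed
  next
    case False
    define w where "w = sqrt (\<delta>\<^sup>2 - l)"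
    have w: "w \<ge> g" "w > 0" using False g assms(3) unfolding w_def by auto
    have wd: "w \<le> \<delta>" unfolding w_def using l assms(1) real_le_lsqrt[of \<delta> "\<delta>\<^sup>2 - l"]
      by (simp add: real_le_lsqrt)
    have m: "1 / (2 * w) \<le> 1 / (2 * g)" "0 < 1 / (2 * w)" using w assms(3) by (auto simp: field_simps)
    define E where "E = (if Q (\<delta> - w) then exp (- (\<delta> - w) * t) else 0)"
    define G where "G = (if Q (\<delta> + w) then exp (- (\<delta> + w) * t) else 0)"
    have E: "0 \<le> E" "E \<le> exp (- s * t)"
      using r[of "\<delta> - w"] e'[of s "\<delta> - w" t] False by (auto simp: E_def rates_def w_def)
    have G: "0 \<le> G" "G \<le> exp (- s * t)"
      using r[of "\<delta> + w"] e'[of s "\<delta> + w" t] False by (auto simp: G_def rates_def w_def)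
    have f: "fund \<delta> l Q t = (E - G) * (1 / (2 * w))"
      using False by (auto simp: fund_def Let_def E_def G_def w_def[symmetric] algebra_simps diff_divide_distrib)
    have d: "dfund \<delta> l Q t = ((\<delta> + w) * G - (\<delta> - w) * E) * (1 / (2 * w))"
      using False by (auto simp: dfund_def Let_def E_def G_def w_def[symmetric] algebra_simps diff_divide_distrib add_divide_distrib)
    have EG: "\<bar>E - G\<bar> \<le> exp (- s * t)" using E G by linarith
    have "\<bar>fund \<delta> l Q t\<bar> \<le> exp (- s * t) * (1 / (2 * g))"
      unfolding f abs_mult using EG m by (intro mult_mono) auto
    then have "sqrt (1 + l) * \<bar>fund \<delta> l Q t\<bar> \<le> sqrt (1 + \<delta>\<^sup>2) * (exp (- s * t) * (1 / (2 * g)))"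
      using False by (intro mult_mono) auto
    also have "\<dots> = (sqrt (1 + \<delta>\<^sup>2) / (2 * g)) * exp (- s * t)" by simp
    also have "\<dots> \<le> (C1 + C2) * exp (- s * t)"
    proof (intro mult_right_mono)
      have "sqrt (1 + \<delta>\<^sup>2) / (2 * g) \<le> sqrt (1 + \<delta>\<^sup>2) / g"
        using assms by (intro divide_left_mono) auto
      also have "\<dots> \<le> C2" unfolding C2_def using assms by simp
      finally show "sqrt (1 + \<delta>\<^sup>2) / (2 * g) \<le> C1 + C2" using pos by linarith
    qed simp
    finally have 1: "sqrt (1 + l) * \<bar>fund \<delta> l Q t\<bar> \<le> (C1 + C2) * exp (- s * t)" .
    have "(\<delta> + w) * G \<le> (2 * \<delta>) * exp (- s * t)" "0 \<le> (\<delta> + w) * G"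
      using G wd w assms(1) by (auto intro!: mult_mono)
    moreover have "(\<delta> - w) * E \<le> \<delta> * exp (- s * t)" "0 \<le> (\<delta> - w) * E"
      using E wd w assms(1) by (auto intro!: mult_mono)
    moreover have "0 < \<delta> * exp (- s * t)" using assms(1) by simp
    ultimately have "\<bar>(\<delta> + w) * G - (\<delta> - w) * E\<bar> \<le> (3 * \<delta>) * exp (- s * t)"
      by (simp add: abs_le_iff)
    then have "\<bar>dfund \<delta> l Q t\<bar> \<le> ((3 * \<delta>) * exp (- s * t)) * (1 / (2 * g))"
      unfolding d abs_mult using m by (intro mult_mono) auto
    also have "\<dots> = (3 * \<delta> / (2 * g)) * exp (- s * t)" by simp
    also have "\<dots> \<le> (C1 + C2) * exp (- s * t)"
    proof (intro mult_right_mono)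
      have "3 * \<delta> / (2 * g) \<le> 3 * \<delta> / g"
        using assms by (intro divide_left_mono) auto
      also have "\<dots> \<le> C2" unfolding C2_def using assms by simp
      finally show "3 * \<delta> / (2 * g) \<le> C1 + C2" using pos by linarith
    qed simp
    finally show ?thesis using 1 by blast
  qed
  show ?thesis by (rule that[of "C1 + C2"]) (use pos main in auto)
qed

section \<open>A single forced mode\<close>

definition forcing :: "real \<Rightarrow> (real \<Rightarrow> real) \<Rightarrow> bool" where
  "forcing \<sigma> \<phi> \<longleftrightarrow> continuous_on {0..} \<phi> \<and> (\<exists>M. \<forall>s\<ge>0. \<bar>\<phi> s\<bar> \<le> M * exp (- \<sigma> * s))"

lemma forcing_integrable:
  fixes k :: "real \<Rightarrow> real"
  assumes \<phi>: "forcing \<sigma> \<phi>" and sg: "sg < \<sigma>" and c: "c \<ge> 0"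
    and k: "continuous_on {0..} k" "\<And>s. s \<ge> 0 \<Longrightarrow> \<bar>k s\<bar> \<le> C * exp (sg * s)"
  shows "(\<lambda>s. k s * \<phi> s) integrable_on {c..}"
proof -
  obtain M where M: "\<And>s. s \<ge> 0 \<Longrightarrow> \<bar>\<phi> s\<bar> \<le> M * exp (- \<sigma> * s)" and cont: "continuous_on {0..} \<phi>"
    using \<phi> by (auto simp: forcing_def)
  have C: "C \<ge> 0" using k(2)[of 0] by (auto intro: order_trans[OF abs_ge_zero])
  have sub: "{c..} \<subseteq> {0..}" using c by auto
  have "(\<lambda>s. exp (- (\<sigma> - sg) * s)) integrable_on {c..}"
    using has_integral_exp_minus_to_infinity[of "\<sigma> - sg" c] sg by (auto simp: integrable_on_def)
  then have "(\<lambda>s. (C * M) * exp (- (\<sigma> - sg) * s)) integrable_on {c..}"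
    by (rule integrable_on_mult_right)
  moreover have "norm (k s * \<phi> s) \<le> (C * M) * exp (- (\<sigma> - sg) * s)" if "s \<in> {c..}" for s
  proof -
    have "\<bar>k s\<bar> * \<bar>\<phi> s\<bar> \<le> (C * exp (sg * s)) * (M * exp (- \<sigma> * s))"
      using k(2)[of s] M[of s] that c C by (intro mult_mono) auto
    also have "\<dots> = (C * M) * (exp (sg * s) * exp (- \<sigma> * s))" by simp
    also have "exp (sg * s) * exp (- \<sigma> * s) = exp (- (\<sigma> - sg) * s)"
      by (simp add: exp_add[symmetric] algebra_simps)
    finally show ?thesis by (simp add: abs_mult)
  qed
  moreover have "(\<lambda>s. k s * \<phi> s) \<in> borel_measurable (lebesgue_on {c..})"
    by (intro continuous_imp_measurable_on_sets_lebesgue continuous_intros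
        continuous_on_subset[OF cont sub] continuous_on_subset[OF k(1) sub]) auto
  ultimately show ?thesis
    using measurable_bounded_by_integrable_imp_integrable[of "\<lambda>s. k s * \<phi> s" "{c..}"
        "\<lambda>s. (C * M) * exp (- (\<sigma> - sg) * s)"] by simp
qed

lemma forcing_weight_integrable:
  assumes "forcing \<sigma> \<phi>" "sg < \<sigma>" "c \<ge> 0"
  shows "(\<lambda>s. exp (sg * s) * \<bar>\<phi> s\<bar>) integrable_on {c..}"
proof -
  have "forcing \<sigma> (\<lambda>s. \<bar>\<phi> s\<bar>)" using assms(1) by (auto simp: forcing_def intro!: continuous_intros)
  then show ?thesis
    by (rule forcing_integrable[OF _ assms(2,3), where C = 1]) (auto intro!: continuous_intros)
qed

lemma continuous_on_fund [continuous_intros]: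
  assumes "continuous_on T g"
  shows "continuous_on T (\<lambda>s. fund \<delta> l Q (g s))" "continuous_on T (\<lambda>s. dfund \<delta> l Q (g s))"
proof -
  have c: "continuous_on UNIV (fund \<delta> l Q)" "continuous_on UNIV (dfund \<delta> l Q)"
    by (auto intro!: continuous_at_imp_continuous_on DERIV_isCont fund_deriv)
  show "continuous_on T (\<lambda>s. fund \<delta> l Q (g s))" "continuous_on T (\<lambda>s. dfund \<delta> l Q (g s))"
    by (rule continuous_on_compose2[OF c(1) assms] continuous_on_compose2[OF c(2) assms], simp)+
qed

text \<open>\<open>flow\<close> and \<open>dflow\<close> are linear in the data with coefficients
  that do not depend on \<open>s\<close>, so they pass under the integral. Combined with
  \<open>flow_fund\<close> or \<open>flow_fund_disjoint\<close> this evaluates the kernel.\<close>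

lemma flow_integral:
  assumes "(\<lambda>s. fund \<delta> l Q (- s) * \<phi> s) integrable_on T" "(\<lambda>s. dfund \<delta> l Q (- s) * \<phi> s) integrable_on T"
  shows "((\<lambda>s. flow \<delta> l R (fund \<delta> l Q (- s)) (dfund \<delta> l Q (- s)) t * \<phi> s) has_integral
      flow \<delta> l R (integral T (\<lambda>s. fund \<delta> l Q (- s) * \<phi> s)) (integral T (\<lambda>s. dfund \<delta> l Q (- s) * \<phi> s)) t) T"
    and "((\<lambda>s. dflow \<delta> l R (fund \<delta> l Q (- s)) (dfund \<delta> l Q (- s)) t * \<phi> s) has_integral
      dflow \<delta> l R (integral T (\<lambda>s. fund \<delta> l Q (- s) * \<phi> s)) (integral T (\<lambda>s. dfund \<delta> l Q (- s) * \<phi> s)) t) T"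
proof -
  define a where "a = dfund \<delta> l R t + 2 * \<delta> * fund \<delta> l R t"
  define b where "b = fund \<delta> l R t"
  define d where "d = dfund \<delta> l R t"
  note I = integrable_integral[OF assms(1)] integrable_integral[OF assms(2)]
  have "((\<lambda>s. (fund \<delta> l Q (- s) * \<phi> s) * a + (dfund \<delta> l Q (- s) * \<phi> s) * b) has_integral
     integral T (\<lambda>s. fund \<delta> l Q (- s) * \<phi> s) * a + integral T (\<lambda>s. dfund \<delta> l Q (- s) * \<phi> s) * b) T"
    by (intro has_integral_add has_integral_mult_left I)
  then show "((\<lambda>s. flow \<delta> l R (fund \<delta> l Q (- s)) (dfund \<delta> l Q (- s)) t * \<phi> s) has_integral
      flow \<delta> l R (integral T (\<lambda>s. fund \<delta> l Q (- s) * \<phi> s)) (integral T (\<lambda>s. dfund \<delta> l Q (- s) * \<phi> s)) t) T"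
    unfolding flow_def a_def[symmetric] unfolding b_def[symmetric] by (simp add: algebra_simps)
  have "((\<lambda>s. (dfund \<delta> l Q (- s) * \<phi> s) * d - (fund \<delta> l Q (- s) * \<phi> s) * (l * b)) has_integral
     integral T (\<lambda>s. dfund \<delta> l Q (- s) * \<phi> s) * d - integral T (\<lambda>s. fund \<delta> l Q (- s) * \<phi> s) * (l * b)) T"
    by (intro has_integral_diff has_integral_mult_left I)
  then show "((\<lambda>s. dflow \<delta> l R (fund \<delta> l Q (- s)) (dfund \<delta> l Q (- s)) t * \<phi> s) has_integral
      dflow \<delta> l R (integral T (\<lambda>s. fund \<delta> l Q (- s) * \<phi> s)) (integral T (\<lambda>s. dfund \<delta> l Q (- s) * \<phi> s)) t) T"
    unfolding dflow_def d_def[symmetric] b_def[symmetric] by (simp add: algebra_simps)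
qed

lemma flow_diff:
  "flow \<delta> l Q (x - x') (y - y') t = flow \<delta> l Q x y t - flow \<delta> l Q x' y' t"
  "dflow \<delta> l Q (x - x') (y - y') t = dflow \<delta> l Q x y t - dflow \<delta> l Q x' y' t"
  by (auto simp: flow_def dflow_def algebra_simps)

lemma flow_add:
  "flow \<delta> l Q (x + x') (y + y') t = flow \<delta> l Q x y t + flow \<delta> l Q x' y' t"
  "dflow \<delta> l Q (x + x') (y + y') t = dflow \<delta> l Q x y t + dflow \<delta> l Q x' y' t"
  by (auto simp: flow_def dflow_def algebra_simps)

text \<open>Variation of parameters: by the addition formula \<open>flow_fund\<close>, \<open>perron\<close> is the sum of the integral of
  the pieces outside \<open>Q\<close> over \<open>[0, t]\<close> and minus that of the pieces in \<open>Q\<close> over \<open>[t, \<infinity>)\<close>.\<close>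

definition perronX :: "real \<Rightarrow> real \<Rightarrow> (real \<Rightarrow> bool) \<Rightarrow> (real \<Rightarrow> real) \<Rightarrow> real \<Rightarrow> real" where
  "perronX \<delta> l Q \<phi> t = integral {0..t} (\<lambda>s. fund \<delta> l anyrate (- s) * \<phi> s)
     - integral {0..} (\<lambda>s. fund \<delta> l Q (- s) * \<phi> s)"

definition perronY :: "real \<Rightarrow> real \<Rightarrow> (real \<Rightarrow> bool) \<Rightarrow> (real \<Rightarrow> real) \<Rightarrow> real \<Rightarrow> real" where
  "perronY \<delta> l Q \<phi> t = integral {0..t} (\<lambda>s. dfund \<delta> l anyrate (- s) * \<phi> s)
     - integral {0..} (\<lambda>s. dfund \<delta> l Q (- s) * \<phi> s)"

definition perron :: "real \<Rightarrow> real \<Rightarrow> (real \<Rightarrow> bool) \<Rightarrow> (real \<Rightarrow> real) \<Rightarrow> real \<Rightarrow> real" where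
  "perron \<delta> l Q \<phi> t = flow \<delta> l anyrate (perronX \<delta> l Q \<phi> t) (perronY \<delta> l Q \<phi> t) t"

definition dperron :: "real \<Rightarrow> real \<Rightarrow> (real \<Rightarrow> bool) \<Rightarrow> (real \<Rightarrow> real) \<Rightarrow> real \<Rightarrow> real" where
  "dperron \<delta> l Q \<phi> t = dflow \<delta> l anyrate (perronX \<delta> l Q \<phi> t) (perronY \<delta> l Q \<phi> t) t"

lemma integral_deriv_halfline:
  fixes g :: "real \<Rightarrow> real"
  assumes "continuous_on {0..} g" "t \<ge> 0"
  shows "((\<lambda>x. integral {0..x} g) has_real_derivative g t) (at t within {0..})"
proof -
  have "((\<lambda>x. integral {0..x} g) has_real_derivative g t) (at t within {0..t + 1})"
    using assms by (intro integral_has_real_derivative continuous_on_subset[OF assms(1)]) auto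
  moreover have "at t within {0..t + 1} = at t within {0..}"
    by (rule at_within_nhd[of t "{..<t + 1}"]) auto
  ultimately show ?thesis by simp
qed

text \<open>Because the kernel is factored through coefficients at time 0, \<open>t\<close> enters
  \<open>perronX\<close> and \<open>perronY\<close> only as an upper limit of integration. The
  fundamental theorem of calculus then suffices, without differentiating under an integral.\<close>

lemma perron_deriv:
  assumes "continuous_on {0..} \<phi>" "t \<ge> 0"
  shows "(perron \<delta> l Q \<phi> has_real_derivative dperron \<delta> l Q \<phi> t) (at t within {0..})"
    "(dperron \<delta> l Q \<phi> has_real_derivative (\<phi> t - 2 * \<delta> * dperron \<delta> l Q \<phi> t - l * perron \<delta> l Q \<phi> t))
       (at t within {0..})"
proof -
  have X: "(perronX \<delta> l Q \<phi> has_real_derivative fund \<delta> l anyrate (- t) * \<phi> t) (at t within {0..})"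
    unfolding perronX_def[abs_def]
    by (auto intro!: derivative_eq_intros integral_deriv_halfline continuous_intros assms)
  have Y: "(perronY \<delta> l Q \<phi> has_real_derivative dfund \<delta> l anyrate (- t) * \<phi> t) (at t within {0..})"
    unfolding perronY_def[abs_def]
    by (auto intro!: derivative_eq_intros integral_deriv_halfline continuous_intros assms)
  note f = fund_deriv[of \<delta> l anyrate t, THEN has_field_derivative_at_within, of "{0..}"]
  \<comment> \<open>Impulse data (0, 1) carried back by \<open>t\<close> and then forward by
    \<open>t\<close> return to (0, 1). Hence the forcing drops out of the first derivative and
    enters the second with coefficient 1.\<close>
  have 1: "fund \<delta> l anyrate (- t) * (dfund \<delta> l anyrate t + 2 * \<delta> * fund \<delta> l anyrate t) +
      dfund \<delta> l anyrate (- t) * fund \<delta> l anyrate t = 0"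
    using flow_fund(1)[of \<delta> l anyrate "- t" t] by (simp add: flow_def fund_zero)
  have 2: "dfund \<delta> l anyrate (- t) * dfund \<delta> l anyrate t - l * fund \<delta> l anyrate (- t) * fund \<delta> l anyrate t = 1"
    using flow_fund(2)[of \<delta> l anyrate "- t" t] by (simp add: dflow_def fund_zero)
  have "(perron \<delta> l Q \<phi> has_real_derivative dperron \<delta> l Q \<phi> t + \<phi> t *
      (fund \<delta> l anyrate (- t) * (dfund \<delta> l anyrate t + 2 * \<delta> * fund \<delta> l anyrate t) +
      dfund \<delta> l anyrate (- t) * fund \<delta> l anyrate t)) (at t within {0..})"
    unfolding perron_def[abs_def] dperron_def flow_def dflow_def
    by (rule derivative_eq_intros X Y f refl | simp)+ (simp add: algebra_simps)
  then show "(perron \<delta> l Q \<phi> has_real_derivative dperron \<delta> l Q \<phi> t) (at t within {0..})"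
    unfolding 1 by simp
  have "(dperron \<delta> l Q \<phi> has_real_derivative (\<phi> t *
      (dfund \<delta> l anyrate (- t) * dfund \<delta> l anyrate t - l * fund \<delta> l anyrate (- t) * fund \<delta> l anyrate t)
      - 2 * \<delta> * dperron \<delta> l Q \<phi> t - l * perron \<delta> l Q \<phi> t)) (at t within {0..})"
    unfolding perron_def dperron_def[abs_def] flow_def dflow_def
    by (rule derivative_eq_intros X Y f refl | simp)+ (simp add: algebra_simps)
  then show "(dperron \<delta> l Q \<phi> has_real_derivative (\<phi> t - 2 * \<delta> * dperron \<delta> l Q \<phi> t - l * perron \<delta> l Q \<phi> t))
       (at t within {0..})"
    unfolding 2 by simp
qed

text \<open>An exponential dichotomy at the rate \<open>sg\<close>: the pieces in \<open>Q\<close>,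
  followed backwards, and the remaining ones, followed forwards, obey the same exponential bound. In
  the application \<open>Q\<close> selects the rates up to \<open>r0\<close>.\<close>

locale dichotomy =
  fixes \<delta> l sg C :: real and Q :: "real \<Rightarrow> bool"
  assumes l_nonneg: "l \<ge> 0"
    and slow_bound: "\<And>t. t \<le> 0 \<Longrightarrow> sqrt (1 + l) * \<bar>fund \<delta> l Q t\<bar> \<le> C * exp (- sg * t)"
      "\<And>t. t \<le> 0 \<Longrightarrow> \<bar>dfund \<delta> l Q t\<bar> \<le> C * exp (- sg * t)"
    and fast_bound: "\<And>t. t \<ge> 0 \<Longrightarrow> sqrt (1 + l) * \<bar>fund \<delta> l (\<lambda>r. \<not> Q r) t\<bar> \<le> C * exp (- sg * t)"
      "\<And>t. t \<ge> 0 \<Longrightarrow> \<bar>dfund \<delta> l (\<lambda>r. \<not> Q r) t\<bar> \<le> C * exp (- sg * t)"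
begin

lemma slow_integrable:
  assumes "forcing \<sigma> \<phi>" "sg < \<sigma>" "c \<ge> 0"
  shows "(\<lambda>s. fund \<delta> l Q (- s) * \<phi> s) integrable_on {c..}"
    "(\<lambda>s. dfund \<delta> l Q (- s) * \<phi> s) integrable_on {c..}"
proof -
  have "\<bar>fund \<delta> l Q (- s)\<bar> \<le> C * exp (sg * s)" if "s \<ge> 0" for s
  proof -
    have "1 * \<bar>fund \<delta> l Q (- s)\<bar> \<le> sqrt (1 + l) * \<bar>fund \<delta> l Q (- s)\<bar>"
      using l_nonneg by (intro mult_right_mono) auto
    then show ?thesis using slow_bound(1)[of "- s"] that by simp
  qed
  then show "(\<lambda>s. fund \<delta> l Q (- s) * \<phi> s) integrable_on {c..}"
    by (intro forcing_integrable[OF assms] continuous_intros)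
  have "\<bar>dfund \<delta> l Q (- s)\<bar> \<le> C * exp (sg * s)" if "s \<ge> 0" for s
    using slow_bound(2)[of "- s"] that by simp
  then show "(\<lambda>s. dfund \<delta> l Q (- s) * \<phi> s) integrable_on {c..}"
    by (intro forcing_integrable[OF assms] continuous_intros)
qed

lemma integrable_finite:
  assumes "forcing \<sigma> \<phi>" "c \<ge> 0"
  shows "(\<lambda>s. fund \<delta> l R (- s) * \<phi> s) integrable_on {c..t}"
    "(\<lambda>s. dfund \<delta> l R (- s) * \<phi> s) integrable_on {c..t}"
  using assms by (auto intro!: integrable_continuous_real continuous_intros
      continuous_on_subset[of "{0..}" \<phi>] simp: forcing_def)

text \<open>When the half-line is cut at \<open>t\<close>, the pieces in \<open>Q\<close> over the
  past cancel: only the other pieces see the past, and only those in \<open>Q\<close> see the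
  future. Each kernel is thus used just on the side where the dichotomy controls it.\<close>

lemma perronXY_split:
  assumes "forcing \<sigma> \<phi>" "sg < \<sigma>" "t \<ge> 0"
  shows "perronX \<delta> l Q \<phi> t = integral {0..t} (\<lambda>s. fund \<delta> l (\<lambda>r. \<not> Q r) (- s) * \<phi> s)
        - integral {t..} (\<lambda>s. fund \<delta> l Q (- s) * \<phi> s)"
    "perronY \<delta> l Q \<phi> t = integral {0..t} (\<lambda>s. dfund \<delta> l (\<lambda>r. \<not> Q r) (- s) * \<phi> s)
        - integral {t..} (\<lambda>s. dfund \<delta> l Q (- s) * \<phi> s)"
proof -
  have un: "{0..} = {0..t} \<union> {t..}" and neg: "negligible ({0..t} \<inter> {t..})"
    using assms(3) by (auto simp: Int_def intro: negligible_subset[of "{t}"])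
  have I: "integral {0..} (\<lambda>s. fund \<delta> l Q (- s) * \<phi> s) =
      integral {0..t} (\<lambda>s. fund \<delta> l Q (- s) * \<phi> s) + integral {t..} (\<lambda>s. fund \<delta> l Q (- s) * \<phi> s)"
    unfolding un by (intro integral_Un neg slow_integrable[OF assms] integrable_finite[OF assms(1) order_refl])
  have J: "integral {0..} (\<lambda>s. dfund \<delta> l Q (- s) * \<phi> s) =
      integral {0..t} (\<lambda>s. dfund \<delta> l Q (- s) * \<phi> s) + integral {t..} (\<lambda>s. dfund \<delta> l Q (- s) * \<phi> s)"
    unfolding un by (intro integral_Un neg slow_integrable[OF assms] integrable_finite[OF assms(1) order_refl])
  show "perronX \<delta> l Q \<phi> t = integral {0..t} (\<lambda>s. fund \<delta> l (\<lambda>r. \<not> Q r) (- s) * \<phi> s)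
        - integral {t..} (\<lambda>s. fund \<delta> l Q (- s) * \<phi> s)"
    unfolding perronX_def I fund_split[where Q = Q] distrib_right
    by (simp add: Henstock_Kurzweil_Integration.integral_add integrable_finite[OF assms(1) order_refl])
  show "perronY \<delta> l Q \<phi> t = integral {0..t} (\<lambda>s. dfund \<delta> l (\<lambda>r. \<not> Q r) (- s) * \<phi> s)
        - integral {t..} (\<lambda>s. dfund \<delta> l Q (- s) * \<phi> s)"
    unfolding perronY_def J fund_split[where Q = Q] distrib_right
    by (simp add: Henstock_Kurzweil_Integration.integral_add integrable_finite[OF assms(1) order_refl])
qed

lemma perron_has_integral:
  assumes "forcing \<sigma> \<phi>" "sg < \<sigma>" "t \<ge> 0"
  obtains a b where "((\<lambda>s. fund \<delta> l (\<lambda>r. \<not> Q r) (t - s) * \<phi> s) has_integral a) {0..t}"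
     "((\<lambda>s. fund \<delta> l Q (t - s) * \<phi> s) has_integral b) {t..}" "perron \<delta> l Q \<phi> t = a - b"
proof -
  from flow_integral(1)[OF integrable_finite[OF assms(1) order_refl, of "\<lambda>r. \<not> Q r" t], of anyrate t]
    flow_integral(1)[OF slow_integrable[OF assms(1-3)], of anyrate t]
  show ?thesis unfolding flow_fund
    by (intro that) (auto simp: perron_def perronXY_split[OF assms] flow_diff)
qed

lemma dperron_has_integral:
  assumes "forcing \<sigma> \<phi>" "sg < \<sigma>" "t \<ge> 0"
  obtains a b where "((\<lambda>s. dfund \<delta> l (\<lambda>r. \<not> Q r) (t - s) * \<phi> s) has_integral a) {0..t}"
     "((\<lambda>s. dfund \<delta> l Q (t - s) * \<phi> s) has_integral b) {t..}" "dperron \<delta> l Q \<phi> t = a - b"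
proof -
  from flow_integral(2)[OF integrable_finite[OF assms(1) order_refl, of "\<lambda>r. \<not> Q r" t], of anyrate t]
    flow_integral(2)[OF slow_integrable[OF assms(1-3)], of anyrate t]
  show ?thesis unfolding flow_fund
    by (intro that) (auto simp: dperron_def perronXY_split[OF assms] flow_diff)
qed

text \<open>The common bound at \<open>t - s\<close> factors into \<open>exp (- sg * t)\<close> and
  the weight \<open>exp (sg * s)\<close>, so past and future add up to one integral that does not
  depend on \<open>t\<close>. The factor \<open>B\<close> is \<open>sqrt (1 + l)\<close> for the
  solution and 1 for its derivative.\<close>

lemma kernel_bound:
  fixes k k' :: "real \<Rightarrow> real"
  assumes "forcing \<sigma> \<phi>" "sg < \<sigma>" "t \<ge> 0"
    and I: "((\<lambda>s. k (t - s) * \<phi> s) has_integral a) {0..t}" "((\<lambda>s. k' (t - s) * \<phi> s) has_integral b) {t..}"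
    and B: "B \<ge> 0" "\<And>s. s \<ge> 0 \<Longrightarrow> B * \<bar>k s\<bar> \<le> C * exp (- sg * s)" "\<And>s. s \<le> 0 \<Longrightarrow> B * \<bar>k' s\<bar> \<le> C * exp (- sg * s)"
  shows "B * \<bar>a - b\<bar> \<le> C * exp (- sg * t) * integral {0..} (\<lambda>s. exp (sg * s) * \<bar>\<phi> s\<bar>)"
proof -
  let ?w = "\<lambda>s. exp (sg * s) * \<bar>\<phi> s\<bar>"
  have un: "{0..} = {0..t} \<union> {t..}" and neg: "negligible ({0..t} \<inter> {t..})"
    using assms(3) by (auto simp: Int_def intro: negligible_subset[of "{t}"])
  have w1: "?w integrable_on {0..t}"
    using assms(1) by (auto intro!: integrable_continuous_real continuous_intros
      continuous_on_subset[of "{0..}" \<phi>] simp: forcing_def)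
  have w2: "?w integrable_on {t..}" by (rule forcing_weight_integrable[OF assms(1-3)])
  have aux: "norm (B * (k s * \<phi> r)) \<le> (C * exp (- sg * t)) * (exp (sg * r) * \<bar>\<phi> r\<bar>)"
    if "B * \<bar>k s\<bar> \<le> C * exp (- sg * s)" "s = t - r" for k :: "real \<Rightarrow> real" and s r
  proof -
    have "norm (B * (k s * \<phi> r)) = (B * \<bar>k s\<bar>) * \<bar>\<phi> r\<bar>" using B(1) by (simp add: abs_mult)
    also have "\<dots> \<le> (C * exp (- sg * s)) * \<bar>\<phi> r\<bar>" using that by (intro mult_right_mono) auto
    also have "exp (- sg * s) = exp (- sg * t) * exp (sg * r)"
      unfolding that(2) by (simp add: exp_add[symmetric] algebra_simps)
    finally show ?thesis by simp
  qed
  have "norm (integral {0..t} (\<lambda>s. B * (k (t - s) * \<phi> s))) \<le> integral {0..t} (\<lambda>s. (C * exp (- sg * t)) * ?w s)"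
    using I(1) w1 by (intro Henstock_Kurzweil_Integration.integral_norm_bound_integral
        integrable_on_mult_right aux B(2)) auto
  then have 1: "B * \<bar>a\<bar> \<le> (C * exp (- sg * t)) * integral {0..t} ?w"
    using integral_unique[OF I(1)] B(1) by (simp add: abs_mult)
  have "norm (integral {t..} (\<lambda>s. B * (k' (t - s) * \<phi> s))) \<le> integral {t..} (\<lambda>s. (C * exp (- sg * t)) * ?w s)"
    using I(2) w2 by (intro Henstock_Kurzweil_Integration.integral_norm_bound_integral
        integrable_on_mult_right aux B(3)) auto
  then have 2: "B * \<bar>b\<bar> \<le> (C * exp (- sg * t)) * integral {t..} ?w"
    using integral_unique[OF I(2)] B(1) by (simp add: abs_mult)
  have 3: "integral {0..} ?w = integral {0..t} ?w + integral {t..} ?w"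
    unfolding un by (intro integral_Un w1 w2 neg)
  have "B * \<bar>a - b\<bar> \<le> B * \<bar>a\<bar> + B * \<bar>b\<bar>"
    using mult_left_mono[OF abs_triangle_ineq4[of a b] B(1)] by (simp add: algebra_simps)
  also have "\<dots> \<le> C * exp (- sg * t) * integral {0..} ?w"
    unfolding 3 distrib_left using 1 2 by linarith
  finally show ?thesis .
qed

lemma perron_bound:
  assumes "forcing \<sigma> \<phi>" "sg < \<sigma>" "t \<ge> 0"
  shows "sqrt (1 + l) * \<bar>perron \<delta> l Q \<phi> t\<bar> \<le> C * exp (- sg * t) * integral {0..} (\<lambda>s. exp (sg * s) * \<bar>\<phi> s\<bar>)"
    "\<bar>dperron \<delta> l Q \<phi> t\<bar> \<le> C * exp (- sg * t) * integral {0..} (\<lambda>s. exp (sg * s) * \<bar>\<phi> s\<bar>)"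
proof -
  obtain a b where 1: "((\<lambda>s. fund \<delta> l (\<lambda>r. \<not> Q r) (t - s) * \<phi> s) has_integral a) {0..t}"
     "((\<lambda>s. fund \<delta> l Q (t - s) * \<phi> s) has_integral b) {t..}" "perron \<delta> l Q \<phi> t = a - b"
    by (rule perron_has_integral[OF assms])
  show "sqrt (1 + l) * \<bar>perron \<delta> l Q \<phi> t\<bar> \<le> C * exp (- sg * t) * integral {0..} (\<lambda>s. exp (sg * s) * \<bar>\<phi> s\<bar>)"
    unfolding 1(3) by (rule kernel_bound[OF assms 1(1,2)]) (use l_nonneg slow_bound fast_bound in auto)
  obtain c d where 2: "((\<lambda>s. dfund \<delta> l (\<lambda>r. \<not> Q r) (t - s) * \<phi> s) has_integral c) {0..t}"
     "((\<lambda>s. dfund \<delta> l Q (t - s) * \<phi> s) has_integral d) {t..}" "dperron \<delta> l Q \<phi> t = c - d"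
    by (rule dperron_has_integral[OF assms])
  have "1 * \<bar>c - d\<bar> \<le> C * exp (- sg * t) * integral {0..} (\<lambda>s. exp (sg * s) * \<bar>\<phi> s\<bar>)"
    by (rule kernel_bound[OF assms 2(1,2)]) (use slow_bound fast_bound in auto)
  then show "\<bar>dperron \<delta> l Q \<phi> t\<bar> \<le> C * exp (- sg * t) * integral {0..} (\<lambda>s. exp (sg * s) * \<bar>\<phi> s\<bar>)"
    unfolding 2(3) by simp
qed

lemma perron_diff:
  assumes "forcing \<sigma> \<phi>" "forcing \<sigma> \<psi>" "sg < \<sigma>"
  shows "perron \<delta> l Q (\<lambda>s. \<phi> s - \<psi> s) t = perron \<delta> l Q \<phi> t - perron \<delta> l Q \<psi> t"
proof -
  have "perronX \<delta> l Q (\<lambda>s. \<phi> s - \<psi> s) t = perronX \<delta> l Q \<phi> t - perronX \<delta> l Q \<psi> t"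
    "perronY \<delta> l Q (\<lambda>s. \<phi> s - \<psi> s) t = perronY \<delta> l Q \<phi> t - perronY \<delta> l Q \<psi> t"
    unfolding perronX_def perronY_def right_diff_distrib
    by (simp_all add: Henstock_Kurzweil_Integration.integral_diff slow_integrable[OF _ assms(3) order_refl] assms
        integrable_finite[OF assms(1) order_refl] integrable_finite[OF assms(2) order_refl])
  then show ?thesis by (simp add: perron_def flow_diff)
qed

text \<open>At time 0 the past is empty, and only minus the integral of the pieces in
  \<open>Q\<close> is left; \<open>flow_fund_disjoint\<close> annihilates it under the integral
  sign.\<close>

lemma perron_zero_slow:
  assumes "forcing \<sigma> \<phi>" "sg < \<sigma>" "\<And>r. \<not> (Q r \<and> R r)"
  shows "flow \<delta> l R (perron \<delta> l Q \<phi> 0) (dperron \<delta> l Q \<phi> 0) t = 0"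
proof -
  have "((\<lambda>s. 0) has_integral
      flow \<delta> l R (integral {0..} (\<lambda>s. fund \<delta> l Q (- s) * \<phi> s)) (integral {0..} (\<lambda>s. dfund \<delta> l Q (- s) * \<phi> s)) t) {0..}"
    using flow_integral(1)[OF slow_integrable[OF assms(1,2) order_refl], of R t]
    unfolding flow_fund_disjoint[where Q = Q and R = R, OF assms(3)] by simp
  then have "flow \<delta> l R (integral {0..} (\<lambda>s. fund \<delta> l Q (- s) * \<phi> s)) (integral {0..} (\<lambda>s. dfund \<delta> l Q (- s) * \<phi> s)) t = 0"
    by (metis has_integral_0 has_integral_unique)
  then show ?thesis
    by (simp add: perron_def dperron_def flow_zero perronX_def perronY_def) (simp add: flow_def)
qed

end

text \<open>Needed because the notions of fast, slow and pure pairs quantify over all homogeneous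
  weak solutions. Derivatives at 0 are one-sided, so monotonicity is tested at interior points and
  extended by continuity.\<close>

lemma mode_unique:
  fixes u q :: "real \<Rightarrow> real"
  assumes "l \<ge> 0" "\<delta> > 0"
    and u: "\<And>t. t \<ge> 0 \<Longrightarrow> (u has_real_derivative q t) (at t within {0..})"
    and q: "\<And>t. t \<ge> 0 \<Longrightarrow> (q has_real_derivative (- 2 * \<delta> * q t - l * u t)) (at t within {0..})"
    and t: "t \<ge> 0"
  shows "u t = flow \<delta> l anyrate (u 0) (q 0) t" "q t = dflow \<delta> l anyrate (u 0) (q 0) t"
proof -
  define d where "d = (\<lambda>t. u t - flow \<delta> l anyrate (u 0) (q 0) t)"
  define c where "c = (\<lambda>t. q t - dflow \<delta> l anyrate (u 0) (q 0) t)"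
  note fl = flow_deriv[of \<delta> l anyrate "u 0" "q 0", THEN has_field_derivative_at_within]
  have d: "(d has_real_derivative c t) (at t within {0..})" if "t \<ge> 0" for t
    unfolding d_def c_def by (intro DERIV_diff u fl that)
  have c: "(c has_real_derivative (- 2 * \<delta> * c t - l * d t)) (at t within {0..})" if "t \<ge> 0" for t
    unfolding d_def c_def by (rule DERIV_cong[OF DERIV_diff[OF q[OF that] fl(2)]]) (simp add: algebra_simps)
  txt \<open>The energy of the difference of two solutions does not increase.\<close>
  define E where "E = (\<lambda>t. c t * c t + l * (d t * d t))"
  have E: "(E has_real_derivative - 4 * \<delta> * (c t * c t)) (at t within {0..})" if "t \<ge> 0" for t
    unfolding E_def
    by (rule DERIV_cong, (rule derivative_intros c[OF that] d[OF that] refl)+) (simp add: algebra_simps)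
  have at: "(g has_real_derivative g') (at x)" if "(g has_real_derivative g') (at x within {0..})" "x > 0"
    for g g' and x :: real
    using that at_within_interior[of x "{0..}"] by (simp add: interior_real_atLeast)
  have cont: "continuous_on {0..t} E" "continuous_on {0..t} d" for t
    by (rule continuous_on_subset[of "{0..}"], rule DERIV_continuous_on, rule E d, auto)+
  have zero: "c t = 0" if "t \<ge> 0" for t
  proof (cases "t = 0")
    case True
    then show ?thesis by (simp add: c_def flow_zero)
  next
    case False
    have "E t \<le> E 0"
    proof (rule DERIV_nonpos_imp_decreasing_open[OF that _ cont(1)])
      fix x assume "0 < x" "x < t"
      then show "\<exists>y. (E has_real_derivative y) (at x) \<and> y \<le> 0"
        using at[OF E[of x]] assms(2) by (intro exI[of _ "- 4 * \<delta> * (c x * c x)"]) auto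
    qed
    have "E 0 = 0" by (simp add: E_def c_def d_def flow_zero)
    then have "c t * c t \<le> 0" using \<open>E t \<le> E 0\<close> assms(1) unfolding E_def
      by (smt (verit) mult_nonneg_nonneg zero_le_square)
    then show ?thesis by (smt (verit) mult_eq_0_iff zero_le_square)
  qed
  \<comment> \<open>For \<open>l = 0\<close> the energy does not see \<open>d\<close>; therefore
    \<open>d\<close> is recovered from its vanishing derivative \<open>c\<close>.\<close>
  have "d t = d 0"
  proof (cases "t = 0")
    case False
    show ?thesis
    proof (rule DERIV_isconst_end[OF _ cont(2)])
      show "0 < t" using False t by simp
      show "(d has_real_derivative 0) (at x)" if "0 < x" "x < t" for x
        using at[OF d[of x]] zero[of x] that by simp
    qed
  qed simp
  then show "u t = flow \<delta> l anyrate (u 0) (q 0) t" "q t = dflow \<delta> l anyrate (u 0) (q 0) t"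
    using zero[OF t] by (auto simp: d_def c_def flow_zero)
qed

section \<open>Coefficient sequences\<close>

locale hilbert_basis =
  fixes e :: "nat \<Rightarrow> 'a::{real_inner,complete_space}" and K :: "nat set"
  assumes basis: "onb e K"
begin

lemma inner_basis: "i \<in> K \<Longrightarrow> j \<in> K \<Longrightarrow> inner (e i) (e j) = (if i = j then 1 else 0)"
  using basis by (auto simp: onb_def)

lemma parseval: "((\<lambda>k. (inner x (e k))\<^sup>2) has_sum (norm x)\<^sup>2) K"
proof -
  have "((\<lambda>k. inner x (e k) *\<^sub>R e k) has_sum x) K" using basis by (auto simp: onb_def)
  from has_sum_bounded_linear[OF bounded_linear_inner_right[of x] this]
  show ?thesis unfolding power2_norm_eq_inner by (simp add: power2_eq_square o_def)
qed

lemma coeffs_eqI: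
  assumes "\<And>k. k \<in> K \<Longrightarrow> inner x (e k) = inner y (e k)"
  shows "x = y"
proof -
  have "((\<lambda>k. (inner (x - y) (e k))\<^sup>2) has_sum 0) K"
    by (rule has_sum_0) (simp add: assms inner_diff_left)
  then have "(norm (x - y))\<^sup>2 = 0" using parseval has_sum_unique by blast
  then show ?thesis by simp
qed

lemma bessel:
  assumes "finite J" "J \<subseteq> K"
  shows "L2_set (\<lambda>k. inner x (e k)) J \<le> norm x"
proof -
  have "(\<Sum>k\<in>J. (inner x (e k))\<^sup>2) \<le> (norm x)\<^sup>2"
    by (rule finite_sum_le_has_sum[OF parseval assms(1,2)]) auto
  then show ?thesis unfolding L2_set_def by (rule real_le_lsqrt[rotated]) simp
qed

text \<open>Estimates are made on finite sections, where \<open>L2_set\<close> offers the triangle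
  and Cauchy-Schwarz inequalities, and reach the norm through this lemma.\<close>

lemma norm_le_L2:
  assumes "\<And>J. finite J \<Longrightarrow> J \<subseteq> K \<Longrightarrow> L2_set (\<lambda>k. inner x (e k)) J \<le> M"
  shows "norm x \<le> M"
proof -
  have M: "0 \<le> M" using assms[of "{}"] by simp
  have "(norm x)\<^sup>2 \<le> M\<^sup>2"
  proof (rule has_sum_le_finite_sums[OF parseval])
    fix J assume J: "finite J" "J \<subseteq> K"
    show "(\<Sum>k\<in>J. (inner x (e k))\<^sup>2) \<le> M\<^sup>2"
      using assms[OF J] M unfolding L2_set_def by (metis real_sqrt_le_iff' real_sqrt_unique sqrt_le_D)
  qed
  then show ?thesis using M by (rule power2_le_imp_le)
qed

text \<open>The squared distance of two partial sums is a block of a convergent series, so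
  completeness of the space yields the limit. The index set is run through in the order of the
  natural numbers, with zeros outside \<open>K\<close>.\<close>

lemma riesz_fischer:
  assumes "(\<lambda>k. (c k)\<^sup>2) summable_on K"
  shows "\<exists>x. \<forall>k\<in>K. inner x (e k) = c k"
proof -
  define a where "a = (\<lambda>n. if n \<in> K then (c n)\<^sup>2 else 0)"
  define s where "s = (\<lambda>n. \<Sum>k\<in>K \<inter> {..<n}. c k *\<^sub>R e k)"
  have "a summable_on UNIV"
    using assms summable_on_cong_neutral[of UNIV K a "\<lambda>k. (c k)\<^sup>2"] by (auto simp: a_def)
  then have a: "summable a" by (rule summable_on_UNIV_nonneg_real_iff[THEN iffD1, rotated]) (auto simp: a_def)
  have in_fin: "inner (\<Sum>k\<in>J. c k *\<^sub>R e k) (e j) = (if j \<in> J then c j else 0)" if "finite J" "J \<subseteq> K" "j \<in> K" for J j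
  proof -
    have "inner (\<Sum>k\<in>J. c k *\<^sub>R e k) (e j) = (\<Sum>k\<in>J. if k = j then c k else 0)"
      unfolding inner_sum_left using that by (intro sum.cong) (auto simp: inner_basis subset_iff)
    then show ?thesis using that by (simp add: sum.delta)
  qed
  have nrm: "(norm (\<Sum>k\<in>J. c k *\<^sub>R e k))\<^sup>2 = (\<Sum>k\<in>J. (c k)\<^sup>2)" if "finite J" "J \<subseteq> K" for J
  proof -
    have "(norm (\<Sum>k\<in>J. c k *\<^sub>R e k))\<^sup>2 = (\<Sum>j\<in>J. c j * inner (\<Sum>k\<in>J. c k *\<^sub>R e k) (e j))"
      unfolding power2_norm_eq_inner inner_sum_right inner_scaleR_right ..
    also have "\<dots> = (\<Sum>j\<in>J. (c j)\<^sup>2)"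
      using that by (intro sum.cong) (auto simp: in_fin subset_iff power2_eq_square)
    finally show ?thesis .
  qed
  have sd: "(norm (s n - s m))\<^sup>2 = (\<Sum>k=m..<n. a k)" if "m \<le> n" for m n
  proof -
    have "s n - s m = (\<Sum>k\<in>K \<inter> {m..<n}. c k *\<^sub>R e k)"
    proof -
      have U: "K \<inter> {..<n} = (K \<inter> {..<m}) \<union> (K \<inter> {m..<n})" using that by auto
      have "s n = s m + (\<Sum>k\<in>K \<inter> {m..<n}. c k *\<^sub>R e k)"
        unfolding s_def by (subst U, rule sum.union_disjoint) auto
      then show ?thesis by simp
    qed
    then have "(norm (s n - s m))\<^sup>2 = (\<Sum>k\<in>K \<inter> {m..<n}. (c k)\<^sup>2)" using nrm by simp
    also have "\<dots> = (\<Sum>k=m..<n. a k)" unfolding a_def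
      by (subst Int_commute, rule sum.inter_restrict) simp
    finally show ?thesis .
  qed
  have "Cauchy s"
  proof (rule CauchyI)
    fix \<epsilon> :: real assume "\<epsilon> > 0"
    then have "\<epsilon>\<^sup>2 > 0" by simp
    then obtain N where N: "\<And>m n. m \<ge> N \<Longrightarrow> norm (\<Sum>k=m..<n. a k) < \<epsilon>\<^sup>2"
      using a unfolding summable_Cauchy by blast
    have 1: "norm (s n - s m) < \<epsilon>" if "m \<ge> N" "m \<le> n" for m n
    proof -
      have "(norm (s n - s m))\<^sup>2 < \<epsilon>\<^sup>2" using sd[OF that(2)] N[OF that(1), of n] by simp
      then show ?thesis using \<open>\<epsilon> > 0\<close> by (rule power2_less_imp_less[OF _ less_imp_le])
    qed
    show "\<exists>M. \<forall>m\<ge>M. \<forall>n\<ge>M. norm (s m - s n) < \<epsilon>"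
      using 1 by (intro exI[of _ N]) (metis nle_le norm_minus_commute)
  qed
  then obtain x where x: "s \<longlonglongrightarrow> x" using Cauchy_convergent convergent_def by blast
  have "inner x (e k) = c k" if "k \<in> K" for k
  proof (rule LIMSEQ_unique)
    show "(\<lambda>n. inner (s n) (e k)) \<longlonglongrightarrow> inner x (e k)" by (intro tendsto_intros x)
    have "eventually (\<lambda>n. inner (s n) (e k) = c k) sequentially"
      using eventually_gt_at_top[of k] by eventually_elim (simp add: s_def in_fin that)
    then show "(\<lambda>n. inner (s n) (e k)) \<longlonglongrightarrow> c k" by (simp add: tendsto_eventually)
  qed
  then show ?thesis by blast
qed

text \<open>For square summable \<open>c\<close> the choice is unique by \<open>coeffs_eqI\<close>;
  otherwise it is arbitrary, which is why square summability is established before the coefficients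
  are read off.\<close>

definition of_coeffs :: "(nat \<Rightarrow> real) \<Rightarrow> 'a" where
  "of_coeffs c = (SOME x. \<forall>k\<in>K. inner x (e k) = c k)"

lemma inner_of_coeffs:
  assumes "(\<lambda>k. (c k)\<^sup>2) summable_on K" "k \<in> K"
  shows "inner (of_coeffs c) (e k) = c k"
proof -
  have "\<forall>k\<in>K. inner (of_coeffs c) (e k) = c k"
    unfolding of_coeffs_def by (rule someI_ex[OF riesz_fischer[OF assms(1)]])
  then show ?thesis using assms(2) by simp
qed

lemma square_summable_comparison:
  fixes c m :: "nat \<Rightarrow> real"
  assumes "(\<lambda>k. (m k)\<^sup>2) summable_on K" "\<And>k. k \<in> K \<Longrightarrow> \<bar>c k\<bar> \<le> m k"
  shows "(\<lambda>k. (c k)\<^sup>2) summable_on K"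
  using assms(1)
proof (rule summable_on_comparison_test)
  show "(c k)\<^sup>2 \<le> (m k)\<^sup>2" if "k \<in> K" for k
    using assms(2)[OF that] by (metis abs_ge_zero abs_of_nonneg order_trans power2_abs power_mono)
qed auto

lemma square_summable_add:
  fixes c d :: "nat \<Rightarrow> real"
  assumes "(\<lambda>k. (c k)\<^sup>2) summable_on K" "(\<lambda>k. (d k)\<^sup>2) summable_on K"
  shows "(\<lambda>k. (\<bar>c k\<bar> + \<bar>d k\<bar>)\<^sup>2) summable_on K"
proof -
  have "(\<lambda>k. 2 * (c k)\<^sup>2 + 2 * (d k)\<^sup>2) summable_on K"
    by (intro summable_on_add summable_on_cmult_right assms)
  then show ?thesis
  proof (rule summable_on_comparison_test)
    show "(\<bar>c k\<bar> + \<bar>d k\<bar>)\<^sup>2 \<le> 2 * (c k)\<^sup>2 + 2 * (d k)\<^sup>2" if "k \<in> K" for k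
      using sum_squares_ge_zero[of "\<bar>c k\<bar> - \<bar>d k\<bar>" 0] by (simp add: power2_eq_square algebra_simps)
  qed auto
qed

lemma square_summable_cmult:
  fixes c :: "nat \<Rightarrow> real"
  assumes "(\<lambda>k. (c k)\<^sup>2) summable_on K"
  shows "(\<lambda>k. (a * c k)\<^sup>2) summable_on K"
  unfolding power_mult_distrib by (intro summable_on_cmult_right assms)

lemma square_summable_L2:
  fixes m :: "nat \<Rightarrow> real"
  assumes "\<And>J. finite J \<Longrightarrow> J \<subseteq> K \<Longrightarrow> L2_set m J \<le> M"
  shows "(\<lambda>k. (m k)\<^sup>2) summable_on K"
proof (rule nonneg_bounded_partial_sums_imp_summable_on)
  have M: "0 \<le> M" using assms[of "{}"] by simp
  show "\<forall>\<^sub>F J in finite_subsets_at_top K. (\<Sum>k\<in>J. (m k)\<^sup>2) \<le> M\<^sup>2"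
  proof (rule eventually_finite_subsets_at_top_weakI)
    fix J assume J: "finite J" "J \<subseteq> K"
    show "(\<Sum>k\<in>J. (m k)\<^sup>2) \<le> M\<^sup>2"
      using assms[OF J] M unfolding L2_set_def by (metis real_sqrt_le_iff' real_sqrt_unique sqrt_le_D)
  qed
qed auto

lemma coeff_square_summable: "(\<lambda>k. (inner x (e k))\<^sup>2) summable_on K"
  using parseval summable_on_def by blast

text \<open>Dominated convergence for square summable sequences: a finite \<open>J\<close> carries
  all but \<open>\<epsilon>\<^sup>2 / 2\<close> of the mass of the majorant, and on \<open>J\<close>
  convergence of each coefficient is enough.\<close>

lemma coeffs_tendsto_zero:
  fixes X :: "'b \<Rightarrow> 'a"
  assumes lim: "\<And>k. k \<in> K \<Longrightarrow> ((\<lambda>h. inner (X h) (e k)) \<longlongrightarrow> 0) F"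
    and dom: "\<forall>\<^sub>F h in F. \<forall>k\<in>K. \<bar>inner (X h) (e k)\<bar> \<le> m k"
    and m: "(\<lambda>k. (m k)\<^sup>2) summable_on K"
  shows "(X \<longlongrightarrow> 0) F"
proof (rule tendstoI)
  fix \<epsilon> :: real assume \<epsilon>: "\<epsilon> > 0"
  define S where "S = infsum (\<lambda>k. (m k)\<^sup>2) K"
  have S: "((\<lambda>k. (m k)\<^sup>2) has_sum S) K" using m unfolding S_def by (rule has_sum_infsum)
  then have "\<forall>\<^sub>F J in finite_subsets_at_top K. dist (\<Sum>k\<in>J. (m k)\<^sup>2) S < \<epsilon>\<^sup>2 / 2"
    unfolding has_sum_def using \<epsilon> by (intro tendstoD) auto
  then obtain J where J: "finite J" "J \<subseteq> K" "dist (\<Sum>k\<in>J. (m k)\<^sup>2) S < \<epsilon>\<^sup>2 / 2"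
    unfolding eventually_finite_subsets_at_top by blast
  have "((\<lambda>h. \<Sum>k\<in>J. (inner (X h) (e k))\<^sup>2) \<longlongrightarrow> (\<Sum>k\<in>J. 0\<^sup>2)) F"
    using lim J by (intro tendsto_sum tendsto_power) auto
  then have "\<forall>\<^sub>F h in F. dist (\<Sum>k\<in>J. (inner (X h) (e k))\<^sup>2) (\<Sum>k\<in>J. 0\<^sup>2) < \<epsilon>\<^sup>2 / 2"
    using \<epsilon> by (intro tendstoD) auto
  then show "\<forall>\<^sub>F h in F. dist (X h) 0 < \<epsilon>"
    using dom
  proof eventually_elim
    case (elim h)
    \<comment> \<open>The defect of the majorant is nonnegative off \<open>J\<close>, so its sum
      over \<open>J\<close> is at most its total. Rearranged, the squared norm is at most the tail
      of the majorant plus the squared coefficients on \<open>J\<close>.\<close>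
    have "((\<lambda>k. (m k)\<^sup>2 - (inner (X h) (e k))\<^sup>2) has_sum (S - (norm (X h))\<^sup>2)) K"
      using has_sum_add[OF S has_sum_uminusI[OF parseval[of "X h"]]] by simp
    then have "(\<Sum>k\<in>J. (m k)\<^sup>2 - (inner (X h) (e k))\<^sup>2) \<le> S - (norm (X h))\<^sup>2"
    proof (rule finite_sum_le_has_sum[OF _ J(1,2)])
      show "0 \<le> (m k)\<^sup>2 - (inner (X h) (e k))\<^sup>2" if "k \<in> K - J" for k
        using elim(2) that by (metis DiffD1 abs_ge_zero diff_ge_0_iff_ge power2_abs power_mono)
    qed
    then have "(norm (X h))\<^sup>2 < \<epsilon>\<^sup>2"
      using J(3) elim(1) unfolding sum_subtractf dist_real_def zero_power2 sum.neutral_const diff_0_right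
      by linarith
    then show ?case using \<epsilon> by (simp add: power2_less_imp_less)
  qed
qed

end

section \<open>The domain of the square root of A\<close>

locale spectral_space = hilbert_basis e K for e :: "nat \<Rightarrow> 'a::{real_inner,complete_space}" and K :: "nat set" +
  fixes lam :: "nat \<Rightarrow> real"
  assumes lam_nonneg: "\<And>k. k \<in> K \<Longrightarrow> lam k \<ge> 0"
begin

abbreviation "b k \<equiv> sqrt (1 + lam k)"
abbreviation "DH \<equiv> D12 lam e K"
abbreviation "dn \<equiv> dnorm lam e K"

text \<open>The weight \<open>1 + lam k\<close> merges the norm and the graph term, so that
  membership becomes square summability of one sequence.\<close>

lemma D12_iff: "u \<in> DH \<longleftrightarrow> (\<lambda>k. (b k * inner u (e k))\<^sup>2) summable_on K"
proof -
  have eq: "(b k * inner u (e k))\<^sup>2 = (inner u (e k))\<^sup>2 + lam k * (inner u (e k))\<^sup>2" if "k \<in> K" for k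
    using lam_nonneg[OF that] by (simp add: power_mult_distrib algebra_simps)
  show ?thesis
  proof
    assume "u \<in> DH"
    then have "(\<lambda>k. (inner u (e k))\<^sup>2 + lam k * (inner u (e k))\<^sup>2) summable_on K"
      by (intro summable_on_add coeff_square_summable) (simp add: D12_def)
    then show "(\<lambda>k. (b k * inner u (e k))\<^sup>2) summable_on K"
      using summable_on_cong[of K, OF eq] by simp
  next
    assume "(\<lambda>k. (b k * inner u (e k))\<^sup>2) summable_on K"
    then have "(\<lambda>k. (inner u (e k))\<^sup>2 + lam k * (inner u (e k))\<^sup>2) summable_on K"
      using summable_on_cong[of K, OF eq] by simp
    then have "(\<lambda>k. lam k * (inner u (e k))\<^sup>2) summable_on K"
      by (rule summable_on_comparison_test) (auto simp: lam_nonneg)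
    then show "u \<in> DH" by (simp add: D12_def)
  qed
qed

text \<open>The square root of I + A, an isometry from the graph norm to the norm of the space. It
  reduces every statement about \<open>dn\<close> to one about coefficient sequences.\<close>

definition B :: "'a \<Rightarrow> 'a" where
  "B u = of_coeffs (\<lambda>k. b k * inner u (e k))"

lemma inner_B: "u \<in> DH \<Longrightarrow> k \<in> K \<Longrightarrow> inner (B u) (e k) = b k * inner u (e k)"
  unfolding B_def by (rule inner_of_coeffs) (simp add: D12_iff)

lemma norm_B:
  assumes "u \<in> DH"
  shows "norm (B u) = dn u"
proof -
  have "((\<lambda>k. (inner u (e k))\<^sup>2 + lam k * (inner u (e k))\<^sup>2) has_sum (norm u)\<^sup>2 + halfsq lam e K u) K"
    using assms unfolding halfsq_def D12_def by (intro has_sum_add parseval has_sum_infsum) auto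
  moreover have "((\<lambda>k. (inner (B u) (e k))\<^sup>2) has_sum (norm (B u))\<^sup>2) K" by (rule parseval)
  moreover have "(inner (B u) (e k))\<^sup>2 = (inner u (e k))\<^sup>2 + lam k * (inner u (e k))\<^sup>2" if "k \<in> K" for k
    using inner_B[OF assms that] lam_nonneg[OF that] by (simp add: power_mult_distrib algebra_simps)
  ultimately have "(norm (B u))\<^sup>2 = (norm u)\<^sup>2 + halfsq lam e K u"
    using has_sum_cong has_sum_unique by (metis (no_types, lifting))
  then show ?thesis unfolding dnorm_def by (metis norm_ge_zero real_sqrt_unique)
qed

lemma D12_of_coeffs:
  assumes "(\<lambda>k. (m k)\<^sup>2) summable_on K" "\<And>k. k \<in> K \<Longrightarrow> b k * \<bar>c k\<bar> \<le> m k"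
  shows "(\<lambda>k. (c k)\<^sup>2) summable_on K" "of_coeffs c \<in> DH"
proof -
  have "\<bar>c k\<bar> \<le> m k" if "k \<in> K" for k
  proof -
    have "1 * \<bar>c k\<bar> \<le> b k * \<bar>c k\<bar>" using lam_nonneg[OF that] by (intro mult_right_mono) auto
    then show ?thesis using assms(2)[OF that] by simp
  qed
  then show 1: "(\<lambda>k. (c k)\<^sup>2) summable_on K" by (rule square_summable_comparison[OF assms(1)])
  have "(\<lambda>k. (b k * c k)\<^sup>2) summable_on K"
    using assms(2) lam_nonneg by (intro square_summable_comparison[OF assms(1)]) (auto simp: abs_mult)
  moreover have "(b k * c k)\<^sup>2 = (b k * inner (of_coeffs c) (e k))\<^sup>2" if "k \<in> K" for k
    using inner_of_coeffs[OF 1 that] by simp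
  ultimately show "of_coeffs c \<in> DH" unfolding D12_iff using summable_on_cong by (metis (no_types, lifting))
qed

lemma D12_add: "u \<in> DH \<Longrightarrow> v \<in> DH \<Longrightarrow> u + v \<in> DH"
  unfolding D12_iff
  by (rule square_summable_comparison[OF square_summable_add[of "\<lambda>k. b k * inner u (e k)" "\<lambda>k. b k * inner v (e k)"]])
     (auto simp: inner_add_left distrib_left)

lemma D12_diff: "u \<in> DH \<Longrightarrow> v \<in> DH \<Longrightarrow> u - v \<in> DH"
  unfolding D12_iff
  by (rule square_summable_comparison[OF square_summable_add[of "\<lambda>k. b k * inner u (e k)" "\<lambda>k. b k * inner v (e k)"]])
     (auto simp: inner_diff_left right_diff_distrib)

lemma dnorm_add: "u \<in> DH \<Longrightarrow> v \<in> DH \<Longrightarrow> dn (u + v) \<le> dn u + dn v"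
proof -
  assume u: "u \<in> DH" "v \<in> DH"
  have "B (u + v) = B u + B v"
    by (rule coeffs_eqI) (simp add: inner_B u D12_add inner_add_left distrib_left)
  then show ?thesis using norm_triangle_ineq[of "B u" "B v"] norm_B u D12_add by metis
qed

lemma dnorm_nonneg: "0 \<le> dn u"
  unfolding dnorm_def halfsq_def using lam_nonneg by (auto intro!: infsum_nonneg add_nonneg_nonneg)

lemma dnorm_le_L2:
  assumes "u \<in> DH" "\<And>k. k \<in> K \<Longrightarrow> b k * \<bar>inner u (e k)\<bar> \<le> m k"
    "\<And>J. finite J \<Longrightarrow> J \<subseteq> K \<Longrightarrow> L2_set m J \<le> M"
  shows "dn u \<le> M"
proof -
  have "norm (B u) \<le> M"
  proof (rule norm_le_L2)
    fix J assume J: "finite J" "J \<subseteq> K"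
    have "L2_set (\<lambda>k. inner (B u) (e k)) J = L2_set (\<lambda>k. \<bar>inner (B u) (e k)\<bar>) J"
      by (simp add: L2_set_def)
    also have "\<dots> \<le> L2_set m J"
    proof (rule L2_set_mono)
      fix k assume "k \<in> J"
      then have "k \<in> K" using J by auto
      then show "\<bar>inner (B u) (e k)\<bar> \<le> m k"
        using assms(2)[of k] lam_nonneg[of k] by (simp add: inner_B assms(1) abs_mult)
    qed simp
    finally show "L2_set (\<lambda>k. inner (B u) (e k)) J \<le> M" using assms(3)[OF J] by simp
  qed
  then show ?thesis using norm_B assms(1) by simp
qed

lemma L2_le_dnorm:
  assumes "u \<in> DH" "finite J" "J \<subseteq> K"
  shows "L2_set (\<lambda>k. b k * inner u (e k)) J \<le> dn u"
proof -
  have "L2_set (\<lambda>k. b k * inner u (e k)) J = L2_set (\<lambda>k. inner (B u) (e k)) J"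
    using assms by (intro L2_set_cong) (auto simp: inner_B)
  then show ?thesis using bessel[OF assms(2,3), of "B u"] norm_B assms(1) by simp
qed

text \<open>The passage from modes to vectors. The majorant is uniform over each compact time
  interval, so \<open>coeffs_tendsto_zero\<close> applies to increments in the graph norm, to
  increments of the derivative and to difference quotients.\<close>

lemma weak_sol_assemble:
  fixes c c' :: "nat \<Rightarrow> real \<Rightarrow> real"
  assumes c: "\<And>k t. k \<in> K \<Longrightarrow> t \<ge> 0 \<Longrightarrow> (c k has_real_derivative c' k t) (at t within {0..})"
    and c': "\<And>k t. k \<in> K \<Longrightarrow> t \<ge> 0 \<Longrightarrow> (c' k has_real_derivative
        (inner (g t) (e k) - 2 * \<delta> * c' k t - lam k * c k t)) (at t within {0..})"
    and dom: "\<And>T. \<exists>m. (\<lambda>k. (m k)\<^sup>2) summable_on K \<and>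
        (\<forall>k\<in>K. \<forall>t\<in>{0..T}. b k * \<bar>c k t\<bar> \<le> m k \<and> \<bar>c' k t\<bar> \<le> m k)"
  shows "weak_sol \<delta> lam e K g (\<lambda>t. of_coeffs (\<lambda>k. c k t)) (\<lambda>t. of_coeffs (\<lambda>k. c' k t))"
    "\<And>k t. k \<in> K \<Longrightarrow> t \<ge> 0 \<Longrightarrow> inner (of_coeffs (\<lambda>k. c k t)) (e k) = c k t"
    "\<And>k t. k \<in> K \<Longrightarrow> t \<ge> 0 \<Longrightarrow> inner (of_coeffs (\<lambda>k. c' k t)) (e k) = c' k t"
proof -
  define u where "u = (\<lambda>t. of_coeffs (\<lambda>k. c k t))"
  define v where "v = (\<lambda>t. of_coeffs (\<lambda>k. c' k t))"
  have D: "u t \<in> DH" and u: "\<And>k. k \<in> K \<Longrightarrow> inner (u t) (e k) = c k t"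
    and v: "\<And>k. k \<in> K \<Longrightarrow> inner (v t) (e k) = c' k t" if t: "t \<ge> 0" for t
  proof -
    obtain m where m: "(\<lambda>k. (m k)\<^sup>2) summable_on K" "\<And>k. k \<in> K \<Longrightarrow> b k * \<bar>c k t\<bar> \<le> m k"
        "\<And>k. k \<in> K \<Longrightarrow> \<bar>c' k t\<bar> \<le> m k"
      using dom[of t] t by fastforce
    show "u t \<in> DH" unfolding u_def by (rule D12_of_coeffs(2)[OF m(1,2)])
    show "inner (u t) (e k) = c k t" if "k \<in> K" for k
      unfolding u_def by (rule inner_of_coeffs[OF D12_of_coeffs(1)[OF m(1,2)] that])
    show "inner (v t) (e k) = c' k t" if "k \<in> K" for k
      unfolding v_def by (rule inner_of_coeffs[OF square_summable_comparison[OF m(1,3)] that])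
  qed
  \<comment> \<open>All limits are taken at \<open>t\<close>, and times near \<open>t\<close> stay
    in \<open>{0..t + 1}\<close>; one majorant, chosen for that interval, then serves
    throughout.\<close>
  have ev: "\<forall>\<^sub>F s in at t within {0..}. s \<in> {0..t + 1} \<and> s \<noteq> t" for t :: real
    unfolding eventually_at by (rule exI[of _ 1]) (auto simp: dist_real_def)
  have cont_c: "(c k \<longlongrightarrow> c k t) (at t within {0..})" "(c' k \<longlongrightarrow> c' k t) (at t within {0..})"
    if "k \<in> K" "t \<ge> 0" for k t
    using DERIV_continuous[OF c[OF that]] DERIV_continuous[OF c'[OF that]]
    by (auto simp: continuous_within)
  have P1: "((\<lambda>s. dn (u s - u t)) \<longlongrightarrow> 0) (at t within {0..})"
    and P2: "((\<lambda>s. v s - v t) \<longlongrightarrow> 0) (at t within {0..})"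
    and P3: "(u has_vector_derivative v t) (at t within {0..})" if t: "t \<ge> 0" for t
  proof -
    obtain m where m: "(\<lambda>k. (m k)\<^sup>2) summable_on K"
        "\<And>k s. k \<in> K \<Longrightarrow> s \<in> {0..t + 1} \<Longrightarrow> b k * \<bar>c k s\<bar> \<le> m k"
        "\<And>k s. k \<in> K \<Longrightarrow> s \<in> {0..t + 1} \<Longrightarrow> \<bar>c' k s\<bar> \<le> m k"
      using dom[of "t + 1"] by blast
    have m2: "(\<lambda>k. (2 * m k)\<^sup>2) summable_on K" by (rule square_summable_cmult[OF m(1)])
    have tt: "t \<in> {0..t + 1}" using t by simp
    have "((\<lambda>s. B (u s - u t)) \<longlongrightarrow> 0) (at t within {0..})"
    proof (rule coeffs_tendsto_zero[OF _ _ m2])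
      show "\<forall>\<^sub>F s in at t within {0..}. \<forall>k\<in>K. \<bar>inner (B (u s - u t)) (e k)\<bar> \<le> 2 * m k"
        using ev[of t]
      proof (eventually_elim, intro ballI)
        fix s k assume s: "s \<in> {0..t + 1} \<and> s \<noteq> t" and k: "k \<in> K"
        have "\<bar>inner (B (u s - u t)) (e k)\<bar> = b k * \<bar>c k s - c k t\<bar>"
          using s t k D12_diff[OF D D, of s t] lam_nonneg[OF k]
          by (simp add: inner_B inner_diff_left u abs_mult)
        also have "\<dots> \<le> b k * (\<bar>c k s\<bar> + \<bar>c k t\<bar>)"
          using lam_nonneg[OF k] by (intro mult_left_mono) auto
        also have "\<dots> \<le> 2 * m k" using m(2)[OF k, of s] m(2)[OF k tt] s by (simp add: distrib_left)
        finally show "\<bar>inner (B (u s - u t)) (e k)\<bar> \<le> 2 * m k" .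
      qed
      fix k assume k: "k \<in> K"
      have "((\<lambda>s. b k * (c k s - c k t)) \<longlongrightarrow> b k * (c k t - c k t)) (at t within {0..})"
        by (intro tendsto_intros cont_c k t)
      moreover have "\<forall>\<^sub>F s in at t within {0..}. b k * (c k s - c k t) = inner (B (u s - u t)) (e k)"
        using ev[of t] by eventually_elim (use t k D12_diff[OF D D, of _ t] in \<open>simp add: inner_B inner_diff_left u\<close>)
      ultimately show "((\<lambda>s. inner (B (u s - u t)) (e k)) \<longlongrightarrow> 0) (at t within {0..})"
        using tendsto_cong by fastforce
    qed
    then have "((\<lambda>s. norm (B (u s - u t))) \<longlongrightarrow> 0) (at t within {0..})" by (rule tendsto_norm_zero)
    moreover have "\<forall>\<^sub>F s in at t within {0..}. norm (B (u s - u t)) = dn (u s - u t)"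
      using ev[of t] by eventually_elim (use t D12_diff[OF D D, of _ t] norm_B in auto)
    ultimately show "((\<lambda>s. dn (u s - u t)) \<longlongrightarrow> 0) (at t within {0..})"
      using tendsto_cong by fastforce
    show "((\<lambda>s. v s - v t) \<longlongrightarrow> 0) (at t within {0..})"
    proof (rule coeffs_tendsto_zero[OF _ _ m2])
      show "\<forall>\<^sub>F s in at t within {0..}. \<forall>k\<in>K. \<bar>inner (v s - v t) (e k)\<bar> \<le> 2 * m k"
        using ev[of t]
      proof (eventually_elim, intro ballI)
        fix s k assume s: "s \<in> {0..t + 1} \<and> s \<noteq> t" and k: "k \<in> K"
        then show "\<bar>inner (v s - v t) (e k)\<bar> \<le> 2 * m k"
          using m(3)[OF k, of s] m(3)[OF k tt] t by (simp add: inner_diff_left v)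
      qed
      fix k assume k: "k \<in> K"
      have "((\<lambda>s. c' k s - c' k t) \<longlongrightarrow> c' k t - c' k t) (at t within {0..})"
        by (intro tendsto_intros cont_c k t)
      moreover have "\<forall>\<^sub>F s in at t within {0..}. c' k s - c' k t = inner (v s - v t) (e k)"
        using ev[of t] by eventually_elim (use t k in \<open>simp add: inner_diff_left v\<close>)
      ultimately show "((\<lambda>s. inner (v s - v t) (e k)) \<longlongrightarrow> 0) (at t within {0..})"
        using tendsto_cong by fastforce
    qed
    have "((\<lambda>s. (1 / norm (s - t)) *\<^sub>R (u s - (u t + (s - t) *\<^sub>R v t))) \<longlongrightarrow> 0) (at t within {0..})"
    proof (rule coeffs_tendsto_zero[OF _ _ m2])
      show "\<forall>\<^sub>F s in at t within {0..}. \<forall>k\<in>K.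
          \<bar>inner ((1 / norm (s - t)) *\<^sub>R (u s - (u t + (s - t) *\<^sub>R v t))) (e k)\<bar> \<le> 2 * m k"
        using ev[of t]
      proof (eventually_elim, intro ballI)
        fix s k assume s: "s \<in> {0..t + 1} \<and> s \<noteq> t" and k: "k \<in> K"
        \<comment> \<open>By the mean value inequality the bound on \<open>c' k\<close> bounds the
          difference quotient by \<open>m k\<close>. Subtracting the derivative itself costs another
          \<open>m k\<close>, hence the majorant \<open>2 * m k\<close>.\<close>
        have "norm (c k s - c k t) \<le> m k * norm (s - t)"
        proof (rule field_differentiable_bound[where S = "{0..t + 1}" and f' = "c' k"])
          show "(c k has_real_derivative c' k z) (at z within {0..t + 1})" if "z \<in> {0..t + 1}" for z
            using that by (intro DERIV_subset[OF c[OF k]]) auto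
        qed (use m(3)[OF k] s tt in auto)
        moreover have "\<bar>(s - t) * c' k t\<bar> \<le> m k * \<bar>s - t\<bar>"
          using mult_right_mono[OF m(3)[OF k tt], of "\<bar>s - t\<bar>"] by (simp add: abs_mult mult.commute)
        ultimately have "\<bar>c k s - (c k t + (s - t) * c' k t)\<bar> \<le> 2 * m k * \<bar>s - t\<bar>" by simp
        then have "\<bar>c k s - (c k t + (s - t) * c' k t)\<bar> / \<bar>s - t\<bar> \<le> 2 * m k"
          using s by (simp add: divide_le_eq)
        then show "\<bar>inner ((1 / norm (s - t)) *\<^sub>R (u s - (u t + (s - t) *\<^sub>R v t))) (e k)\<bar> \<le> 2 * m k"
          using s t k by (simp add: inner_diff_left inner_add_left u v abs_mult)
      qed
      fix k assume k: "k \<in> K"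
      have "((\<lambda>s. (1 / norm (s - t)) *\<^sub>R (c k s - (c k t + c' k t * (s - t)))) \<longlongrightarrow> 0) (at t within {0..})"
        using c[OF k t] unfolding has_field_derivative_def has_derivative_within by simp
      moreover have "\<forall>\<^sub>F s in at t within {0..}. (1 / norm (s - t)) *\<^sub>R (c k s - (c k t + c' k t * (s - t)))
          = inner ((1 / norm (s - t)) *\<^sub>R (u s - (u t + (s - t) *\<^sub>R v t))) (e k)"
        using ev[of t] by eventually_elim (use t k in \<open>simp add: inner_diff_left inner_add_left u v mult.commute\<close>)
      ultimately show "((\<lambda>s. inner ((1 / norm (s - t)) *\<^sub>R (u s - (u t + (s - t) *\<^sub>R v t))) (e k)) \<longlongrightarrow> 0)
          (at t within {0..})"
        by (rule Lim_transform_eventually)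
    qed
    then show "(u has_vector_derivative v t) (at t within {0..})"
      unfolding has_vector_derivative_def has_derivative_within
      by (simp add: bounded_linear_scaleR_left)
  qed
  have "continuous_on {0..} v"
    unfolding continuous_on_def using P2 Lim_null by (metis atLeast_iff)
  moreover have "((\<lambda>s. inner (v s) (e k)) has_real_derivative
      (inner (g t) (e k) - 2 * \<delta> * inner (v t) (e k) - lam k * inner (u t) (e k))) (at t within {0..})"
    if "k \<in> K" "t \<ge> 0" for k t
    by (rule has_field_derivative_transform_within[of "c' k" _ t "{0..}" 1])
      (use c'[OF that] that in \<open>auto simp: u v\<close>)
  ultimately show "weak_sol \<delta> lam e K g (\<lambda>t. of_coeffs (\<lambda>k. c k t)) (\<lambda>t. of_coeffs (\<lambda>k. c' k t))"
    unfolding weak_sol_def u_def[symmetric] v_def[symmetric] using D P1 P3 by auto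
  show "inner (of_coeffs (\<lambda>k. c k t)) (e k) = c k t" "inner (of_coeffs (\<lambda>k. c' k t)) (e k) = c' k t"
    if "k \<in> K" "t \<ge> 0" for k t
    using u v that unfolding u_def v_def by auto
qed

end

section \<open>Homogeneous solutions\<close>

text \<open>Completing the square gives
  \<open>(z - \<delta>)\<^sup>2 = \<delta>\<^sup>2 - l\<close>. A nonpositive right-hand side forces
  \<open>z - \<delta>\<close> to be purely imaginary, so both roots have real part \<delta>; a
  positive one gives two real roots.\<close>

lemma rates_eq_roots:
  assumes "l \<ge> 0"
  shows "rates \<delta> l = {Re z | z. z\<^sup>2 - 2 * complex_of_real \<delta> * z + complex_of_real l = 0}"
proof -
  have root: "z\<^sup>2 - 2 * complex_of_real \<delta> * z + complex_of_real l = 0 \<longleftrightarrow>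
      (z - complex_of_real \<delta>)\<^sup>2 = complex_of_real (\<delta>\<^sup>2 - l)" for z
    by (auto simp: power2_eq_square algebra_simps)
  show ?thesis
  proof (cases "l \<ge> \<delta>\<^sup>2")
    case True
    define w where "w = sqrt (l - \<delta>\<^sup>2)"
    have w: "w\<^sup>2 = l - \<delta>\<^sup>2" using True unfolding w_def by simp
    have "(complex_of_real \<delta> + \<i> * complex_of_real w - complex_of_real \<delta>)\<^sup>2 = complex_of_real (\<delta>\<^sup>2 - l)"
      using arg_cong[OF w, of complex_of_real] by (simp add: power_mult_distrib algebra_simps)
    moreover have "Re z = \<delta>" if "(z - complex_of_real \<delta>)\<^sup>2 = complex_of_real (\<delta>\<^sup>2 - l)" for z
    proof -
      define a where "a = Re z - \<delta>"
      have "z - complex_of_real \<delta> = Complex a (Im z)" by (simp add: a_def complex_eq_iff)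
      then have c: "Complex a (Im z) * Complex a (Im z) = complex_of_real (\<delta>\<^sup>2 - l)"
        using that by (simp add: power2_eq_square)
      have 1: "a * a - Im z * Im z = \<delta>\<^sup>2 - l" using arg_cong[OF c, of Re] by simp
      have 2: "a * Im z = 0" using arg_cong[OF c, of Im] by simp
      have "a = 0"
      proof (rule ccontr)
        assume "a \<noteq> 0"
        with 2 have "Im z = 0" by simp
        with 1 have "a * a \<le> 0" using True by simp
        with \<open>a \<noteq> 0\<close> show False by (metis mult_le_0_iff mult_eq_0_iff nle_le zero_le_square order_antisym)
      qed
      then show ?thesis by (simp add: a_def)
    qed
    ultimately show ?thesis unfolding root rates_def using True
      by (auto intro!: exI[of _ "complex_of_real \<delta> + \<i> * complex_of_real w"])
  next
    case False
    define w where "w = sqrt (\<delta>\<^sup>2 - l)"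
    have w: "w\<^sup>2 = \<delta>\<^sup>2 - l" using False unfolding w_def by simp
    have "(z - complex_of_real \<delta>)\<^sup>2 = complex_of_real (\<delta>\<^sup>2 - l) \<longleftrightarrow>
        z = complex_of_real (\<delta> + w) \<or> z = complex_of_real (\<delta> - w)" for z
    proof -
      have "(z - complex_of_real \<delta>)\<^sup>2 = complex_of_real (\<delta>\<^sup>2 - l) \<longleftrightarrow>
          (z - complex_of_real \<delta>)\<^sup>2 = (complex_of_real w)\<^sup>2" unfolding w[symmetric] by simp
      also have "\<dots> \<longleftrightarrow> z = complex_of_real (\<delta> + w) \<or> z = complex_of_real (\<delta> - w)"
        unfolding power2_eq_iff by (auto simp: algebra_simps)
      finally show ?thesis .
    qed
    then have "{Re z | z. (z - complex_of_real \<delta>)\<^sup>2 = complex_of_real (\<delta>\<^sup>2 - l)}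
        = {Re z | z. z = complex_of_real (\<delta> + w) \<or> z = complex_of_real (\<delta> - w)}" by simp
    also have "\<dots> = {Re (complex_of_real (\<delta> + w)), Re (complex_of_real (\<delta> - w))}" by blast
    finally show ?thesis unfolding root rates_def w_def[symmetric] using False by auto
  qed
qed

lemma Dset_eq_rates:
  assumes "\<forall>k\<in>K. lam k \<ge> 0"
  shows "Dset \<delta> lam K = (\<Union>k\<in>K. rates \<delta> (lam k))"
  unfolding Dset_def spec_def using assms by (auto simp: rates_eq_roots)

lemma rates_nonneg:
  assumes "l \<ge> 0" "\<delta> > 0" "r \<in> rates \<delta> l"
  shows "r \<ge> 0"
proof -
  have "sqrt (\<delta>\<^sup>2 - l) \<le> \<delta>" using assms by (simp add: real_le_lsqrt)
  moreover have "0 \<le> sqrt (\<delta>\<^sup>2 - l)" if "l < \<delta>\<^sup>2" using that by simp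
  ultimately show ?thesis using assms by (auto simp: rates_def split: if_splits)
qed

text \<open>Data are measured in the phase space norm
  \<open>sqrt (1 + l) * \<bar>x\<bar> + \<bar>y\<bar>\<close>, in which the flow is bounded
  uniformly in \<open>l\<close>. The factor \<open>1 + 2 * \<delta>\<close> comes from the damping
  term in \<open>flow\<close>.\<close>

lemma flow_bound:
  assumes "l \<ge> 0" "\<delta> > 0" "sqrt (1 + l) * \<bar>fund \<delta> l Q t\<bar> \<le> E" "\<bar>dfund \<delta> l Q t\<bar> \<le> E"
  shows "sqrt (1 + l) * \<bar>flow \<delta> l Q x y t\<bar> \<le> (1 + 2 * \<delta>) * E * (sqrt (1 + l) * \<bar>x\<bar> + \<bar>y\<bar>)"
    "\<bar>dflow \<delta> l Q x y t\<bar> \<le> (1 + 2 * \<delta>) * E * (sqrt (1 + l) * \<bar>x\<bar> + \<bar>y\<bar>)"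
proof -
  define \<beta> where "\<beta> = sqrt (1 + l)"
  define P where "P = \<bar>fund \<delta> l Q t\<bar>"
  define D where "D = \<bar>dfund \<delta> l Q t\<bar>"
  have \<beta>: "\<beta> \<ge> 1" "\<beta> * \<beta> = 1 + l" using assms(1) by (auto simp: \<beta>_def)
  have PD: "0 \<le> P" "0 \<le> D" "\<beta> * P \<le> E" "D \<le> E" using assms by (auto simp: P_def D_def \<beta>_def)
  have PE: "P \<le> E" using PD mult_right_mono[OF \<beta>(1) PD(1)] by linarith
  have E: "0 \<le> E" using PD by linarith
  have bx: "0 \<le> \<beta> * \<bar>x\<bar>" using \<beta> by simp
  have "\<bar>flow \<delta> l Q x y t\<bar> \<le> \<bar>x\<bar> * (D + 2 * \<delta> * P) + \<bar>y\<bar> * P"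
  proof -
    have "\<bar>flow \<delta> l Q x y t\<bar> \<le> \<bar>x * (dfund \<delta> l Q t + 2 * \<delta> * fund \<delta> l Q t)\<bar> + \<bar>y * fund \<delta> l Q t\<bar>"
      unfolding flow_def by (rule abs_triangle_ineq)
    also have "\<dots> = \<bar>x\<bar> * \<bar>dfund \<delta> l Q t + 2 * \<delta> * fund \<delta> l Q t\<bar> + \<bar>y\<bar> * P" by (simp add: abs_mult P_def)
    also have "\<bar>dfund \<delta> l Q t + 2 * \<delta> * fund \<delta> l Q t\<bar> \<le> D + 2 * \<delta> * P"
      using abs_triangle_ineq[of "dfund \<delta> l Q t" "2 * \<delta> * fund \<delta> l Q t"] assms(2) by (simp add: abs_mult P_def D_def)
    finally show ?thesis by (simp add: mult_left_mono)
  qed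
  then have "\<beta> * \<bar>flow \<delta> l Q x y t\<bar> \<le> \<beta> * (\<bar>x\<bar> * (D + 2 * \<delta> * P) + \<bar>y\<bar> * P)"
    using \<beta> by (intro mult_left_mono) auto
  also have "\<dots> = (\<beta> * \<bar>x\<bar>) * (D + 2 * \<delta> * P) + \<bar>y\<bar> * (\<beta> * P)" by (simp add: algebra_simps)
  also have "\<dots> \<le> (\<beta> * \<bar>x\<bar>) * (E + 2 * \<delta> * E) + \<bar>y\<bar> * (E + 2 * \<delta> * E)"
    using PD PE bx assms(2) E by (intro add_mono mult_left_mono) (auto intro: order_trans)
  finally show "sqrt (1 + l) * \<bar>flow \<delta> l Q x y t\<bar> \<le> (1 + 2 * \<delta>) * E * (sqrt (1 + l) * \<bar>x\<bar> + \<bar>y\<bar>)"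
    unfolding \<beta>_def[symmetric] by (simp add: algebra_simps)
  have "\<bar>dflow \<delta> l Q x y t\<bar> \<le> \<bar>y\<bar> * D + l * \<bar>x\<bar> * P"
    using abs_triangle_ineq4[of "y * dfund \<delta> l Q t" "l * x * fund \<delta> l Q t"] assms(1)
    by (simp add: dflow_def abs_mult P_def D_def)
  \<comment> \<open>The unbounded factor \<open>l\<close> is at most \<beta> times \<beta>: one
    \<beta> is absorbed by the weighted datum, the other by the weighted kernel.\<close>
  also have "\<dots> \<le> \<bar>y\<bar> * D + (\<beta> * \<beta>) * \<bar>x\<bar> * P"
    using PD by (intro add_left_mono mult_right_mono) (auto simp: \<beta>(2))
  also have "\<dots> = \<bar>y\<bar> * D + (\<beta> * \<bar>x\<bar>) * (\<beta> * P)" by simp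
  also have "\<dots> \<le> \<bar>y\<bar> * (E + 2 * \<delta> * E) + (\<beta> * \<bar>x\<bar>) * (E + 2 * \<delta> * E)"
    using PD PE bx assms(2) E by (intro add_mono mult_left_mono) (auto intro: order_trans)
  finally show "\<bar>dflow \<delta> l Q x y t\<bar> \<le> (1 + 2 * \<delta>) * E * (sqrt (1 + l) * \<bar>x\<bar> + \<bar>y\<bar>)"
    unfolding \<beta>_def[symmetric] by (simp add: algebra_simps)
qed

text \<open>Vanishing of a component is known for nonnegative times only, so at time 0 the
  derivative must be identified from one side.\<close>

lemma dflow_eq_0:
  assumes "\<And>t. t \<ge> 0 \<Longrightarrow> flow \<delta> l Q x y t = 0" "t \<ge> 0"
  shows "dflow \<delta> l Q x y t = 0"
proof -
  have 1: "(flow \<delta> l Q x y has_vector_derivative dflow \<delta> l Q x y t) (at t within {0..t + 1})"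
    using flow_deriv(1)[of \<delta> l Q x y t] has_field_derivative_at_within
    unfolding has_real_derivative_iff_has_vector_derivative[symmetric] by blast
  have "((\<lambda>_. 0) has_vector_derivative dflow \<delta> l Q x y t) (at t within {0..t + 1})"
    by (rule has_vector_derivative_transform[OF _ _ 1]) (use assms in auto)
  then show ?thesis
    using vector_derivative_unique_within_closed_interval[of 0 "t + 1" t "\<lambda>_. 0" "dflow \<delta> l Q x y t" 0] assms(2)
    by (auto simp: cbox_interval)
qed

text \<open>Collects the estimates that are uniform in the mode, leaving the choice of exponents to
  the theorem. \<open>slow_est\<close> and \<open>fast_est\<close> form the dichotomy at
  \<open>sg\<close>, \<open>pure_est\<close> has the weaker rate \<rho>. The crude
  \<open>growth_est\<close> holds for every selection of pieces and provides the square summability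
  and local domination behind homogeneous solutions and their components.\<close>

locale damped = spectral_space e K lam
  for e :: "nat \<Rightarrow> 'a::{real_inner,complete_space}" and K :: "nat set" and lam :: "nat \<Rightarrow> real" +
  fixes \<delta> r0 \<rho> sg C :: real
  assumes delta_pos: "\<delta> > 0" and C_pos: "C > 0"
    and slow_est: "\<And>k t. k \<in> K \<Longrightarrow> t \<le> 0 \<Longrightarrow>
      b k * \<bar>fund \<delta> (lam k) (\<lambda>r. r \<le> r0) t\<bar> \<le> C * exp (- sg * t) \<and>
      \<bar>dfund \<delta> (lam k) (\<lambda>r. r \<le> r0) t\<bar> \<le> C * exp (- sg * t)"
    and fast_est: "\<And>k t. k \<in> K \<Longrightarrow> t \<ge> 0 \<Longrightarrow>
      b k * \<bar>fund \<delta> (lam k) (\<lambda>r. \<not> r \<le> r0) t\<bar> \<le> C * exp (- sg * t) \<and>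
      \<bar>dfund \<delta> (lam k) (\<lambda>r. \<not> r \<le> r0) t\<bar> \<le> C * exp (- sg * t)"
    and pure_est: "\<And>k t. k \<in> K \<Longrightarrow> t \<ge> 0 \<Longrightarrow>
      b k * \<bar>fund \<delta> (lam k) (\<lambda>r. r = r0) t\<bar> \<le> C * exp (- \<rho> * t) \<and>
      \<bar>dfund \<delta> (lam k) (\<lambda>r. r = r0) t\<bar> \<le> C * exp (- \<rho> * t)"
    and growth_est: "\<And>k Q t. k \<in> K \<Longrightarrow> t \<ge> 0 \<Longrightarrow>
      b k * \<bar>fund \<delta> (lam k) Q t\<bar> \<le> C * exp t \<and> \<bar>dfund \<delta> (lam k) Q t\<bar> \<le> C * exp t"
begin

abbreviation "C1 \<equiv> (1 + 2 * \<delta>) * C"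

lemma b_ge_1: "k \<in> K \<Longrightarrow> b k \<ge> 1"
  using lam_nonneg by simp

definition data :: "'a \<Rightarrow> 'a \<Rightarrow> nat \<Rightarrow> real" where
  "data x0 x1 k = b k * \<bar>inner x0 (e k)\<bar> + \<bar>inner x1 (e k)\<bar>"

lemma data_summable:
  assumes "x0 \<in> DH"
  shows "(\<lambda>k. (data x0 x1 k)\<^sup>2) summable_on K"
proof -
  have "(\<lambda>k. (\<bar>b k * inner x0 (e k)\<bar> + \<bar>inner x1 (e k)\<bar>)\<^sup>2) summable_on K"
    using assms by (intro square_summable_add coeff_square_summable) (simp add: D12_iff)
  then show ?thesis
    by (rule square_summable_comparison) (use b_ge_1 in \<open>force simp: data_def abs_mult\<close>)
qed

lemma data_L2:
  assumes "x0 \<in> DH" "finite J" "J \<subseteq> K"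
  shows "L2_set (data x0 x1) J \<le> dn x0 + norm x1"
proof -
  have "L2_set (data x0 x1) J \<le> L2_set (\<lambda>k. b k * \<bar>inner x0 (e k)\<bar>) J + L2_set (\<lambda>k. \<bar>inner x1 (e k)\<bar>) J"
    unfolding data_def by (rule L2_set_triangle_ineq)
  also have "L2_set (\<lambda>k. b k * \<bar>inner x0 (e k)\<bar>) J = L2_set (\<lambda>k. b k * inner x0 (e k)) J"
    by (simp add: L2_set_def power_mult_distrib)
  also have "L2_set (\<lambda>k. \<bar>inner x1 (e k)\<bar>) J = L2_set (\<lambda>k. inner x1 (e k)) J"
    by (simp add: L2_set_def)
  finally show ?thesis using L2_le_dnorm[OF assms] bessel[OF assms(2,3), of x1] by linarith
qed

lemma flow_growth:
  assumes "k \<in> K" "t \<ge> 0"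
  shows "b k * \<bar>flow \<delta> (lam k) Q (inner x0 (e k)) (inner x1 (e k)) t\<bar> \<le> C1 * exp t * data x0 x1 k"
    "\<bar>dflow \<delta> (lam k) Q (inner x0 (e k)) (inner x1 (e k)) t\<bar> \<le> C1 * exp t * data x0 x1 k"
  using flow_bound[OF lam_nonneg[OF assms(1)] delta_pos, where E = "C * exp t" and Q = Q and t = t]
    growth_est[OF assms] unfolding data_def by (auto simp: mult.assoc)

definition hom :: "'a \<Rightarrow> 'a \<Rightarrow> real \<Rightarrow> 'a" where
  "hom x0 x1 t = of_coeffs (\<lambda>k. flow \<delta> (lam k) anyrate (inner x0 (e k)) (inner x1 (e k)) t)"

definition dhom :: "'a \<Rightarrow> 'a \<Rightarrow> real \<Rightarrow> 'a" where
  "dhom x0 x1 t = of_coeffs (\<lambda>k. dflow \<delta> (lam k) anyrate (inner x0 (e k)) (inner x1 (e k)) t)"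

lemma growth_dominated:
  assumes "x0 \<in> DH"
  shows "\<exists>m. (\<lambda>k. (m k)\<^sup>2) summable_on K \<and> (\<forall>k\<in>K. \<forall>t\<in>{0..T}.
     b k * \<bar>flow \<delta> (lam k) anyrate (inner x0 (e k)) (inner x1 (e k)) t\<bar> \<le> m k \<and>
     \<bar>dflow \<delta> (lam k) anyrate (inner x0 (e k)) (inner x1 (e k)) t\<bar> \<le> m k)"
proof (intro exI conjI ballI)
  show "(\<lambda>k. (C1 * exp T * data x0 x1 k)\<^sup>2) summable_on K"
    by (rule square_summable_cmult[OF data_summable[OF assms]])
  fix k t assume k: "k \<in> K" and t: "t \<in> {0..T}"
  have "0 \<le> data x0 x1 k" using b_ge_1[OF k] by (simp add: data_def)
  then have "C1 * exp t * data x0 x1 k \<le> C1 * exp T * data x0 x1 k"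
    using t delta_pos C_pos by (intro mult_right_mono mult_left_mono) auto
  then show "b k * \<bar>flow \<delta> (lam k) anyrate (inner x0 (e k)) (inner x1 (e k)) t\<bar> \<le> C1 * exp T * data x0 x1 k"
    "\<bar>dflow \<delta> (lam k) anyrate (inner x0 (e k)) (inner x1 (e k)) t\<bar> \<le> C1 * exp T * data x0 x1 k"
    using flow_growth[OF k, of t anyrate x0 x1] t by auto
qed

lemma hom_weak_sol:
  assumes "x0 \<in> DH"
  shows "weak_sol \<delta> lam e K (\<lambda>_. 0) (hom x0 x1) (dhom x0 x1)"
    and inner_hom: "\<And>k t. k \<in> K \<Longrightarrow> t \<ge> 0 \<Longrightarrow>
        inner (hom x0 x1 t) (e k) = flow \<delta> (lam k) anyrate (inner x0 (e k)) (inner x1 (e k)) t"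
    and inner_dhom: "\<And>k t. k \<in> K \<Longrightarrow> t \<ge> 0 \<Longrightarrow>
        inner (dhom x0 x1 t) (e k) = dflow \<delta> (lam k) anyrate (inner x0 (e k)) (inner x1 (e k)) t"
proof -
  have 1: "(flow \<delta> (lam k) anyrate (inner x0 (e k)) (inner x1 (e k)) has_real_derivative
     dflow \<delta> (lam k) anyrate (inner x0 (e k)) (inner x1 (e k)) t) (at t within {0..})" for k t
    by (rule has_field_derivative_at_within[OF flow_deriv(1)])
  have 2: "(dflow \<delta> (lam k) anyrate (inner x0 (e k)) (inner x1 (e k)) has_real_derivative
     inner (0::'a) (e k) - 2 * \<delta> * dflow \<delta> (lam k) anyrate (inner x0 (e k)) (inner x1 (e k)) t
      - lam k * flow \<delta> (lam k) anyrate (inner x0 (e k)) (inner x1 (e k)) t) (at t within {0..})" for k t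
    using has_field_derivative_at_within[OF flow_deriv(2)[of \<delta> "lam k" anyrate _ _ t]] by simp
  note A = weak_sol_assemble[where c = "\<lambda>k. flow \<delta> (lam k) anyrate (inner x0 (e k)) (inner x1 (e k))"
      and c' = "\<lambda>k. dflow \<delta> (lam k) anyrate (inner x0 (e k)) (inner x1 (e k))" and g = "\<lambda>_. 0" and \<delta> = \<delta>,
      OF 1 2 growth_dominated[OF assms]]
  show "weak_sol \<delta> lam e K (\<lambda>_. 0) (hom x0 x1) (dhom x0 x1)"
    using A(1) by (simp add: hom_def[abs_def] dhom_def[abs_def])
  show "inner (hom x0 x1 t) (e k) = flow \<delta> (lam k) anyrate (inner x0 (e k)) (inner x1 (e k)) t"
    "inner (dhom x0 x1 t) (e k) = dflow \<delta> (lam k) anyrate (inner x0 (e k)) (inner x1 (e k)) t"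
    if "k \<in> K" "t \<ge> 0" for k t
    using A(2,3)[OF that] by (simp_all add: hom_def dhom_def)
qed

lemma hom_sol_hom:
  assumes "x0 \<in> DH"
  shows "hom_sol \<delta> lam e K x0 x1 (hom x0 x1) (dhom x0 x1)"
  unfolding hom_sol_def using hom_weak_sol[OF assms]
  by (auto intro!: coeffs_eqI simp: inner_hom[OF assms] inner_dhom[OF assms] flow_zero)

lemma hom_sol_coeffs:
  assumes "hom_sol \<delta> lam e K x0 x1 u u'" "k \<in> K" "t \<ge> 0"
  shows "inner (u t) (e k) = flow \<delta> (lam k) anyrate (inner x0 (e k)) (inner x1 (e k)) t"
    "inner (u' t) (e k) = dflow \<delta> (lam k) anyrate (inner x0 (e k)) (inner x1 (e k)) t"
proof -
  have w: "weak_sol \<delta> lam e K (\<lambda>_. 0) u u'" and i: "u 0 = x0" "u' 0 = x1"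
    using assms(1) by (auto simp: hom_sol_def)
  have 1: "((\<lambda>s. inner (u s) (e k)) has_real_derivative inner (u' s) (e k)) (at s within {0..})" if "s \<ge> 0" for s
    using bounded_linear.has_vector_derivative[OF bounded_linear_inner_left[of "e k"], of u "u' s" "at s within {0..}"] w that
    by (simp add: weak_sol_def has_real_derivative_iff_has_vector_derivative)
  have 2: "((\<lambda>s. inner (u' s) (e k)) has_real_derivative
     (- 2 * \<delta> * inner (u' s) (e k) - lam k * inner (u s) (e k))) (at s within {0..})" if "s \<ge> 0" for s
    using w that assms(2) by (auto simp: weak_sol_def)
  show "inner (u t) (e k) = flow \<delta> (lam k) anyrate (inner x0 (e k)) (inner x1 (e k)) t"
    "inner (u' t) (e k) = dflow \<delta> (lam k) anyrate (inner x0 (e k)) (inner x1 (e k)) t"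
    using mode_unique[OF lam_nonneg[OF assms(2)] delta_pos 1 2 assms(3)] unfolding i by auto
qed

lemma hom_sol_unique:
  assumes "x0 \<in> DH" "hom_sol \<delta> lam e K x0 x1 u u'" "t \<ge> 0"
  shows "u t = hom x0 x1 t" "u' t = dhom x0 x1 t"
  by (auto intro!: coeffs_eqI simp: inner_hom[OF assms(1)] inner_dhom[OF assms(1)] hom_sol_coeffs[OF assms(2)] assms(3))

text \<open>The coefficients \<open>a\<close> and \<open>b\<close> of the decomposition are those of
  \<open>flow\<close> restricted to one rate, since the two rates differ by
  \<open>2 * s\<close>.\<close>

lemma piece_coef_flow:
  assumes "hom_sol \<delta> lam e K x0 x1 u u'" "k \<in> K" "t \<ge> 0"
  shows "piece_coef \<delta> lam e u u' r k t = flow \<delta> (lam k) (\<lambda>q. q = r) (inner x0 (e k)) (inner x1 (e k)) t"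
proof (cases "lam k \<ge> \<delta>\<^sup>2")
  case True
  then show ?thesis
    by (auto simp: piece_coef_def hom_sol_coeffs[OF assms] flow_def fund_def dfund_def)
next
  case False
  define s where "s = sqrt (\<delta>\<^sup>2 - lam k)"
  have s: "s > 0" using False by (simp add: s_def)
  define x y where "x = inner x0 (e k)" and "y = inner x1 (e k)"
  have i: "u 0 = x0" "u' 0 = x1" using assms(1) by (auto simp: hom_sol_def)
  define E where "E = exp (- (\<delta> - s) * t)"
  define G where "G = exp (- (\<delta> + s) * t)"
  have 1: "piece_coef \<delta> lam e u u' r k t =
     (if r = \<delta> - s then ((\<delta> + s) * x + y) / (2 * s) * E else 0)
     + (if r = \<delta> + s then (- ((\<delta> - s) * x + y)) / (2 * s) * G else 0)"
    unfolding piece_coef_def Let_def s_def[symmetric] i x_def[symmetric] y_def[symmetric] E_def G_def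
    using False by simp
  have 2: "fund \<delta> (lam k) (\<lambda>q. q = r) t = (if r = \<delta> - s then E / (2 * s) else 0) - (if r = \<delta> + s then G / (2 * s) else 0)"
    using False unfolding fund_def Let_def s_def[symmetric] E_def G_def by auto
  have 3: "dfund \<delta> (lam k) (\<lambda>q. q = r) t = - (if r = \<delta> - s then (\<delta> - s) * E / (2 * s) else 0)
      + (if r = \<delta> + s then (\<delta> + s) * G / (2 * s) else 0)"
    using False unfolding dfund_def Let_def s_def[symmetric] E_def G_def by auto
  show ?thesis unfolding 1 flow_def 2 3 x_def[symmetric] y_def[symmetric] using s
    by (auto simp: field_simps)
qed

text \<open>Turns a statement about vectors into one about modes. Since \<open>infsum\<close> is 0
  by default when a family is not summable, square summability of the pieces comes first; only then
  does a zero sum force zero coefficients.\<close>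

lemma vanishes_iff:
  assumes "x0 \<in> DH" "hom_sol \<delta> lam e K x0 x1 u u'"
  shows "vanishes \<delta> lam e K u u' r \<longleftrightarrow>
    (\<forall>k\<in>K. \<forall>t\<ge>0. flow \<delta> (lam k) (\<lambda>q. q = r) (inner x0 (e k)) (inner x1 (e k)) t = 0)"
proof -
  define c where "c = (\<lambda>k t. flow \<delta> (lam k) (\<lambda>q. q = r) (inner x0 (e k)) (inner x1 (e k)) t)"
  have eq: "comp \<delta> lam e K u u' r t = of_coeffs (\<lambda>k. c k t)"
    and c: "\<And>k. k \<in> K \<Longrightarrow> inner (of_coeffs (\<lambda>k. c k t)) (e k) = c k t" if t: "t \<ge> 0" for t
  proof -
    have "(\<lambda>k. (C1 * exp t * data x0 x1 k)\<^sup>2) summable_on K"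
      by (rule square_summable_cmult[OF data_summable[OF assms(1)]])
    then have "(\<lambda>k. (c k t)\<^sup>2) summable_on K"
      by (rule D12_of_coeffs(1)) (unfold c_def, rule flow_growth(1), auto simp: t)
    then show c: "inner (of_coeffs (\<lambda>k. c k t)) (e k) = c k t" if "k \<in> K" for k
      using that by (rule inner_of_coeffs)
    have "comp \<delta> lam e K u u' r t = infsum (\<lambda>k. inner (of_coeffs (\<lambda>k. c k t)) (e k) *\<^sub>R e k) K"
      unfolding comp_def
    proof (rule infsum_cong)
      fix k assume k: "k \<in> K"
      have "piece_coef \<delta> lam e u u' r k t = c k t" by (simp add: c_def piece_coef_flow[OF assms(2) k t])
      then show "piece_coef \<delta> lam e u u' r k t *\<^sub>R e k = inner (of_coeffs (\<lambda>k. c k t)) (e k) *\<^sub>R e k"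
        by (simp add: c[OF k])
    qed
    also have "\<dots> = of_coeffs (\<lambda>k. c k t)"
      using basis unfolding onb_def by (auto intro: infsumI)
    finally show "comp \<delta> lam e K u u' r t = of_coeffs (\<lambda>k. c k t)" .
  qed
  have "of_coeffs (\<lambda>k. c k t) = 0 \<longleftrightarrow> (\<forall>k\<in>K. c k t = 0)" if "t \<ge> 0" for t
  proof
    assume "of_coeffs (\<lambda>k. c k t) = 0"
    then show "\<forall>k\<in>K. c k t = 0" using c[OF that] by (metis inner_zero_left)
  next
    assume "\<forall>k\<in>K. c k t = 0"
    then show "of_coeffs (\<lambda>k. c k t) = 0" by (intro coeffs_eqI) (simp add: c[OF that])
  qed
  then have "vanishes \<delta> lam e K u u' r \<longleftrightarrow> (\<forall>k\<in>K. \<forall>t\<ge>0. c k t = 0)"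
    unfolding vanishes_def using eq by auto
  then show ?thesis by (simp add: c_def)
qed

lemma rates_Dset: "k \<in> K \<Longrightarrow> r \<in> rates \<delta> (lam k) \<Longrightarrow> r \<in> Dset \<delta> lam K"
  using Dset_eq_rates[of K lam \<delta>] lam_nonneg by auto

text \<open>All rates of a mode belong to \<open>Dset\<close>, so the discarded pieces add up to
  zero. Bounds on the pieces in \<open>Q\<close> thereby become bounds on the whole
  solution.\<close>

lemma flow_eq_of_vanishing:
  assumes "x0 \<in> DH"
    and van: "\<And>r. r \<in> Dset \<delta> lam K \<Longrightarrow> \<not> Q r \<Longrightarrow> vanishes \<delta> lam e K (hom x0 x1) (dhom x0 x1) r"
    and k: "k \<in> K" and t: "t \<ge> 0"
  shows "flow \<delta> (lam k) anyrate (inner x0 (e k)) (inner x1 (e k)) t = flow \<delta> (lam k) Q (inner x0 (e k)) (inner x1 (e k)) t"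
    "dflow \<delta> (lam k) anyrate (inner x0 (e k)) (inner x1 (e k)) t = dflow \<delta> (lam k) Q (inner x0 (e k)) (inner x1 (e k)) t"
proof -
  have z: "flow \<delta> (lam k) (\<lambda>r. \<not> Q r) (inner x0 (e k)) (inner x1 (e k)) s = 0" if "s \<ge> 0" for s
  proof -
    have "flow \<delta> (lam k) (\<lambda>q. q = r) (inner x0 (e k)) (inner x1 (e k)) s = 0"
      if "r \<in> rates \<delta> (lam k)" "\<not> Q r" for r
      using van[OF rates_Dset[OF k that(1)] that(2)] k \<open>s \<ge> 0\<close>
      unfolding vanishes_iff[OF assms(1) hom_sol_hom[OF assms(1)]] by blast
    then show ?thesis by (subst flow_sum_rates) (simp add: sum.neutral)
  qed
  show "flow \<delta> (lam k) anyrate (inner x0 (e k)) (inner x1 (e k)) t = flow \<delta> (lam k) Q (inner x0 (e k)) (inner x1 (e k)) t"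
    using flow_split(1)[of \<delta> "lam k" "inner x0 (e k)" "inner x1 (e k)" t Q] z[OF t] by simp
  show "dflow \<delta> (lam k) anyrate (inner x0 (e k)) (inner x1 (e k)) t = dflow \<delta> (lam k) Q (inner x0 (e k)) (inner x1 (e k)) t"
    using flow_split(2)[of \<delta> "lam k" "inner x0 (e k)" "inner x1 (e k)" t Q] dflow_eq_0[OF z t] by simp
qed

lemma hom_in_D12: "x0 \<in> DH \<Longrightarrow> t \<ge> 0 \<Longrightarrow> hom x0 x1 t \<in> DH"
  using hom_weak_sol(1) by (auto simp: weak_sol_def)

lemma L2_set_cmult_le:
  assumes "a \<ge> 0" "L2_set m J \<le> M"
  shows "L2_set (\<lambda>k. a * m k) J \<le> a * M"
proof -
  have "L2_set (\<lambda>k. a * m k) J = a * L2_set m J"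
    using L2_set_right_distrib[OF assms(1), of m J] by simp
  then show ?thesis using mult_left_mono[OF assms(2,1)] by simp
qed

lemma norm_le_dominated:
  assumes "\<And>k. k \<in> K \<Longrightarrow> \<bar>inner u (e k)\<bar> \<le> m k" "\<And>J. finite J \<Longrightarrow> J \<subseteq> K \<Longrightarrow> L2_set m J \<le> M"
  shows "norm u \<le> M"
proof (rule norm_le_L2)
  fix J assume J: "finite J" "J \<subseteq> K"
  have "L2_set (\<lambda>k. inner u (e k)) J = L2_set (\<lambda>k. \<bar>inner u (e k)\<bar>) J" by (simp add: L2_set_def)
  also have "\<dots> \<le> L2_set m J" using assms(1) J by (intro L2_set_mono) auto
  finally show "L2_set (\<lambda>k. inner u (e k)) J \<le> M" using assms(2)[OF J] by simp
qed

lemma hom_decay: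
  assumes "x0 \<in> DH"
    and van: "\<And>r. r \<in> Dset \<delta> lam K \<Longrightarrow> \<not> Q r \<Longrightarrow> vanishes \<delta> lam e K (hom x0 x1) (dhom x0 x1) r"
    and est: "\<And>k t. k \<in> K \<Longrightarrow> t \<ge> 0 \<Longrightarrow>
      b k * \<bar>fund \<delta> (lam k) Q t\<bar> \<le> C * exp (- s * t) \<and> \<bar>dfund \<delta> (lam k) Q t\<bar> \<le> C * exp (- s * t)"
    and t: "t \<ge> 0"
  shows "dn (hom x0 x1 t) \<le> C1 * exp (- s * t) * (dn x0 + norm x1)"
    "norm (dhom x0 x1 t) \<le> C1 * exp (- s * t) * (dn x0 + norm x1)"
proof -
  have L2: "L2_set (\<lambda>k. C1 * exp (- s * t) * data x0 x1 k) J \<le> C1 * exp (- s * t) * (dn x0 + norm x1)"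
    if "finite J" "J \<subseteq> K" for J
    using delta_pos C_pos by (intro L2_set_cmult_le data_L2 assms that) auto
  have bnd: "b k * \<bar>flow \<delta> (lam k) Q (inner x0 (e k)) (inner x1 (e k)) t\<bar> \<le> C1 * exp (- s * t) * data x0 x1 k"
    "\<bar>dflow \<delta> (lam k) Q (inner x0 (e k)) (inner x1 (e k)) t\<bar> \<le> C1 * exp (- s * t) * data x0 x1 k" if "k \<in> K" for k
    using flow_bound[OF lam_nonneg[OF that] delta_pos, where E = "C * exp (- s * t)" and Q = Q and t = t]
      est[OF that t] unfolding data_def by (auto simp: mult.assoc)
  note f = flow_eq_of_vanishing[OF assms(1) van _ t]
  show "dn (hom x0 x1 t) \<le> C1 * exp (- s * t) * (dn x0 + norm x1)"
    using bnd(1) by (intro dnorm_le_L2[OF hom_in_D12[OF assms(1) t] _ L2]) (simp_all add: inner_hom assms(1) t f(1))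
  show "norm (dhom x0 x1 t) \<le> C1 * exp (- s * t) * (dn x0 + norm x1)"
    using bnd(2) by (intro norm_le_dominated[OF _ L2]) (simp_all add: inner_dhom assms(1) t f(2))
qed

lemma pure_decay:
  assumes "pure_pair \<delta> lam e K r0 x0 x1" "t \<ge> 0"
  shows "dn (hom x0 x1 t) \<le> C1 * exp (- \<rho> * t) * (dn x0 + norm x1)"
    "norm (dhom x0 x1 t) \<le> C1 * exp (- \<rho> * t) * (dn x0 + norm x1)"
proof -
  have D: "x0 \<in> DH" using assms(1) by (simp add: pure_pair_def)
  have "vanishes \<delta> lam e K (hom x0 x1) (dhom x0 x1) r" if "r \<in> Dset \<delta> lam K" "\<not> r = r0" for r
    using assms(1) hom_sol_hom[OF D, of x1] that unfolding pure_pair_def pure_sol_def by blast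
  from hom_decay[OF D this pure_est assms(2)]
  show "dn (hom x0 x1 t) \<le> C1 * exp (- \<rho> * t) * (dn x0 + norm x1)"
    "norm (dhom x0 x1 t) \<le> C1 * exp (- \<rho> * t) * (dn x0 + norm x1)" by auto
qed

lemma fast_decay:
  assumes "fast_pair \<delta> lam e K r0 x0 x1" "t \<ge> 0"
  shows "dn (hom x0 x1 t) \<le> C1 * exp (- sg * t) * (dn x0 + norm x1)"
    "norm (dhom x0 x1 t) \<le> C1 * exp (- sg * t) * (dn x0 + norm x1)"
proof -
  have D: "x0 \<in> DH" using assms(1) by (simp add: fast_pair_def)
  have "vanishes \<delta> lam e K (hom x0 x1) (dhom x0 x1) r" if "r \<in> Dset \<delta> lam K" "\<not> (\<not> r \<le> r0)" for r
    using assms(1) hom_sol_hom[OF D, of x1] that unfolding fast_pair_def fast_sol_def by blast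
  from hom_decay[OF D this fast_est assms(2)]
  show "dn (hom x0 x1 t) \<le> C1 * exp (- sg * t) * (dn x0 + norm x1)"
    "norm (dhom x0 x1 t) \<le> C1 * exp (- sg * t) * (dn x0 + norm x1)" by auto
qed

lemma slow_pairI:
  assumes "x0 \<in> DH" "\<And>k r t. k \<in> K \<Longrightarrow> r > r0 \<Longrightarrow> t \<ge> 0 \<Longrightarrow>
      flow \<delta> (lam k) (\<lambda>q. q = r) (inner x0 (e k)) (inner x1 (e k)) t = 0"
  shows "slow_pair \<delta> lam e K r0 x0 x1"
  unfolding slow_pair_def slow_sol_def using assms vanishes_iff[OF assms(1)] by auto

end

section \<open>Forced solutions\<close>

lemma weak_sol_cong:
  assumes "weak_sol \<delta> lam e K g u u'" "\<And>t. t \<ge> 0 \<Longrightarrow> g t = h t"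
  shows "weak_sol \<delta> lam e K h u u'"
  using assms unfolding weak_sol_def by simp

context damped
begin

definition forced :: "real \<Rightarrow> real \<Rightarrow> (real \<Rightarrow> 'a) \<Rightarrow> bool" where
  "forced \<sigma> \<eta> F \<longleftrightarrow> continuous_on {0..} F \<and> (\<forall>s\<ge>0. norm (F s) \<le> \<eta> * exp (- \<sigma> * s))"

text \<open>The time-independent majorant: up to \<open>C * exp (- sg * t)\<close> it bounds mode
  \<open>k\<close> of \<open>W F\<close> and of \<open>dW F\<close> at every
  \<open>t\<close>.\<close>

definition weight :: "(real \<Rightarrow> 'a) \<Rightarrow> nat \<Rightarrow> real" where
  "weight F k = integral {0..} (\<lambda>s. exp (sg * s) * \<bar>inner (F s) (e k)\<bar>)"

abbreviation "pc F k \<equiv> perron \<delta> (lam k) (\<lambda>r. r \<le> r0) (\<lambda>s. inner (F s) (e k))"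
abbreviation "dpc F k \<equiv> dperron \<delta> (lam k) (\<lambda>r. r \<le> r0) (\<lambda>s. inner (F s) (e k))"

definition W :: "(real \<Rightarrow> 'a) \<Rightarrow> real \<Rightarrow> 'a" where
  "W F t = of_coeffs (\<lambda>k. pc F k t)"

definition dW :: "(real \<Rightarrow> 'a) \<Rightarrow> real \<Rightarrow> 'a" where
  "dW F t = of_coeffs (\<lambda>k. dpc F k t)"

lemma dich: "k \<in> K \<Longrightarrow> dichotomy \<delta> (lam k) sg C (\<lambda>r. r \<le> r0)"
  by unfold_locales (use lam_nonneg slow_est fast_est in auto)

lemma forced_forcing:
  assumes "forced \<sigma> \<eta> F" "k \<in> K"
  shows "forcing \<sigma> (\<lambda>s. inner (F s) (e k))"
proof -
  have "\<bar>inner (F s) (e k)\<bar> \<le> \<eta> * exp (- \<sigma> * s)" if "s \<ge> 0" for s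
  proof -
    have "\<bar>inner (F s) (e k)\<bar> \<le> norm (F s)" using bessel[of "{k}" "F s"] assms(2) by simp
    then show ?thesis using assms(1) that unfolding forced_def by (meson order_trans)
  qed
  then show ?thesis using assms(1) by (auto simp: forcing_def forced_def intro!: continuous_intros)
qed

lemma weight_L2:
  assumes F: "forced \<sigma> \<eta> F" and sg: "sg < \<sigma>" and J: "finite J" "J \<subseteq> K"
  shows "L2_set (weight F) J \<le> \<eta> / (\<sigma> - sg)"
proof -
  define w where "w = (\<lambda>k s. exp (sg * s) * \<bar>inner (F s) (e k)\<bar>)"
  define N where "N = L2_set (weight F) J"
  have N0: "0 \<le> N" by (simp add: N_def L2_set_nonneg)
  have "norm (F 0) \<le> \<eta> * exp (- \<sigma> * 0)" using F unfolding forced_def by blast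
  then have \<eta>: "0 \<le> \<eta>" using order_trans[OF norm_ge_zero] by fastforce
  have int: "w k integrable_on {0..}" if "k \<in> J" for k
    unfolding w_def using forcing_weight_integrable[OF forced_forcing[OF F] sg order_refl] that J by blast
  have I: "((\<lambda>s. \<Sum>k\<in>J. weight F k * w k s) has_integral (\<Sum>k\<in>J. weight F k * weight F k)) {0..}"
  proof (rule has_integral_sum[OF J(1)])
    fix k assume "k \<in> J"
    then have "(w k has_integral weight F k) {0..}"
      using integrable_integral[OF int] by (simp add: weight_def w_def)
    then show "((\<lambda>s. weight F k * w k s) has_integral weight F k * weight F k) {0..}"
      by (rule has_integral_mult_right)
  qed
  \<comment> \<open>The mass of the product of the weight and the decay of \<open>F\<close>, finite
    since \<open>sg\<close> < \<sigma>; it is the origin of the factor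
    \<open>\<eta> / (\<sigma> - sg)\<close>.\<close>
  have "((\<lambda>s. exp (- (\<sigma> - sg) * s)) has_integral exp (- (\<sigma> - sg) * 0) / (\<sigma> - sg)) {0..}"
    by (rule has_integral_exp_minus_to_infinity) (use sg in simp)
  then have "((\<lambda>s. exp (- (\<sigma> - sg) * s)) has_integral 1 / (\<sigma> - sg)) {0..}" by simp
  then have I2: "((\<lambda>s. (N * \<eta>) * exp (- (\<sigma> - sg) * s)) has_integral (N * \<eta>) * (1 / (\<sigma> - sg))) {0..}"
    by (rule has_integral_mult_right)
  have "(\<Sum>k\<in>J. weight F k * weight F k) \<le> (N * \<eta>) * (1 / (\<sigma> - sg))"
  proof (rule has_integral_le[OF I I2])
    fix s :: real assume s: "s \<in> {0..}"
    have "(\<Sum>k\<in>J. weight F k * w k s) = exp (sg * s) * (\<Sum>k\<in>J. weight F k * \<bar>inner (F s) (e k)\<bar>)"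
      by (simp add: w_def sum_distrib_left algebra_simps)
    also have "\<dots> \<le> exp (sg * s) * (N * (\<eta> * exp (- \<sigma> * s)))"
    proof (rule mult_left_mono)
      have "(\<Sum>k\<in>J. weight F k * \<bar>inner (F s) (e k)\<bar>) \<le> (\<Sum>k\<in>J. \<bar>weight F k\<bar> * \<bar>inner (F s) (e k)\<bar>)"
        by (intro sum_mono mult_right_mono) auto
      also have "\<dots> \<le> N * L2_set (\<lambda>k. inner (F s) (e k)) J" unfolding N_def by (rule L2_set_mult_ineq)
      also have "\<dots> \<le> N * norm (F s)" using N0 by (intro mult_left_mono bessel J)
      also have "\<dots> \<le> N * (\<eta> * exp (- \<sigma> * s))" using N0 F s by (intro mult_left_mono) (auto simp: forced_def)
      finally show "(\<Sum>k\<in>J. weight F k * \<bar>inner (F s) (e k)\<bar>) \<le> N * (\<eta> * exp (- \<sigma> * s))" .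
    qed simp
    also have "\<dots> = (N * \<eta>) * (exp (sg * s) * exp (- \<sigma> * s))" by simp
    also have "exp (sg * s) * exp (- \<sigma> * s) = exp (- (\<sigma> - sg) * s)"
      unfolding exp_add[symmetric] by (simp add: algebra_simps)
    finally show "(\<Sum>k\<in>J. weight F k * w k s) \<le> (N * \<eta>) * exp (- (\<sigma> - sg) * s)" .
  qed
  moreover have "(\<Sum>k\<in>J. weight F k * weight F k) = N * N"
    unfolding N_def L2_set_def by (simp add: sum_nonneg power2_eq_square)
  txt \<open>Testing \<open>weight F\<close> against itself replaces the Minkowski inequality for vector-valued integrals.\<close>
  ultimately have NN: "N * N \<le> N * (\<eta> / (\<sigma> - sg))" by simp
  have "N \<le> \<eta> / (\<sigma> - sg)"
  proof (cases "N = 0")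
    case True
    then show ?thesis using \<eta> sg by simp
  next
    case False
    then have "N > 0" using N0 by simp
    then show ?thesis using NN by (rule mult_left_le_imp_le[rotated])
  qed
  then show ?thesis by (simp add: N_def)
qed

lemma pc_bound:
  assumes "forced \<sigma> \<eta> F" "sg < \<sigma>" "k \<in> K" "t \<ge> 0"
  shows "b k * \<bar>pc F k t\<bar> \<le> (C * exp (- sg * t)) * weight F k"
    "\<bar>dpc F k t\<bar> \<le> (C * exp (- sg * t)) * weight F k"
  using dichotomy.perron_bound[OF dich[OF assms(3)] forced_forcing[OF assms(1,3)] assms(2,4)]
  unfolding weight_def by auto

lemma weight_summable:
  assumes "forced \<sigma> \<eta> F" "sg < \<sigma>"
  shows "(\<lambda>k. (weight F k)\<^sup>2) summable_on K"
  by (rule square_summable_L2[OF weight_L2[OF assms]])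

lemma inner_W:
  assumes "forced \<sigma> \<eta> F" "sg < \<sigma>" "t \<ge> 0"
  shows W_in_D12: "W F t \<in> DH"
    and "k \<in> K \<Longrightarrow> inner (W F t) (e k) = pc F k t"
    and "k \<in> K \<Longrightarrow> inner (dW F t) (e k) = dpc F k t"
proof -
  have m: "(\<lambda>k. ((C * exp (- sg * t)) * weight F k)\<^sup>2) summable_on K"
    by (rule square_summable_cmult[OF weight_summable[OF assms(1,2)]])
  note p = pc_bound[OF assms(1,2) _ assms(3)]
  show "W F t \<in> DH" unfolding W_def by (rule D12_of_coeffs(2)[OF m p(1)])
  show "k \<in> K \<Longrightarrow> inner (W F t) (e k) = pc F k t"
    unfolding W_def by (rule inner_of_coeffs[OF D12_of_coeffs(1)[OF m p(1)]])
  show "k \<in> K \<Longrightarrow> inner (dW F t) (e k) = dpc F k t"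
    unfolding dW_def by (rule inner_of_coeffs[OF square_summable_comparison[OF m p(2)]])
qed

lemma W_bound:
  assumes "forced \<sigma> \<eta> F" "sg < \<sigma>" "t \<ge> 0"
  shows "dn (W F t) \<le> C * exp (- sg * t) * (\<eta> / (\<sigma> - sg))"
    "norm (dW F t) \<le> C * exp (- sg * t) * (\<eta> / (\<sigma> - sg))"
proof -
  have L2: "L2_set (\<lambda>k. (C * exp (- sg * t)) * weight F k) J \<le> C * exp (- sg * t) * (\<eta> / (\<sigma> - sg))"
    if "finite J" "J \<subseteq> K" for J
    using C_pos by (intro L2_set_cmult_le weight_L2 assms that) auto
  note p = pc_bound[OF assms(1,2) _ assms(3)]
  show "dn (W F t) \<le> C * exp (- sg * t) * (\<eta> / (\<sigma> - sg))"
    using p(1) by (intro dnorm_le_L2[OF W_in_D12[OF assms] _ L2]) (simp_all add: inner_W(2)[OF assms])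
  show "norm (dW F t) \<le> C * exp (- sg * t) * (\<eta> / (\<sigma> - sg))"
    using p(2) by (intro norm_le_dominated[OF _ L2]) (simp_all add: inner_W(3)[OF assms])
qed

text \<open>Linearity of \<open>W\<close>. The difference of the forcings has its own constant
  \<zeta>, which \<open>W_bound\<close> then converts into a Lipschitz estimate.\<close>

lemma W_diff:
  assumes F: "forced \<sigma> \<eta> F" and G: "forced \<sigma> \<eta>' G" and FG: "forced \<sigma> \<zeta> (\<lambda>s. F s - G s)"
    and sg: "sg < \<sigma>" and t: "t \<ge> 0"
  shows "W F t - W G t = W (\<lambda>s. F s - G s) t"
proof (rule coeffs_eqI)
  fix k assume k: "k \<in> K"
  show "inner (W F t - W G t) (e k) = inner (W (\<lambda>s. F s - G s) t) (e k)"
    unfolding inner_diff_left inner_W(2)[OF F sg t k] inner_W(2)[OF G sg t k] inner_W(2)[OF FG sg t k]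
    using dichotomy.perron_diff[OF dich[OF k] forced_forcing[OF F k] forced_forcing[OF G k] sg, of t]
    by (simp add: inner_diff_left)
qed

text \<open>These data are the correction that the theorem allows: integrating the slow pieces from
  infinity fixes their initial values instead of prescribing them.\<close>

lemma W_slow:
  assumes "forced \<sigma> \<eta> F" "sg < \<sigma>"
  shows "slow_pair \<delta> lam e K r0 (W F 0) (dW F 0)"
proof (rule slow_pairI)
  show "W F 0 \<in> DH" by (rule W_in_D12[OF assms order_refl])
  fix k r and t :: real assume k: "k \<in> K" and r: "r > r0" and "t \<ge> 0"
  show "flow \<delta> (lam k) (\<lambda>q. q = r) (inner (W F 0) (e k)) (inner (dW F 0) (e k)) t = 0"
    unfolding inner_W(2,3)[OF assms order_refl k]
    by (rule dichotomy.perron_zero_slow[OF dich[OF k] forced_forcing[OF assms(1) k] assms(2)]) (use r in auto)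
qed

text \<open>Defined by coefficients rather than as a sum of vectors, so that
  \<open>weak_sol_assemble\<close> applies once to the complete forced mode; the splitting into
  \<open>hom\<close> and \<open>W\<close> is recovered afterwards.\<close>

definition sol :: "'a \<Rightarrow> 'a \<Rightarrow> (real \<Rightarrow> 'a) \<Rightarrow> real \<Rightarrow> 'a" where
  "sol x0 x1 F t = of_coeffs (\<lambda>k. flow \<delta> (lam k) anyrate (inner x0 (e k)) (inner x1 (e k)) t + pc F k t)"

definition dsol :: "'a \<Rightarrow> 'a \<Rightarrow> (real \<Rightarrow> 'a) \<Rightarrow> real \<Rightarrow> 'a" where
  "dsol x0 x1 F t = of_coeffs (\<lambda>k. dflow \<delta> (lam k) anyrate (inner x0 (e k)) (inner x1 (e k)) t + dpc F k t)"

lemma sol_weak_sol: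
  assumes x0: "x0 \<in> DH" and F: "forced \<sigma> \<eta> F" and sg: "sg < \<sigma>" "0 \<le> sg"
  shows "weak_sol \<delta> lam e K F (sol x0 x1 F) (dsol x0 x1 F)"
    and "\<And>t. t \<ge> 0 \<Longrightarrow> sol x0 x1 F t = hom x0 x1 t + W F t"
    and "\<And>t. t \<ge> 0 \<Longrightarrow> dsol x0 x1 F t = dhom x0 x1 t + dW F t"
proof -
  let ?p = "\<lambda>k. flow \<delta> (lam k) anyrate (inner x0 (e k)) (inner x1 (e k))"
  let ?q = "\<lambda>k. dflow \<delta> (lam k) anyrate (inner x0 (e k)) (inner x1 (e k))"
  have c: "continuous_on {0..} (\<lambda>s. inner (F s) (e k))" for k
    using F by (auto simp: forced_def intro!: continuous_intros)
  have 1: "((\<lambda>t. ?p k t + pc F k t) has_real_derivative ?q k t + dpc F k t) (at t within {0..})" if "t \<ge> 0" for k t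
    by (intro DERIV_add has_field_derivative_at_within[OF flow_deriv(1)] perron_deriv(1)[OF c that])
  have 2: "((\<lambda>t. ?q k t + dpc F k t) has_real_derivative
      inner (F t) (e k) - 2 * \<delta> * (?q k t + dpc F k t) - lam k * (?p k t + pc F k t)) (at t within {0..})" if "t \<ge> 0" for k t
    by (rule DERIV_cong[OF DERIV_add[OF has_field_derivative_at_within[OF flow_deriv(2)] perron_deriv(2)[OF c that]]])
      (simp add: algebra_simps)
  have 3: "\<exists>m. (\<lambda>k. (m k)\<^sup>2) summable_on K \<and>
        (\<forall>k\<in>K. \<forall>t\<in>{0..T}. b k * \<bar>?p k t + pc F k t\<bar> \<le> m k \<and> \<bar>?q k t + dpc F k t\<bar> \<le> m k)" for T
  proof -
    obtain m where m: "(\<lambda>k. (m k)\<^sup>2) summable_on K"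
      "\<And>k t. k \<in> K \<Longrightarrow> t \<in> {0..T} \<Longrightarrow> b k * \<bar>?p k t\<bar> \<le> m k \<and> \<bar>?q k t\<bar> \<le> m k"
      using growth_dominated[OF x0, of T x1] by blast
    have n: "(\<lambda>k. (C * weight F k)\<^sup>2) summable_on K"
      by (rule square_summable_cmult[OF weight_summable[OF F sg(1)]])
    have "b k * \<bar>?p k t + pc F k t\<bar> \<le> \<bar>m k\<bar> + \<bar>C * weight F k\<bar> \<and> \<bar>?q k t + dpc F k t\<bar> \<le> \<bar>m k\<bar> + \<bar>C * weight F k\<bar>"
      if k: "k \<in> K" and t: "t \<in> {0..T}" for k t
    proof -
      have t0: "t \<ge> 0" using t by simp
      have "(C * exp (- sg * t)) * weight F k \<le> (C * exp (- sg * t)) * \<bar>weight F k\<bar>"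
        using C_pos by (intro mult_left_mono) auto
      also have "\<dots> \<le> C * 1 * \<bar>weight F k\<bar>"
        using C_pos sg(2) t0 by (intro mult_right_mono mult_left_mono) auto
      also have "\<dots> = \<bar>C * weight F k\<bar>" using C_pos by (simp add: abs_mult)
      finally have w: "(C * exp (- sg * t)) * weight F k \<le> \<bar>C * weight F k\<bar>" .
      have "b k * \<bar>?p k t + pc F k t\<bar> \<le> b k * \<bar>?p k t\<bar> + b k * \<bar>pc F k t\<bar>"
        using mult_left_mono[OF abs_triangle_ineq[of "?p k t" "pc F k t"], of "b k"] b_ge_1[OF k]
        by (simp add: distrib_left)
      then show ?thesis
        using m(2)[OF k t] pc_bound[OF F sg(1) k t0] w abs_triangle_ineq[of "?q k t" "dpc F k t"] by linarith
    qed
    then show ?thesis using square_summable_add[OF m(1) n]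
      by (intro exI[of _ "\<lambda>k. \<bar>m k\<bar> + \<bar>C * weight F k\<bar>"]) blast
  qed
  note A = weak_sol_assemble[where c = "\<lambda>k t. ?p k t + pc F k t" and c' = "\<lambda>k t. ?q k t + dpc F k t"
      and g = F and \<delta> = \<delta>, OF 1 2 3]
  show "weak_sol \<delta> lam e K F (sol x0 x1 F) (dsol x0 x1 F)"
    using A(1) by (simp add: sol_def[abs_def] dsol_def[abs_def])
  show "sol x0 x1 F t = hom x0 x1 t + W F t" if t: "t \<ge> 0" for t
    unfolding sol_def
    by (rule coeffs_eqI) (simp add: A(2) inner_add_left inner_hom[OF x0] inner_W(2)[OF F sg(1)] t)
  show "dsol x0 x1 F t = dhom x0 x1 t + dW F t" if t: "t \<ge> 0" for t
    unfolding dsol_def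
    by (rule coeffs_eqI) (simp add: A(3) inner_add_left inner_dhom[OF x0] inner_W(3)[OF F sg(1)] t)
qed

lemma hom_add:
  assumes "x0 \<in> DH" "y0 \<in> DH" "t \<ge> 0"
  shows "hom (x0 + y0) (x1 + y1) t = hom x0 x1 t + hom y0 y1 t"
    "dhom (x0 + y0) (x1 + y1) t = dhom x0 x1 t + dhom y0 y1 t"
  by (rule coeffs_eqI, simp add: inner_add_left inner_hom inner_dhom assms D12_add flow_add)+

lemma zero_in_D12: "0 \<in> DH" "dn 0 = 0"
  by (simp_all add: D12_def dnorm_def halfsq_def)

end

section \<open>The fixed point\<close>

text \<open>With \<eta> both the size of the data and the radius for forcings,
  \<open>A * \<eta>\<close> will bound the solutions. The last condition makes the nonlinear map
  halve distances.\<close>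

lemma small_radius:
  fixes A L p R0 :: real
  assumes "A > 0" "L \<ge> 0" "p > 0" "R0 > 0"
  obtains \<eta> where "\<eta> > 0" "A * \<eta> < R0" "2 * L * (A * \<eta>) powr p * A \<le> 1 / 2"
proof -
  \<comment> \<open>At this \<open>x\<close> the quantity to be bounded is
    \<open>2 * L * A / (4 * L * A + 1)\<close>, which is at most 1/2; the summand 1 covers
    \<open>L = 0\<close>.\<close>
  define x where "x = (1 / (4 * L * A + 1)) powr (1 / p)"
  have q: "4 * L * A + 1 > 0" using assms by (simp add: add_nonneg_pos)
  have x: "x > 0" using q by (simp add: x_def)
  have xp: "x powr p = 1 / (4 * L * A + 1)" using q assms(3) by (simp add: x_def powr_powr)
  define \<eta> where "\<eta> = min (R0 / 2) x / A"
  have \<eta>: "\<eta> > 0" "A * \<eta> = min (R0 / 2) x" using assms x by (auto simp: \<eta>_def)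
  have "(A * \<eta>) powr p \<le> 1 / (4 * L * A + 1)"
    unfolding xp[symmetric] \<eta>(2) using assms x by (intro powr_mono2) auto
  then have "2 * L * A * (A * \<eta>) powr p \<le> 2 * L * A * (1 / (4 * L * A + 1))"
    using assms by (intro mult_left_mono) auto
  also have "\<dots> \<le> 1 / 2" using q by (simp add: field_simps)
  finally have "2 * L * (A * \<eta>) powr p * A \<le> 1 / 2" by (simp add: mult_ac)
  moreover have "A * \<eta> < R0" unfolding \<eta>(2) using assms by linarith
  ultimately show ?thesis using that \<eta>(1) by blast
qed

context damped
begin

text \<open>Decay of \<open>u\<close> and \<open>v\<close> at the rate \<rho> turns the powers in
  the hypothesis on \<open>f\<close> into decay at the rate p\<rho>. The factor
  \<open>dn (u - v)\<close> is kept, to contribute its own decay.\<close>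

lemma f_estimate:
  fixes f :: "'a \<Rightarrow> 'a"
  assumes L: "L \<ge> 0" and p: "p > 0" and D: "D > 0" "D < R0" and \<rho>: "\<rho> \<ge> 0" and t: "t \<ge> 0"
    and lip: "\<forall>u \<in> ballD lam e K R0. \<forall>v \<in> ballD lam e K R0.
        norm (f u - f v) \<le> L * (dn u powr p + dn v powr p) * dn (u - v)"
    and u: "u \<in> DH" "dn u \<le> D * exp (- \<rho> * t)" and v: "v \<in> DH" "dn v \<le> D * exp (- \<rho> * t)"
  shows "norm (f u - f v) \<le> 2 * L * D powr p * exp (- (p * \<rho>) * t) * dn (u - v)"
proof -
  have "exp (- \<rho> * t) \<le> 1" using \<rho> t by simp
  then have "D * exp (- \<rho> * t) \<le> D" using mult_left_le[of "exp (- \<rho> * t)" D] D by simp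
  then have "dn u < R0" "dn v < R0" using u v D by linarith+
  then have "u \<in> ballD lam e K R0" "v \<in> ballD lam e K R0" using u v by (auto simp: ballD_def)
  then have "norm (f u - f v) \<le> L * (dn u powr p + dn v powr p) * dn (u - v)" using lip by blast
  also have "\<dots> \<le> L * (2 * (D * exp (- \<rho> * t)) powr p) * dn (u - v)"
  proof (intro mult_right_mono mult_left_mono L dnorm_nonneg)
    have "dn u powr p \<le> (D * exp (- \<rho> * t)) powr p" "dn v powr p \<le> (D * exp (- \<rho> * t)) powr p"
      using u v p dnorm_nonneg by (auto intro!: powr_mono2)
    then show "dn u powr p + dn v powr p \<le> 2 * (D * exp (- \<rho> * t)) powr p" by simp
  qed
  also have "(D * exp (- \<rho> * t)) powr p = D powr p * exp (- (p * \<rho>) * t)"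
    by (simp add: powr_mult exp_powr_real mult_ac)
  finally show ?thesis by (simp add: mult_ac)
qed

lemma asymptotic_solution:
  fixes f :: "'a \<Rightarrow> 'a"
  assumes L: "L \<ge> 0" and p: "p > 0" and R0: "R0 > 0" and f0: "f 0 = 0"
    and lip: "\<forall>u \<in> ballD lam e K R0. \<forall>v \<in> ballD lam e K R0.
        norm (f u - f v) \<le> L * (dn u powr p + dn v powr p) * dn (u - v)"
    and \<rho>: "0 < \<rho>" "\<rho> < r0" and sg: "r0 < sg" "sg < (1 + p) * \<rho>"
  shows "\<exists>\<epsilon>0 > 0. \<forall>v0 v1 z0 z1.
       pure_pair \<delta> lam e K r0 v0 v1 \<longrightarrow> fast_pair \<delta> lam e K r0 z0 z1 \<longrightarrow>
       norm v1 + dn v0 + norm z1 + dn z0 \<le> \<epsilon>0 \<longrightarrow>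
       (\<exists>w0 w1. slow_pair \<delta> lam e K r0 w0 w1 \<and>
          (\<exists>u u'. global_sol \<delta> lam e K f R0 u u' \<and>
             u 0 = v0 + z0 + w0 \<and> u' 0 = v1 + z1 + w1 \<and>
             (\<forall>v v'. hom_sol \<delta> lam e K v0 v1 v v' \<longrightarrow>
                ((\<lambda>t. (norm (u' t - v' t) + dn (u t - v t)) * exp (r0 * t)) \<longlongrightarrow> 0) at_top)))"
proof -
  \<comment> \<open>The rate that \<open>f\<close> produces from solutions of rate \<rho>: p\<rho>
    from the powers and \<rho> from the last factor.\<close>
  define \<sigma> where "\<sigma> = (1 + p) * \<rho>"
  have sg\<sigma>: "sg < \<sigma>" using sg by (simp add: \<sigma>_def)
  have sg0: "0 \<le> sg" using sg \<rho> by linarith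
  \<comment> \<open>\<open>C1\<close> bounds the homogeneous part for data of size \<eta>, and
    \<open>C / (\<sigma> - sg)\<close> bounds \<open>W\<close> on forcings of size \<eta>, so
    solutions stay below \<open>A * \<eta>\<close> times the decay. The same \<eta> serves as the
    smallness threshold for the data.\<close>
  define A where "A = C1 + C / (\<sigma> - sg)"
  have C1: "C1 > 0" using C_pos delta_pos by simp
  have Cs: "C / (\<sigma> - sg) > 0" using C_pos sg\<sigma> by simp
  have A: "A > 0" using C1 Cs by (simp add: A_def)
  obtain \<eta> where \<eta>: "\<eta> > 0" "A * \<eta> < R0" "2 * L * (A * \<eta>) powr p * A \<le> 1 / 2"
    by (rule small_radius[OF A L p R0])
  define D where "D = A * \<eta>"
  have D: "D > 0" "D < R0" using A \<eta> by (auto simp: D_def)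
  have LD: "2 * L * D powr p * A \<le> 1 / 2" using \<eta>(3) by (simp add: D_def)
  have ee: "exp (- (p * \<rho>) * t) * exp (- \<rho> * t) = exp (- \<sigma> * t)" for t
    unfolding exp_add[symmetric] \<sigma>_def by (simp add: algebra_simps)
  have sgr: "exp (- sg * t) \<le> exp (- \<rho> * t)" if "t \<ge> 0" for t
    using that sg \<rho> by (simp add: mult_right_mono)
  have fest: "norm (f u - f v) \<le> 2 * L * D powr p * exp (- (p * \<rho>) * t) * dn (u - v)"
    if "t \<ge> 0" "u \<in> DH" "dn u \<le> D * exp (- \<rho> * t)" "v \<in> DH" "dn v \<le> D * exp (- \<rho> * t)" for u v t
    by (rule f_estimate[OF L p D less_imp_le[OF \<rho>(1)] that(1) lip that(2-5)])
  have contract: "2 * L * D powr p * exp (- (p * \<rho>) * t) * (A * exp (- \<rho> * t) * d) \<le> exp (- \<sigma> * t) * (d / 2)"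
    if "d \<ge> 0" for d t
  proof -
    have "2 * L * D powr p * exp (- (p * \<rho>) * t) * (A * exp (- \<rho> * t) * d)
       = (2 * L * D powr p * A) * ((exp (- (p * \<rho>) * t) * exp (- \<rho> * t)) * d)" by (simp only: mult_ac)
    also have "\<dots> \<le> (1 / 2) * (exp (- \<sigma> * t) * d)"
      unfolding ee using LD that by (intro mult_right_mono) auto
    finally show ?thesis by simp
  qed
  show ?thesis
  proof (intro exI[of _ \<eta>] conjI \<eta>(1) allI impI)
    fix v0 v1 z0 z1
    assume pure: "pure_pair \<delta> lam e K r0 v0 v1" and fast: "fast_pair \<delta> lam e K r0 z0 z1"
      and small: "norm v1 + dn v0 + norm z1 + dn z0 \<le> \<eta>"
    have vz: "v0 \<in> DH" "z0 \<in> DH" using pure fast by (auto simp: pure_pair_def fast_pair_def)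
    define x0 x1 where "x0 = v0 + z0" and "x1 = v1 + z1"
    have x0: "x0 \<in> DH" unfolding x0_def by (rule D12_add[OF vz])
    have hom_bd: "dn (hom x0 x1 t) \<le> C1 * \<eta> * exp (- \<rho> * t)" if t: "t \<ge> 0" for t
    proof -
      have "dn (hom x0 x1 t) \<le> dn (hom v0 v1 t) + dn (hom z0 z1 t)"
        unfolding x0_def x1_def hom_add(1)[OF vz t] by (intro dnorm_add hom_in_D12 vz t)
      also have "\<dots> \<le> C1 * exp (- \<rho> * t) * (dn v0 + norm v1) + C1 * exp (- \<rho> * t) * (dn z0 + norm z1)"
      proof (rule add_mono[OF pure_decay(1)[OF pure t]])
        have "dn (hom z0 z1 t) \<le> C1 * exp (- sg * t) * (dn z0 + norm z1)" by (rule fast_decay(1)[OF fast t])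
        also have "\<dots> \<le> C1 * exp (- \<rho> * t) * (dn z0 + norm z1)"
          using C1 sgr[OF t] dnorm_nonneg[of z0] by (intro mult_right_mono mult_left_mono) auto
        finally show "dn (hom z0 z1 t) \<le> C1 * exp (- \<rho> * t) * (dn z0 + norm z1)" .
      qed
      also have "\<dots> = C1 * exp (- \<rho> * t) * (norm v1 + dn v0 + norm z1 + dn z0)" by (simp add: algebra_simps)
      also have "\<dots> \<le> C1 * exp (- \<rho> * t) * \<eta>" using C1 small by (intro mult_left_mono) auto
      finally show ?thesis by (simp add: mult_ac)
    qed
    have sol_bd: "sol x0 x1 F t \<in> DH" "dn (sol x0 x1 F t) \<le> D * exp (- \<rho> * t)"
      if F: "forced \<sigma> \<eta> F" and t: "t \<ge> 0" for F t
    proof -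
      note s = sol_weak_sol(2)[OF x0 F sg\<sigma> sg0 t, of x1]
      show "sol x0 x1 F t \<in> DH" unfolding s by (intro D12_add hom_in_D12 x0 t W_in_D12[OF F sg\<sigma>])
      have "dn (sol x0 x1 F t) \<le> dn (hom x0 x1 t) + dn (W F t)"
        unfolding s by (intro dnorm_add hom_in_D12 x0 t W_in_D12[OF F sg\<sigma>])
      also have "\<dots> \<le> C1 * \<eta> * exp (- \<rho> * t) + C / (\<sigma> - sg) * \<eta> * exp (- \<rho> * t)"
      proof (rule add_mono[OF hom_bd[OF t]])
        have "dn (W F t) \<le> C * exp (- sg * t) * (\<eta> / (\<sigma> - sg))" by (rule W_bound(1)[OF F sg\<sigma> t])
        also have "\<dots> = C / (\<sigma> - sg) * \<eta> * exp (- sg * t)" by simp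
        also have "\<dots> \<le> C / (\<sigma> - sg) * \<eta> * exp (- \<rho> * t)"
          by (intro mult_left_mono[OF sgr[OF t]] mult_nonneg_nonneg less_imp_le[OF Cs] less_imp_le[OF \<eta>(1)])
        finally show "dn (W F t) \<le> C / (\<sigma> - sg) * \<eta> * exp (- \<rho> * t)" .
      qed
      also have "\<dots> = D * exp (- \<rho> * t)" by (simp add: D_def A_def algebra_simps)
      finally show "dn (sol x0 x1 F t) \<le> D * exp (- \<rho> * t)" .
    qed
    have fsol_bd: "norm (f (sol x0 x1 F t)) \<le> exp (- \<sigma> * t) * (\<eta> / 2)"
      if F: "forced \<sigma> \<eta> F" and t: "t \<ge> 0" for F t
    proof -
      have "norm (f (sol x0 x1 F t) - f 0) \<le> 2 * L * D powr p * exp (- (p * \<rho>) * t) * dn (sol x0 x1 F t - 0)"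
        using D by (intro fest sol_bd F t zero_in_D12) (simp add: zero_in_D12)
      also have "\<dots> \<le> 2 * L * D powr p * exp (- (p * \<rho>) * t) * (A * exp (- \<rho> * t) * \<eta>)"
        using sol_bd(2)[OF F t] L by (intro mult_left_mono) (auto simp: D_def mult_ac)
      also have "\<dots> \<le> exp (- \<sigma> * t) * (\<eta> / 2)" by (rule contract) (use \<eta> in simp)
      finally show ?thesis by (simp add: f0)
    qed
    have fsol_cont: "continuous_on {0..} (\<lambda>t. f (sol x0 x1 F t))" if F: "forced \<sigma> \<eta> F" for F
      unfolding continuous_on_def
    proof
      fix t :: real assume "t \<in> {0..}"
      then have t: "t \<ge> 0" by simp
      \<comment> \<open>Continuity needs only a radius that is uniform in time, so the Lipschitz
        estimate is invoked with its time parameter equal to 0.\<close>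
      have le: "dn (sol x0 x1 F s) \<le> D * exp (- \<rho> * 0)" if "s \<ge> 0" for s
      proof -
        have "D * exp (- \<rho> * s) \<le> D * exp (- \<rho> * 0)" using D \<rho> that by (intro mult_left_mono) auto
        then show ?thesis using sol_bd(2)[OF F that] by linarith
      qed
      have "((\<lambda>s. 2 * L * D powr p * exp (- (p * \<rho>) * 0) * dn (sol x0 x1 F s - sol x0 x1 F t)) \<longlongrightarrow>
          2 * L * D powr p * exp (- (p * \<rho>) * 0) * 0) (at t within {0..})"
        using sol_weak_sol(1)[OF x0 F sg\<sigma> sg0, of x1] t unfolding weak_sol_def by (intro tendsto_mult_left) blast
      moreover have "\<forall>\<^sub>F s in at t within {0..}. norm (f (sol x0 x1 F s) - f (sol x0 x1 F t)) \<le>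
          2 * L * D powr p * exp (- (p * \<rho>) * 0) * dn (sol x0 x1 F s - sol x0 x1 F t)"
        unfolding eventually_at_filter
        by (rule always_eventually) (auto intro!: fest[of 0, simplified] sol_bd(1)[OF F] le[simplified] t)
      ultimately have "((\<lambda>s. f (sol x0 x1 F s) - f (sol x0 x1 F t)) \<longlongrightarrow> 0) (at t within {0..})"
        unfolding mult_zero_right by (rule Lim_null_comparison[rotated])
      then show "((\<lambda>s. f (sol x0 x1 F s)) \<longlongrightarrow> f (sol x0 x1 F t)) (at t within {0..})"
        by (rule Lim_null[THEN iffD2])
    qed
    have fsol_lip: "norm (f (sol x0 x1 F t) - f (sol x0 x1 G t)) \<le> exp (- \<sigma> * t) * (d / 2)"
      if F: "forced \<sigma> \<eta> F" and G: "forced \<sigma> \<eta> G" and FG: "forced \<sigma> d (\<lambda>s. F s - G s)"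
        and t: "t \<ge> 0" and d: "d \<ge> 0" for F G d t
    proof -
      \<comment> \<open>The homogeneous parts have the same data and cancel.\<close>
      have "sol x0 x1 F t - sol x0 x1 G t = W (\<lambda>s. F s - G s) t"
        using W_diff[OF F G FG sg\<sigma> t] sol_weak_sol(2)[OF x0 F sg\<sigma> sg0 t] sol_weak_sol(2)[OF x0 G sg\<sigma> sg0 t] by simp
      then have "dn (sol x0 x1 F t - sol x0 x1 G t) \<le> C * exp (- sg * t) * (d / (\<sigma> - sg))"
        using W_bound(1)[OF FG sg\<sigma> t] by simp
      also have "\<dots> = C / (\<sigma> - sg) * exp (- sg * t) * d" by simp
      also have "\<dots> \<le> A * exp (- \<rho> * t) * d"
        using sgr[OF t] Cs C1 A d unfolding A_def by (intro mult_right_mono mult_mono) auto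
      finally have 1: "dn (sol x0 x1 F t - sol x0 x1 G t) \<le> A * exp (- \<rho> * t) * d" .
      have "norm (f (sol x0 x1 F t) - f (sol x0 x1 G t)) \<le>
         2 * L * D powr p * exp (- (p * \<rho>) * t) * dn (sol x0 x1 F t - sol x0 x1 G t)"
        by (intro fest sol_bd F G t)
      also have "\<dots> \<le> 2 * L * D powr p * exp (- (p * \<rho>) * t) * (A * exp (- \<rho> * t) * d)"
        using 1 L by (intro mult_left_mono) auto
      also have "\<dots> \<le> exp (- \<sigma> * t) * (d / 2)" by (rule contract[OF d])
      finally show ?thesis .
    qed
    define \<Phi> :: "(real \<Rightarrow>\<^sub>C 'a) \<Rightarrow> real \<Rightarrow> 'a" where
      "\<Phi> = (\<lambda>\<phi> s. exp (- \<sigma> * s) *\<^sub>R apply_bcontfun \<phi> s)"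
    txt \<open>The unknown of the fixed point problem is the rescaled forcing, extended constantly to negative times.\<close>
    define T where "T = (\<lambda>\<phi> t. exp (\<sigma> * max t 0) *\<^sub>R f (sol x0 x1 (\<Phi> \<phi>) (max t 0)))"
    have \<Phi>: "forced \<sigma> \<eta> (\<Phi> \<phi>)" if "\<phi> \<in> cball 0 \<eta>" for \<phi>
    proof -
      have "norm (apply_bcontfun \<phi> s) \<le> \<eta>" for s
        using norm_bounded[of \<phi> s] that by simp
      then show ?thesis unfolding forced_def \<Phi>_def by (auto intro!: continuous_intros)
    qed
    have \<Phi>d: "forced \<sigma> (dist \<phi> \<psi>) (\<lambda>s. \<Phi> \<phi> s - \<Phi> \<psi> s)" for \<phi> \<psi>
    proof -
      have "norm (\<Phi> \<phi> s - \<Phi> \<psi> s) \<le> dist \<phi> \<psi> * exp (- \<sigma> * s)" for s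
      proof -
        have "norm (\<Phi> \<phi> s - \<Phi> \<psi> s) = exp (- \<sigma> * s) * dist (apply_bcontfun \<phi> s) (apply_bcontfun \<psi> s)"
          unfolding \<Phi>_def scaleR_diff_right[symmetric] by (simp add: dist_norm)
        then show ?thesis using dist_bounded[of \<phi> s \<psi>] by simp
      qed
      then show ?thesis unfolding forced_def by (auto simp: \<Phi>_def intro!: continuous_intros)
    qed
    have exp_cancel: "exp (\<sigma> * t) * (exp (- \<sigma> * t) * x) = x" for t x :: real
      by (simp add: exp_minus)
    have T_bd: "norm (T \<phi> t) \<le> \<eta> / 2" if "\<phi> \<in> cball 0 \<eta>" for \<phi> t
    proof -
      have "norm (T \<phi> t) = exp (\<sigma> * max t 0) * norm (f (sol x0 x1 (\<Phi> \<phi>) (max t 0)))"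
        by (simp add: T_def)
      also have "\<dots> \<le> exp (\<sigma> * max t 0) * (exp (- \<sigma> * max t 0) * (\<eta> / 2))"
        by (intro mult_left_mono fsol_bd \<Phi> that) auto
      finally show ?thesis unfolding exp_cancel .
    qed
    have T_bcont: "T \<phi> \<in> bcontfun" if "\<phi> \<in> cball 0 \<eta>" for \<phi>
    proof (rule bcontfun_normI[OF _ T_bd[OF that]])
      show "continuous_on UNIV (T \<phi>)" unfolding T_def
        by (intro continuous_intros continuous_on_compose2[OF fsol_cont[OF \<Phi>[OF that]]]) auto
    qed
    have T_lip: "dist (T \<phi> t) (T \<psi> t) \<le> dist \<phi> \<psi> / 2" if "\<phi> \<in> cball 0 \<eta>" "\<psi> \<in> cball 0 \<eta>" for \<phi> \<psi> t
    proof -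
      have "dist (T \<phi> t) (T \<psi> t) = exp (\<sigma> * max t 0) *
          norm (f (sol x0 x1 (\<Phi> \<phi>) (max t 0)) - f (sol x0 x1 (\<Phi> \<psi>) (max t 0)))"
        unfolding T_def dist_norm scaleR_diff_right[symmetric] by simp
      also have "\<dots> \<le> exp (\<sigma> * max t 0) * (exp (- \<sigma> * max t 0) * (dist \<phi> \<psi> / 2))"
        by (intro mult_left_mono fsol_lip \<Phi> \<Phi>d that) auto
      finally show ?thesis unfolding exp_cancel .
    qed
    \<comment> \<open>The ball is where \<open>T\<close> has been shown to be bounded and continuous
      and to contract by 1/2; its image even lies in the ball of half the radius.\<close>
    have "\<exists>!\<phi>\<in>cball 0 \<eta>. Bcontfun (T \<phi>) = \<phi>"
    proof (rule Banach_fix[where c = "1 / 2"])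
      show "complete (cball (0 :: real \<Rightarrow>\<^sub>C 'a) \<eta>)" by (simp add: complete_eq_closed)
      show "cball (0 :: real \<Rightarrow>\<^sub>C 'a) \<eta> \<noteq> {}" using \<eta>(1) by simp
      show "(\<lambda>\<phi>. Bcontfun (T \<phi>)) ` cball 0 \<eta> \<subseteq> cball 0 \<eta>"
      proof
        fix \<psi> assume "\<psi> \<in> (\<lambda>\<phi>. Bcontfun (T \<phi>)) ` cball 0 \<eta>"
        then obtain \<phi> where \<phi>: "\<phi> \<in> cball 0 \<eta>" "\<psi> = Bcontfun (T \<phi>)" by blast
        have "norm \<psi> \<le> \<eta> / 2" unfolding \<phi>(2)
          by (rule norm_bound) (simp only: Bcontfun_inverse[OF T_bcont[OF \<phi>(1)]] T_bd[OF \<phi>(1)])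
        then show "\<psi> \<in> cball 0 \<eta>" using \<eta>(1) by simp
      qed
      show "dist (Bcontfun (T \<phi>)) (Bcontfun (T \<psi>)) \<le> 1 / 2 * dist \<phi> \<psi>"
        if "\<phi> \<in> cball 0 \<eta>" "\<psi> \<in> cball 0 \<eta>" for \<phi> \<psi>
        using T_lip[OF that] by (intro dist_bound)
          (simp only: Bcontfun_inverse[OF T_bcont[OF that(1)]] Bcontfun_inverse[OF T_bcont[OF that(2)]], simp)
    qed simp_all
    then obtain \<phi> where \<phi>: "\<phi> \<in> cball 0 \<eta>" "Bcontfun (T \<phi>) = \<phi>" by blast
    define F where "F = \<Phi> \<phi>"
    have F: "forced \<sigma> \<eta> F" unfolding F_def by (rule \<Phi>[OF \<phi>(1)])
    \<comment> \<open>Undoing the rescaling for nonnegative times turns the fixed point into the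
      statement that the forcing is \<open>f\<close> along the solution it generates.\<close>
    have fixp: "F t = f (sol x0 x1 F t)" if "t \<ge> 0" for t
    proof -
      have "apply_bcontfun \<phi> t = T \<phi> t" using Bcontfun_inverse[OF T_bcont[OF \<phi>(1)]] \<phi>(2) by simp
      then have "F t = exp (- \<sigma> * t) *\<^sub>R exp (\<sigma> * t) *\<^sub>R f (sol x0 x1 F t)"
        using that unfolding F_def T_def by (subst \<Phi>_def) (simp add: max_def)
      then show ?thesis by (simp add: exp_minus)
    qed
    define u u' where "u = sol x0 x1 F" and "u' = dsol x0 x1 F"
    have u: "u t = hom x0 x1 t + W F t" "u' t = dhom x0 x1 t + dW F t" if "t \<ge> 0" for t
      unfolding u_def u'_def using sol_weak_sol(2,3)[OF x0 F sg\<sigma> sg0 that] by auto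
    have h0: "hom x0 x1 0 = x0" "dhom x0 x1 0 = x1"
      using hom_sol_hom[OF x0, of x1] by (auto simp: hom_sol_def)
    have gl: "global_sol \<delta> lam e K f R0 u u'"
      unfolding global_sol_def
    proof (intro conjI allI impI)
      show "weak_sol \<delta> lam e K (\<lambda>t. f (u t)) u u'"
        using weak_sol_cong[OF sol_weak_sol(1)[OF x0 F sg\<sigma> sg0, of x1] fixp] by (simp add: u_def u'_def)
      fix t :: real assume t: "t \<ge> 0"
      have "D * exp (- \<rho> * t) \<le> D * 1" using D \<rho> t by (intro mult_left_mono) auto
      then have "dn (u t) < R0" using sol_bd(2)[OF F t] D unfolding u_def by linarith
      then show "u t \<in> ballD lam e K R0" using sol_bd(1)[OF F t] by (simp add: ballD_def u_def)
    qed
    \<comment> \<open>Subtracting the pure part leaves the fast homogeneous part and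
      \<open>W F\<close>. Both decay at the rate \<open>sg\<close>, so a positive exponent
      \<open>sg - r0\<close> remains after multiplication by \<open>exp (r0 * t)\<close>.\<close>
    have lim: "((\<lambda>t. (norm (u' t - v' t) + dn (u t - v t)) * exp (r0 * t)) \<longlongrightarrow> 0) at_top"
      if v: "hom_sol \<delta> lam e K v0 v1 v v'" for v v'
    proof (rule tendsto_sandwich)
      show "\<forall>\<^sub>F t in at_top. 0 \<le> (norm (u' t - v' t) + dn (u t - v t)) * exp (r0 * t)"
        by (intro always_eventually allI mult_nonneg_nonneg add_nonneg_nonneg dnorm_nonneg) auto
      show "((\<lambda>t. 2 * D * exp (- ((sg - r0) * t))) \<longlongrightarrow> 0) at_top"
      proof -
        have "filterlim (\<lambda>t. (sg - r0) * t) at_top at_top"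
          using sg by (intro filterlim_tendsto_pos_mult_at_top[OF tendsto_const]) (auto simp: filterlim_ident)
        then have "((\<lambda>t. exp (- ((sg - r0) * t))) \<longlongrightarrow> 0) at_top"
          by (intro filterlim_compose[OF exp_at_bot] filterlim_compose[OF filterlim_uminus_at_bot_at_top])
        then show ?thesis by (rule tendsto_mult_right_zero)
      qed
      show "\<forall>\<^sub>F t in at_top. (norm (u' t - v' t) + dn (u t - v t)) * exp (r0 * t) \<le> 2 * D * exp (- ((sg - r0) * t))"
        using eventually_ge_at_top[of 0]
      proof eventually_elim
        case (elim t)
        have vt: "v t = hom v0 v1 t" "v' t = dhom v0 v1 t" using hom_sol_unique[OF vz(1) v elim] by auto
        have "u t - v t = hom z0 z1 t + W F t" "u' t - v' t = dhom z0 z1 t + dW F t"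
          unfolding u[OF elim] vt x0_def x1_def hom_add[OF vz elim] by simp_all
        then have "dn (u t - v t) \<le> dn (hom z0 z1 t) + dn (W F t)"
          "norm (u' t - v' t) \<le> norm (dhom z0 z1 t) + norm (dW F t)"
          using dnorm_add[OF hom_in_D12[OF vz(2) elim] W_in_D12[OF F sg\<sigma> elim]] norm_triangle_ineq by auto
        moreover have "C1 * exp (- sg * t) * (dn z0 + norm z1) + C * exp (- sg * t) * (\<eta> / (\<sigma> - sg)) \<le> D * exp (- sg * t)"
        proof -
          have "dn z0 + norm z1 \<le> \<eta>" using small dnorm_nonneg[of v0] norm_ge_zero[of v1] by linarith
          then have "C1 * exp (- sg * t) * (dn z0 + norm z1) \<le> C1 * exp (- sg * t) * \<eta>"
            using C1 by (intro mult_left_mono) auto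
          then show ?thesis by (simp add: D_def A_def algebra_simps)
        qed
        ultimately have "dn (u t - v t) \<le> D * exp (- sg * t)" "norm (u' t - v' t) \<le> D * exp (- sg * t)"
          using add_mono[OF fast_decay(1)[OF fast elim] W_bound(1)[OF F sg\<sigma> elim]]
            add_mono[OF fast_decay(2)[OF fast elim] W_bound(2)[OF F sg\<sigma> elim]]
          by (blast intro: order_trans)+
        then have "norm (u' t - v' t) + dn (u t - v t) \<le> 2 * D * exp (- sg * t)" by simp
        then have "(norm (u' t - v' t) + dn (u t - v t)) * exp (r0 * t) \<le> 2 * D * exp (- sg * t) * exp (r0 * t)"
          by (rule mult_right_mono) simp
        also have "\<dots> = 2 * D * (exp (- sg * t) * exp (r0 * t))" by simp
        also have "exp (- sg * t) * exp (r0 * t) = exp (- ((sg - r0) * t))"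
          unfolding exp_add[symmetric] by (simp add: algebra_simps)
        finally show ?case .
      qed
    qed simp
    show "\<exists>w0 w1. slow_pair \<delta> lam e K r0 w0 w1 \<and>
          (\<exists>u u'. global_sol \<delta> lam e K f R0 u u' \<and>
             u 0 = v0 + z0 + w0 \<and> u' 0 = v1 + z1 + w1 \<and>
             (\<forall>v v'. hom_sol \<delta> lam e K v0 v1 v v' \<longrightarrow>
                ((\<lambda>t. (norm (u' t - v' t) + dn (u t - v t)) * exp (r0 * t)) \<longlongrightarrow> 0) at_top))"
      using W_slow[OF F sg\<sigma>] gl lim u[of 0] h0 unfolding x0_def x1_def
      by (intro exI[of _ "W F 0"] exI[of _ "dW F 0"] exI[of _ u] exI[of _ u'] conjI) auto
  qed
qed

end

section \<open>Spectral gaps and the choice of exponents\<close>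

lemma finite_pos_lower_bound:
  fixes X :: "real set"
  assumes "finite X" "\<And>x. x \<in> X \<Longrightarrow> x > 0"
  \<comment> \<open>The bound must exist also for an empty set, as when no eigenvalue lies below
    \<open>\<delta>\<^sup>2\<close> or no rate exceeds \<open>r0\<close>; this is why 1 is inserted
    in the witness.\<close>
  obtains g where "g > 0" "\<And>x. x \<in> X \<Longrightarrow> g \<le> x"
proof (rule that[of "Min (insert 1 X)"])
  show "Min (insert 1 X) > 0" using assms by (subst Min_gr_iff) auto
  show "Min (insert 1 X) \<le> x" if "x \<in> X" for x using assms(1) that by (intro Min_le) auto
qed

text \<open>Infinitely many eigenvalues do no harm: all those above \<open>\<delta>\<^sup>2\<close>
  contribute the single rate \<delta>.\<close>

lemma finite_rates:
  assumes "finite {l \<in> spec lam K. l \<le> \<delta>\<^sup>2}"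
  shows "finite (\<Union>k\<in>K. rates \<delta> (lam k))"
proof (rule finite_subset)
  show "(\<Union>k\<in>K. rates \<delta> (lam k)) \<subseteq> insert \<delta> (\<Union>l\<in>{l \<in> spec lam K. l \<le> \<delta>\<^sup>2}. rates \<delta> l)"
  proof
    fix r assume "r \<in> (\<Union>k\<in>K. rates \<delta> (lam k))"
    then obtain k where k: "k \<in> K" "r \<in> rates \<delta> (lam k)" by blast
    show "r \<in> insert \<delta> (\<Union>l\<in>{l \<in> spec lam K. l \<le> \<delta>\<^sup>2}. rates \<delta> l)"
    proof (cases "lam k \<le> \<delta>\<^sup>2")
      case True
      then show ?thesis using k by (auto simp: spec_def)
    next
      case False
      then show ?thesis using k by (simp add: rates_def)
    qed
  qed
  show "finite (insert \<delta> (\<Union>l\<in>{l \<in> spec lam K. l \<le> \<delta>\<^sup>2}. rates \<delta> l))"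
    using assms by (auto simp: rates_def)
qed

theorem theorem3p2:
  fixes \<delta> R0 p L :: real
    and lam :: "nat \<Rightarrow> real"
    and e :: "nat \<Rightarrow> 'a::{real_inner,complete_space}"
    and K :: "nat set"
    and f :: "'a \<Rightarrow> 'a"
  assumes delta_pos: "\<delta> > 0"
    and basis: "onb e K"
    and nonneg: "\<forall>k\<in>K. lam k \<ge> 0"
    and discrete: "\<forall>M. finite {l \<in> spec lam K. l \<le> M}"
    and R0_pos: "R0 > 0"
    and f0: "f 0 = 0"
    and p_pos: "p > 0" and L_nonneg: "L \<ge> 0"
    and f_lip: "\<forall>u \<in> ballD lam e K R0. \<forall>v \<in> ballD lam e K R0.
        norm (f u - f v) \<le> L * (dnorm lam e K u powr p + dnorm lam e K v powr p) * dnorm lam e K (u - v)"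
  shows "\<forall>r0 \<in> Dset \<delta> lam K. r0 > 0 \<longrightarrow>
    (\<exists>\<epsilon>0 > 0. \<forall>v0 v1 z0 z1.
       pure_pair \<delta> lam e K r0 v0 v1 \<longrightarrow> fast_pair \<delta> lam e K r0 z0 z1 \<longrightarrow>
       norm v1 + dnorm lam e K v0 + norm z1 + dnorm lam e K z0 \<le> \<epsilon>0 \<longrightarrow>
       (\<exists>w0 w1. slow_pair \<delta> lam e K r0 w0 w1 \<and>
          (\<exists>u u'. global_sol \<delta> lam e K f R0 u u' \<and>
             u 0 = v0 + z0 + w0 \<and> u' 0 = v1 + z1 + w1 \<and>
             (\<forall>v v'. hom_sol \<delta> lam e K v0 v1 v v' \<longrightarrow>
                ((\<lambda>t. (norm (u' t - v' t) + dnorm lam e K (u t - v t)) * exp (r0 * t))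
                   \<longlongrightarrow> 0) at_top))))"
proof (intro ballI impI)
  fix r0 assume "r0 \<in> Dset \<delta> lam K" and r0: "r0 > 0"
  have fin: "finite {l \<in> spec lam K. l \<le> \<delta>\<^sup>2}" using discrete by blast
  \<comment> \<open>Half the smallest distance between the two rates of a mode below the critical
    eigenvalue.\<close>
  obtain g where g: "g > 0" "\<And>x. x \<in> (\<lambda>l. sqrt (\<delta>\<^sup>2 - l)) ` {l \<in> spec lam K. l < \<delta>\<^sup>2} \<Longrightarrow> g \<le> x"
  proof (rule finite_pos_lower_bound)
    show "finite ((\<lambda>l. sqrt (\<delta>\<^sup>2 - l)) ` {l \<in> spec lam K. l < \<delta>\<^sup>2})"
      by (rule finite_imageI, rule finite_subset[OF _ fin]) auto
  qed auto
  \<comment> \<open>A lower bound for the distance from \<open>r0\<close> to the fast rates.\<close>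
  obtain d where d: "d > 0" "\<And>x. x \<in> (\<lambda>r. r - r0) ` {r \<in> (\<Union>k\<in>K. rates \<delta> (lam k)). r > r0} \<Longrightarrow> d \<le> x"
  proof (rule finite_pos_lower_bound)
    show "finite ((\<lambda>r. r - r0) ` {r \<in> (\<Union>k\<in>K. rates \<delta> (lam k)). r > r0})"
      by (rule finite_imageI, rule finite_subset[OF _ finite_rates[OF fin]]) auto
  qed auto
  txt \<open>The pure part may carry a factor \<open>t\<close> (if \<open>r0 = \<delta>\<close>), whence the loss from \<open>r0\<close> to \<open>\<rho>\<close>; the order of \<open>f\<close>
    recovers a rate \<open>(1 + p)\<rho>\<close> above \<open>sg > r0\<close>.\<close>
  define \<rho> where "\<rho> = r0 * (1 + p / 2) / (1 + p)"
  have "(1 + p) * \<rho> = r0 * (1 + p / 2)" using p_pos by (simp add: \<rho>_def)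
  then have pr: "(1 + p) * \<rho> = r0 + r0 * p / 2" by (simp add: distrib_left)
  have \<rho>: "0 < \<rho>" "\<rho> < r0" using r0 p_pos by (auto simp: \<rho>_def divide_simps)
  \<comment> \<open>Halfway from \<open>r0\<close> to the smaller of \<open>r0 + d\<close> and (1 +
    p)\<rho>, the latter being \<open>r0 + r0 * p / 2\<close>.\<close>
  define sg where "sg = r0 + min d (r0 * p / 2) / 2"
  have rp: "r0 * p / 2 > 0" using r0 p_pos by simp
  have sg: "r0 < sg" "sg < r0 + d" "sg < (1 + p) * \<rho>"
    unfolding pr sg_def using d(1) rp by linarith+
  \<comment> \<open>One margin for all four estimates: \<open>r0 - \<rho>\<close> for the pure part,
    \<open>sg - r0\<close> for the slow part backwards, \<open>r0 + d - sg\<close> for the fast part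
    forwards, and 1 for the crude growth bound.\<close>
  define c where "c = min 1 (min (r0 - \<rho>) (min (sg - r0) (r0 + d - sg)))"
  have c: "c > 0" "c \<le> 1" "c \<le> r0 - \<rho>" "c \<le> sg - r0" "c \<le> r0 + d - sg"
    unfolding c_def using \<rho> sg by auto
  obtain C where C: "C > 0" and est: "\<And>l Q s t. l \<ge> 0 \<Longrightarrow> (l < \<delta>\<^sup>2 \<Longrightarrow> sqrt (\<delta>\<^sup>2 - l) \<ge> g) \<Longrightarrow>
       (\<And>r. r \<in> rates \<delta> l \<Longrightarrow> Q r \<Longrightarrow> (s - r) * t \<le> - c * \<bar>t\<bar>) \<Longrightarrow>
       sqrt (1 + l) * \<bar>fund \<delta> l Q t\<bar> \<le> C * exp (- s * t) \<and> \<bar>dfund \<delta> l Q t\<bar> \<le> C * exp (- s * t)"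
    using fund_bounds[OF delta_pos c(1) g(1)] by metis
  have gap: "sqrt (\<delta>\<^sup>2 - lam k) \<ge> g" if "k \<in> K" "lam k < \<delta>\<^sup>2" for k
    using g(2)[of "sqrt (\<delta>\<^sup>2 - lam k)"] that by (auto simp: spec_def)
  have fast_gap: "r0 + d \<le> r" if "k \<in> K" "r \<in> rates \<delta> (lam k)" "r > r0" for k r
  proof -
    have "r - r0 \<in> (\<lambda>r. r - r0) ` {r \<in> (\<Union>k\<in>K. rates \<delta> (lam k)). r > r0}" using that by blast
    then show ?thesis using d(2) by fastforce
  qed
  have up: "(s - r) * t \<le> - c * \<bar>t\<bar>" if "t \<ge> 0" "s - r \<le> - c" for s r t
    using mult_right_mono[OF that(2,1)] that(1) by simp
  have down: "(s - r) * t \<le> - c * \<bar>t\<bar>" if "t \<le> 0" "c \<le> s - r" for s r t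
    using mult_right_mono_neg[OF that(2,1)] that(1) by simp
  interpret damped e K lam \<delta> r0 \<rho> sg C
  proof unfold_locales
    show "onb e K" by (rule basis)
    show lam0: "lam k \<ge> 0" if "k \<in> K" for k using nonneg that by blast
    show "\<delta> > 0" "C > 0" by (rule delta_pos C)+
    fix k t assume k: "k \<in> K"
    note E = est[OF lam0[OF k] gap[OF k]]
    show "sqrt (1 + lam k) * \<bar>fund \<delta> (lam k) (\<lambda>r. r \<le> r0) t\<bar> \<le> C * exp (- sg * t) \<and>
      \<bar>dfund \<delta> (lam k) (\<lambda>r. r \<le> r0) t\<bar> \<le> C * exp (- sg * t)" if "t \<le> 0"
      by (rule E, assumption, rule down[OF that]) (use c in linarith)
    show "sqrt (1 + lam k) * \<bar>fund \<delta> (lam k) (\<lambda>r. \<not> r \<le> r0) t\<bar> \<le> C * exp (- sg * t) \<and>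
      \<bar>dfund \<delta> (lam k) (\<lambda>r. \<not> r \<le> r0) t\<bar> \<le> C * exp (- sg * t)" if "t \<ge> 0"
    proof (rule E, assumption, rule up[OF that])
      fix r assume "r \<in> rates \<delta> (lam k)" "\<not> r \<le> r0"
      then show "sg - r \<le> - c" using fast_gap[OF k, of r] c by linarith
    qed
    show "sqrt (1 + lam k) * \<bar>fund \<delta> (lam k) (\<lambda>r. r = r0) t\<bar> \<le> C * exp (- \<rho> * t) \<and>
      \<bar>dfund \<delta> (lam k) (\<lambda>r. r = r0) t\<bar> \<le> C * exp (- \<rho> * t)" if "t \<ge> 0"
      by (rule E, assumption, rule up[OF that]) (use c in linarith)
    show "sqrt (1 + lam k) * \<bar>fund \<delta> (lam k) Q t\<bar> \<le> C * exp t \<and> \<bar>dfund \<delta> (lam k) Q t\<bar> \<le> C * exp t"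
      if "t \<ge> 0" for Q
    proof -
      \<comment> \<open>The comparison rate is -1: all rates are nonnegative, so the margin
        \<open>c\<close>, at most 1, is available for any selection of pieces.\<close>
      have "sqrt (1 + lam k) * \<bar>fund \<delta> (lam k) Q t\<bar> \<le> C * exp (- (- 1) * t) \<and>
          \<bar>dfund \<delta> (lam k) Q t\<bar> \<le> C * exp (- (- 1) * t)"
      proof (rule E, assumption, rule up[OF that])
        fix r assume "r \<in> rates \<delta> (lam k)"
        then show "- 1 - r \<le> - c" using rates_nonneg[OF lam0[OF k] delta_pos] c(2) by fastforce
      qed
      then show ?thesis by simp
    qed
  qed
  show "\<exists>\<epsilon>0 > 0. \<forall>v0 v1 z0 z1.
       pure_pair \<delta> lam e K r0 v0 v1 \<longrightarrow> fast_pair \<delta> lam e K r0 z0 z1 \<longrightarrow>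
       norm v1 + dnorm lam e K v0 + norm z1 + dnorm lam e K z0 \<le> \<epsilon>0 \<longrightarrow>
       (\<exists>w0 w1. slow_pair \<delta> lam e K r0 w0 w1 \<and>
          (\<exists>u u'. global_sol \<delta> lam e K f R0 u u' \<and>
             u 0 = v0 + z0 + w0 \<and> u' 0 = v1 + z1 + w1 \<and>
             (\<forall>v v'. hom_sol \<delta> lam e K v0 v1 v v' \<longrightarrow>
                ((\<lambda>t. (norm (u' t - v' t) + dnorm lam e K (u t - v t)) * exp (r0 * t))
                   \<longlongrightarrow> 0) at_top)))"
    by (rule asymptotic_solution[OF L_nonneg p_pos R0_pos f0 f_lip \<rho> sg(1,3)])
qed

end
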